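(* In the setting of killed Feller processes described in the context, suppose that: (i) $G^D(C_b(D))\subset C_0(D)$; (ii) there exists a positive right eigenfunction $h\in C_0(D)$ for $G^D$; (iii) there exist an open set $U\subset M$ which is $D$-accessible from all $x\in D$, a nontrivial measure $\xi$ on $D$, and $T>0$ such that for all $x\in U$ (with $x\in D$), $P_T^D(x,\cdot)\ge\xi(\cdot)$. Then there exist a quasi-stationary distribution (QSD) $\mu$ for $(P_t^D)$ and constants $C,\alpha>0$ such that, for every probability measure $\rho$ on $D$ and all $t\ge0$, $$\left\|\frac{\rho P_t^D}{\rho P_t^D\mathbf 1_D}-\mu(\cdot)\right\|_{TV}\le\frac{C}{\rho(h)}e^{-\alpha t},$$ where $\|\cdot\|_{TV}$ is the total variation distance and $\rho(h)=\int h\,d\rho$.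
   Context: $M$ is a separable, locally compact metric space with metric $d$; $D\subset M$ is a nonempty set with compact closure $K=\overline D$ such that $D$ is open relative to $K$; $\partial_KD=K\setminus D$. $(P_t)_{t\ge0}$ is a Markov Feller semigroup on $M$: a semigroup of Markov operators on $C_0(M)$ (sup-norm closure of continuous compactly supported functions) with $P_tf\to f$ uniformly as $t\to0$ for all $f\in C_0(M)$. $(X_t)$ is an associated càdlàg Markov process on a filtered space with right-continuous complete filtration, with laws $(\mathbb P_x)_{x\in M}$, $\mathbb P_x(X_0=x)=1$. $\tau_D^{out}=\inf\{t\ge0:X_t\notin D\}$. Standing hypothesis: $M\setminus K$ is accessible from every $x\in K$, i.e. for every $x\in K$ there is $t\ge0$ with $P_t(x,M\setminus K)>0$. $B(D)$: bounded measurable functions $D\to\mathbb R$; $C_b(D)$: bounded continuous functions on $D$; $C_0(D)$: sup-norm closure of the continuous compactly supported functions on $D$, equivalently those $f\in C_b(D)$ with $f(x)\to0$ when $d(x,\partial_KD)\to0$. Killed semigroup: $P_t^Df(x)=\mathbb E_x(f(X_t)\mathbf 1_{\tau_D^{out}>t})$ for $f\in B(D)$, $x\in D$, and $P_t^D(x,A)=P_t^D\mathbf 1_{A\cap D}(x)$. Green kernel: $G^Df(x)=\int_0^\infty P_t^Df(x)\,dt$ (a bounded operator on $B(D)$). An open set $U\subset M$ is $D$-accessible from $x\in D$ if $P_t^D(x,U)>0$ for some $t\ge0$. A positive right eigenfunction for $G^D$ is $h\in B(D)$ with $h(x)>0$ for all $x\in D$ and $G^Dh=\frac1\lambda h$ for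 some $\lambda>0$. A QSD for $(P_t^D)$ is a probability measure $\mu$ on $D$ such that, for some $\lambda>0$, $\mu P_t^D=e^{-\lambda t}\mu$ for all $t\ge0$. *)

theory Defs
  imports "HOL-Probability.Probability"
begin

text \<open>
  Functions and measures on a subset \<open>S\<close> of the space: a function on \<open>S\<close> is a total function
  of which only the values on \<open>S\<close> matter, and a measure on \<open>S\<close> is a measure on
  \<open>restrict_space borel S\<close>. The separable metric space \<open>M\<close> is the type \<open>'a\<close>; for metric
  spaces, separability is the type class \<open>second_countable_topology\<close>.
\<close>

definition bounded_measurable_on :: "'a::metric_space set \<Rightarrow> ('a \<Rightarrow> real) set" where
  "bounded_measurable_on S =
     {f. f \<in> borel_measurable (restrict_space borel S) \<and> bounded (f ` S)}"

definition bounded_continuous_on :: "'a::metric_space set \<Rightarrow> ('a \<Rightarrow> real) set" where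
  "bounded_continuous_on S = {f. continuous_on S f \<and> bounded (f ` S)}"

definition compactly_supported_on :: "'a::metric_space set \<Rightarrow> ('a \<Rightarrow> real) set" where
  "compactly_supported_on S =
     {f. continuous_on S f \<and> (\<exists>C. compact C \<and> C \<subseteq> S \<and> (\<forall>x\<in>S - C. f x = 0))}"

text \<open>The space \<open>C\<^sub>0(S)\<close>: the closure of \<open>C\<^sub>c(S)\<close> for the sup-norm over \<open>S\<close>.\<close>

definition vanishing_on :: "'a::metric_space set \<Rightarrow> ('a \<Rightarrow> real) set" where
  "vanishing_on S =
     {f. \<forall>\<epsilon>>0. \<exists>g\<in>compactly_supported_on S. \<forall>x\<in>S. \<bar>f x - g x\<bar> \<le> \<epsilon>}"

locale feller_semigroup =
  fixes P :: "real \<Rightarrow> 'a::{metric_space, second_countable_topology} \<Rightarrow> 'a measure"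
  assumes locally_compact: "locally_compact_space (euclidean :: 'a topology)"
    and kernel: "0 \<le> t \<Longrightarrow> P t \<in> borel \<rightarrow>\<^sub>M prob_algebra borel"
    and kernel_0: "P 0 x = return borel x"
    and kernel_add: "0 \<le> s \<Longrightarrow> 0 \<le> t \<Longrightarrow> P (s + t) x = P s x \<bind> P t"
    and feller: "0 \<le> t \<Longrightarrow> f \<in> vanishing_on UNIV \<Longrightarrow> (\<lambda>x. \<integral>y. f y \<partial>P t x) \<in> vanishing_on UNIV"
    and strongly_continuous:
      "f \<in> vanishing_on UNIV \<Longrightarrow> uniform_limit UNIV (\<lambda>t x. \<integral>y. f y \<partial>P t x) f (at_right 0)"

text \<open>
  A cadlag Markov process with semigroup \<open>P\<close>. The measure \<open>\<A>\<close> only provides the sample space and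
  its \<open>\<sigma>\<close>-algebra, and likewise \<open>F t\<close> only stands for a \<open>\<sigma>\<close>-algebra. Only times
  \<open>t \<ge> 0\<close> are meaningful. Completeness of the filtration is relative to the whole family of laws:
  a set is negligible if it is negligible under every \<open>Pr x\<close>.
\<close>

locale feller_process = feller_semigroup P
  for P :: "real \<Rightarrow> 'a::{metric_space, second_countable_topology} \<Rightarrow> 'a measure" +
  fixes \<A> :: "'w measure" and F :: "real \<Rightarrow> 'w measure"
    and Pr :: "'a \<Rightarrow> 'w measure" and X :: "real \<Rightarrow> 'w \<Rightarrow> 'a"
  assumes prob_law: "prob_space (Pr x)"
    and sets_law: "sets (Pr x) = sets \<A>"
    and filtration_subalgebra: "0 \<le> t \<Longrightarrow> subalgebra \<A> (F t)"
    and filtration_mono: "0 \<le> s \<Longrightarrow> s \<le> t \<Longrightarrow> sets (F s) \<subseteq> sets (F t)"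
    and filtration_right_continuous: "0 \<le> t \<Longrightarrow> (\<Inter>s\<in>{t<..}. sets (F s)) \<subseteq> sets (F t)"
    and filtration_complete:
      "0 \<le> t \<Longrightarrow> (\<And>x. \<exists>B\<in>null_sets (Pr x). N \<subseteq> B) \<Longrightarrow> N \<in> sets (F t)"
    and adapted: "0 \<le> t \<Longrightarrow> X t \<in> F t \<rightarrow>\<^sub>M borel"
    and right_continuous_paths:
      "\<omega> \<in> space \<A> \<Longrightarrow> 0 \<le> t \<Longrightarrow> ((\<lambda>s. X s \<omega>) \<longlongrightarrow> X t \<omega>) (at_right t)"
    and left_limits: "\<omega> \<in> space \<A> \<Longrightarrow> 0 < t \<Longrightarrow> \<exists>l. ((\<lambda>s. X s \<omega>) \<longlongrightarrow> l) (at_left t)"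
    and initial: "measure (Pr x) {\<omega> \<in> space \<A>. X 0 \<omega> = x} = 1"
    and markov_property:
      "0 \<le> s \<Longrightarrow> 0 \<le> t \<Longrightarrow> f \<in> bounded_measurable_on UNIV \<Longrightarrow>
        AE \<omega> in Pr x. real_cond_exp (Pr x) (F t) (\<lambda>\<omega>. f (X (t + s) \<omega>)) \<omega> = (\<integral>y. f y \<partial>P s (X t \<omega>))"

locale killed_feller_process = feller_process P \<A> F Pr X
  for P :: "real \<Rightarrow> 'a::{metric_space, second_countable_topology} \<Rightarrow> 'a measure"
    and \<A> :: "'w measure" and F Pr X +
  fixes D :: "'a set"
  assumes nonempty: "D \<noteq> {}"
    and compact_closure: "compact (closure D)"
    and relatively_open: "openin (top_of_set (closure D)) D"
    and accessible_outside:
      "x \<in> closure D \<Longrightarrow> \<exists>t\<ge>0. measure (P t x) (- closure D) > 0"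

definition exit_time :: "(real \<Rightarrow> 'w \<Rightarrow> 'a) \<Rightarrow> 'a set \<Rightarrow> 'w \<Rightarrow> ereal" where
  "exit_time X D \<omega> = (INF t\<in>{t. 0 \<le> t \<and> X t \<omega> \<notin> D}. ereal t)"

text \<open>\<open>P\<^sub>t\<^sup>D f(x)\<close>; the values of \<open>f\<close> outside \<open>D\<close> are irrelevant, as \<open>\<tau> > t\<close> forces \<open>X\<^sub>t \<in> D\<close>.\<close>

definition killed_semigroup ::
    "('a \<Rightarrow> 'w measure) \<Rightarrow> (real \<Rightarrow> 'w \<Rightarrow> 'a) \<Rightarrow> 'a set \<Rightarrow> real \<Rightarrow> ('a \<Rightarrow> real) \<Rightarrow> 'a \<Rightarrow> real" where
  "killed_semigroup Pr X D t f x =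
     (\<integral>\<omega>. f (X t \<omega>) * indicator {\<omega>. ereal t < exit_time X D \<omega>} \<omega> \<partial>Pr x)"

definition killed_kernel ::
    "('a \<Rightarrow> 'w measure) \<Rightarrow> (real \<Rightarrow> 'w \<Rightarrow> 'a) \<Rightarrow> 'a set \<Rightarrow> real \<Rightarrow> 'a \<Rightarrow> 'a set \<Rightarrow> real" where
  "killed_kernel Pr X D t x A = killed_semigroup Pr X D t (indicator (A \<inter> D)) x"

definition green ::
    "('a \<Rightarrow> 'w measure) \<Rightarrow> (real \<Rightarrow> 'w \<Rightarrow> 'a) \<Rightarrow> 'a set \<Rightarrow> ('a \<Rightarrow> real) \<Rightarrow> 'a \<Rightarrow> real" where
  "green Pr X D f x = (LINT t:{0..}|lborel. killed_semigroup Pr X D t f x)"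

definition D_accessible_from ::
    "('a \<Rightarrow> 'w measure) \<Rightarrow> (real \<Rightarrow> 'w \<Rightarrow> 'a) \<Rightarrow> 'a set \<Rightarrow> 'a set \<Rightarrow> 'a \<Rightarrow> bool" where
  "D_accessible_from Pr X D U x \<longleftrightarrow> (\<exists>t\<ge>0. killed_kernel Pr X D t x U > 0)"

definition positive_right_eigenfunction ::
    "('a::metric_space \<Rightarrow> 'w measure) \<Rightarrow> (real \<Rightarrow> 'w \<Rightarrow> 'a) \<Rightarrow> 'a set \<Rightarrow> ('a \<Rightarrow> real) \<Rightarrow> bool" where
  "positive_right_eigenfunction Pr X D h \<longleftrightarrow>
     h \<in> bounded_measurable_on D \<and> (\<forall>x\<in>D. h x > 0) \<and>
     (\<exists>\<kappa>>0. \<forall>x\<in>D. green Pr X D h x = 1 / \<kappa> * h x)"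

abbreviation prob_measures_on :: "'a::metric_space set \<Rightarrow> 'a measure set" where
  "prob_measures_on D \<equiv> space (prob_algebra (restrict_space borel D))"

text \<open>The measure \<open>\<rho> P\<^sub>t\<^sup>D\<close>, as a set function.\<close>

definition killed_law ::
    "('a \<Rightarrow> 'w measure) \<Rightarrow> (real \<Rightarrow> 'w \<Rightarrow> 'a) \<Rightarrow> 'a set \<Rightarrow> 'a measure \<Rightarrow> real \<Rightarrow> 'a set \<Rightarrow> real" where
  "killed_law Pr X D \<rho> t A = (\<integral>x. killed_kernel Pr X D t x A \<partial>\<rho>)"

definition quasi_stationary_distribution ::
    "('a::metric_space \<Rightarrow> 'w measure) \<Rightarrow> (real \<Rightarrow> 'w \<Rightarrow> 'a) \<Rightarrow> 'a set \<Rightarrow> 'a measure \<Rightarrow> bool" where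
  "quasi_stationary_distribution Pr X D \<mu> \<longleftrightarrow>
     \<mu> \<in> prob_measures_on D \<and>
     (\<exists>\<kappa>>0. \<forall>t\<ge>0. \<forall>A\<in>sets (restrict_space borel D).
        killed_law Pr X D \<mu> t A = exp (- \<kappa> * t) * measure \<mu> A)"

text \<open>
  Total variation distance on \<open>D\<close>, normalised as \<open>sup\<^sub>A \<bar>\<nu>\<^sub>1(A) - \<nu>\<^sub>2(A)\<bar>\<close> (half the mass of
  \<open>\<bar>\<nu>\<^sub>1 - \<nu>\<^sub>2\<bar>\<close>, for probability measures). It is extended-real valued so that no boundedness
  is presupposed in taking the supremum.
\<close>

definition tv_dist_on ::
    "'a::metric_space set \<Rightarrow> ('a set \<Rightarrow> real) \<Rightarrow> ('a set \<Rightarrow> real) \<Rightarrow> ereal" where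
  "tv_dist_on D \<nu>\<^sub>1 \<nu>\<^sub>2 = (SUP A\<in>sets (restrict_space borel D). ereal \<bar>\<nu>\<^sub>1 A - \<nu>\<^sub>2 A\<bar>)"

end

theory Submission
  imports Defs
begin

text \<open>
  Write \<open>Q\<^sub>t\<close> for the killed semigroup, \<open>G = \<integral>\<^sub>0\<^sup>\<infinity> Q\<^sub>t dt\<close> for the Green operator and \<open>K\<close> for the
  closure of \<open>D\<close>. The theorem follows from a Harris type contraction for the Doob transform
  \<open>f \<mapsto> e\<^sup>\<kappa>\<^sup>t Q\<^sub>t (h f) / h\<close> with Lyapunov function \<open>1 / h\<close>; without dividing by \<open>h\<close>, this is a statement
  about \<open>e\<^sup>\<kappa>\<^sup>t Q\<^sub>t\<close> on bounded functions with the sup-norm.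

  \<^item> Since \<open>Q\<^sub>s 1\<close> decreases in \<open>s\<close>, one has \<open>Q\<^sub>1 1 \<le> G 1\<close>, and \<open>G 1\<close> belongs to \<open>C\<^sub>0(D)\<close>. So \<open>G 1 \<le> \<epsilon>\<close>
    off a compact subset of \<open>D\<close>, and on that set \<open>h\<close> is bounded below: \<open>Q\<^sub>1 1 \<le> \<epsilon> + C h\<close> with
    \<open>\<epsilon>\<close> as small as desired. This is the drift condition.

  \<^item> Let \<open>f\<close> be continuous and positive exactly on \<open>U\<close>. Then \<open>G f\<close> is continuous and positive, hence
    bounded below on a compact \<open>L \<subseteq> D\<close>, so that the process started in \<open>L\<close> charges \<open>U\<close> at
    some time of a bounded interval \<open>[0, S]\<close>, which depends on the starting point. To get a minorization at one
    common time, note that \<open>\<xi> Q\<^sub>r \<ge> p \<xi>\<close> for all \<open>r\<close> in some interval \<open>[a, a + \<eta>]\<close>, and therefore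
    \<open>\<xi> Q\<^sub>r \<ge> p\<^sup>n \<xi>\<close> for all \<open>r\<close> in \<open>[n a, n (a + \<eta>)]\<close> (lemma \<open>renewal_bound\<close>); once \<open>n \<eta> \<ge> S\<close>
    the variable delay is absorbed (theorem \<open>harris_from_green\<close>).

  \<^item> The equation \<open>G h = h / \<kappa>\<close> gives \<open>Q\<^sub>t h = e\<^sup>-\<^sup>\<kappa>\<^sup>t h\<close> (lemma \<open>eigen_exponential\<close>).

  With these three facts the argument of Hairer and Mattingly (lemma \<open>weighted_contraction\<close>) yields
  \<open>\<bar>e\<^sup>\<kappa>\<^sup>t Q\<^sub>t f (x) h (x\<^sub>0) - \<Lambda> (f) h (x)\<bar> \<le> C e\<^sup>-\<^sup>\<alpha>\<^sup>t sup \<bar>f\<bar>\<close> (lemma \<open>rank_one_limit\<close>). The functional \<open>\<Lambda>\<close>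
  is a uniform limit of measures, hence a measure; \<open>\<mu> = \<Lambda> / \<Lambda> (1)\<close> is the quasi-stationary
  distribution, and dividing the estimate for \<open>f\<close> by the one for \<open>1\<close> gives the rate of convergence.

  All this presupposes that \<open>Q\<^sub>t\<close> is a semigroup of measurable kernels. The exit time from \<open>D\<close> is the hitting
  time of the union of the open set \<open>M - K\<close> and the compact set \<open>K - D\<close>, and the hitting time of a
  compact set by a cadlag path is not determined by countably many times: the path may approach the set
  from the left and jump away. The event \<open>alive 0 t\<close>, that the path stays in a compact subset of \<open>D\<close> until
  slightly after \<open>t\<close>, is determined by countably many times and implies \<open>t < \<tau>\<close>. Conversely,
  \<open>t < \<tau>\<close> implies \<open>alive 0 t\<close> almost surely, since a Feller process does not jump at a time that is announced by its
  approach to \<open>K - D\<close> (quasi-left-continuity, lemma \<open>dead_before_exit_null\<close>). The Markov property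
  for finitely many times then passes to the killed process by monotone approximation.
\<close>

section \<open>Semigroups of sub-Markov kernels\<close>

lemma abs_cross_diff_le:
  fixes a b c d :: real
  assumes "0 < c" "0 < d" shows "\<bar>a * c - b * d\<bar> \<le> \<bar>a\<bar> * c + \<bar>b\<bar> * d"
  using abs_triangle_ineq4[of "a * c" "b * d"] assms by (simp add: abs_mult)

text \<open>
  A semigroup of sub-probability kernels \<open>K t\<close> on \<open>D\<close>, stated through its action on bounded measurable functions.
  Right-continuity is needed for continuous test functions only.
\<close>

locale killed_kernels =
  fixes D :: "'a::{metric_space, second_countable_topology} set"
    and K :: "real \<Rightarrow> 'a \<Rightarrow> 'a measure"
  assumes D_nonempty: "D \<noteq> {}"
    and kernel: "0 \<le> t \<Longrightarrow> K t \<in> restrict_space borel D \<rightarrow>\<^sub>M subprob_algebra (restrict_space borel D)"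
    and kernel_0: "x \<in> D \<Longrightarrow> f \<in> bounded_measurable_on D \<Longrightarrow> (\<integral>y. f y \<partial>K 0 x) = f x"
    and semigroup: "0 \<le> s \<Longrightarrow> 0 \<le> t \<Longrightarrow> x \<in> D \<Longrightarrow> f \<in> bounded_measurable_on D \<Longrightarrow>
        (\<integral>y. f y \<partial>K (s + t) x) = (\<integral>y. (\<integral>z. f z \<partial>K t y) \<partial>K s x)"
    and right_continuous: "0 \<le> t \<Longrightarrow> x \<in> D \<Longrightarrow> f \<in> bounded_continuous_on D \<Longrightarrow>
        ((\<lambda>s. \<integral>y. f y \<partial>K s x) \<longlongrightarrow> (\<integral>y. f y \<partial>K t x)) (at_right t)"
begin

abbreviation BM :: "('a \<Rightarrow> real) set" where "BM \<equiv> bounded_measurable_on D"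

text \<open>
The action of the kernel at time \<open>t\<close> on functions.
\<close>

definition Q :: "real \<Rightarrow> ('a \<Rightarrow> real) \<Rightarrow> 'a \<Rightarrow> real" where
  "Q t f x = (\<integral>y. f y \<partial>K t x)"

lemma BM_I: "f \<in> borel_measurable (restrict_space borel D) \<Longrightarrow> (\<And>x. x \<in> D \<Longrightarrow> \<bar>f x\<bar> \<le> B) \<Longrightarrow> f \<in> BM"
  by (auto simp: bounded_measurable_on_def bounded_iff)

lemma BM_meas: "f \<in> BM \<Longrightarrow> f \<in> borel_measurable (restrict_space borel D)"
  by (auto simp: bounded_measurable_on_def)

lemma BM_bound: assumes "f \<in> BM" shows "\<exists>B\<ge>0. \<forall>x\<in>D. \<bar>f x\<bar> \<le> B"
proof -
  obtain B where "\<And>x. x \<in> D \<Longrightarrow> \<bar>f x\<bar> \<le> B"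
    using assms by (auto simp: bounded_measurable_on_def bounded_iff)
  then show ?thesis by (intro exI[of _ "\<bar>B\<bar>"]) force
qed

lemma BM_const [simp]: "(\<lambda>_. c) \<in> BM"
  by (rule BM_I[where B = "\<bar>c\<bar>"]) auto

lemma BM_add: assumes "f \<in> BM" "g \<in> BM" shows "(\<lambda>x. f x + g x) \<in> BM"
proof -
  obtain B C where "\<And>x. x \<in> D \<Longrightarrow> \<bar>f x\<bar> \<le> B" "\<And>x. x \<in> D \<Longrightarrow> \<bar>g x\<bar> \<le> C"
    using BM_bound[OF assms(1)] BM_bound[OF assms(2)] by blast
  then have "\<bar>f x + g x\<bar> \<le> B + C" if "x \<in> D" for x using that by (intro order_trans[OF abs_triangle_ineq] add_mono) auto
  then show ?thesis using assms[THEN BM_meas] by (intro BM_I) auto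
qed

lemma BM_mult: assumes "f \<in> BM" "g \<in> BM" shows "(\<lambda>x. f x * g x) \<in> BM"
proof -
  obtain B C where "0 \<le> B" "\<And>x. x \<in> D \<Longrightarrow> \<bar>f x\<bar> \<le> B" "\<And>x. x \<in> D \<Longrightarrow> \<bar>g x\<bar> \<le> C"
    using BM_bound[OF assms(1)] BM_bound[OF assms(2)] by blast
  then have "\<And>x. x \<in> D \<Longrightarrow> \<bar>f x * g x\<bar> \<le> B * C" by (simp add: abs_mult mult_mono)
  then show ?thesis using assms[THEN BM_meas] by (intro BM_I) auto
qed

lemma BM_scale: "f \<in> BM \<Longrightarrow> (\<lambda>x. c * f x) \<in> BM"
  by (rule BM_mult[OF BM_const])

lemma BM_diff: assumes "f \<in> BM" "g \<in> BM" shows "(\<lambda>x. f x - g x) \<in> BM"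
  using BM_add[OF assms(1) BM_scale[OF assms(2), of "-1"]] by simp

lemma BM_indicator [simp]: "A \<in> sets (restrict_space borel D) \<Longrightarrow> indicator A \<in> BM"
  by (rule BM_I[where B = 1]) (auto simp: indicator_def)

lemma sets_K: "0 \<le> t \<Longrightarrow> x \<in> D \<Longrightarrow> sets (K t x) = sets (restrict_space borel D)"
  using measurable_space[OF kernel] by (simp add: space_subprob_algebra space_restrict_space)

lemma space_K: "0 \<le> t \<Longrightarrow> x \<in> D \<Longrightarrow> space (K t x) = D"
  using sets_eq_imp_space_eq[OF sets_K] by (simp add: space_restrict_space)

lemma subprob_K: "0 \<le> t \<Longrightarrow> x \<in> D \<Longrightarrow> subprob_space (K t x)"
  using measurable_space[OF kernel] by (simp add: space_subprob_algebra space_restrict_space)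

lemma finite_measure_integrable:
  assumes f: "f \<in> BM" and m: "finite_measure m" and s: "sets m = sets (restrict_space borel D)"
  shows "integrable m f"
proof -
  interpret finite_measure m by fact
  obtain B where "\<And>x. x \<in> D \<Longrightarrow> \<bar>f x\<bar> \<le> B" using BM_bound[OF f] by blast
  moreover have "space m = D" using sets_eq_imp_space_eq[OF s] by (simp add: space_restrict_space)
  moreover have "f \<in> borel_measurable m" using BM_meas[OF f] s measurable_cong_sets by blast
  ultimately show ?thesis by (intro integrable_const_bound[where B = B]) auto
qed

lemma integrable_K: "0 \<le> t \<Longrightarrow> x \<in> D \<Longrightarrow> f \<in> BM \<Longrightarrow> integrable (K t x) f"
  using subprob_K sets_K by (intro finite_measure_integrable) (auto simp: subprob_space_def)

lemma Q_cong: "0 \<le> t \<Longrightarrow> x \<in> D \<Longrightarrow> (\<And>y. y \<in> D \<Longrightarrow> f y = g y) \<Longrightarrow> Q t f x = Q t g x"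
  unfolding Q_def by (intro Bochner_Integration.integral_cong) (auto simp: space_K)

lemma Q_add:
  "0 \<le> t \<Longrightarrow> x \<in> D \<Longrightarrow> f \<in> BM \<Longrightarrow> g \<in> BM \<Longrightarrow> Q t (\<lambda>y. f y + g y) x = Q t f x + Q t g x"
  unfolding Q_def by (simp add: integrable_K)

lemma Q_diff:
  "0 \<le> t \<Longrightarrow> x \<in> D \<Longrightarrow> f \<in> BM \<Longrightarrow> g \<in> BM \<Longrightarrow> Q t (\<lambda>y. f y - g y) x = Q t f x - Q t g x"
  unfolding Q_def by (simp add: integrable_K)

lemma Q_scale: "Q t (\<lambda>y. c * f y) x = c * Q t f x"
  unfolding Q_def by simp

lemma Q_mono:
  "0 \<le> t \<Longrightarrow> x \<in> D \<Longrightarrow> f \<in> BM \<Longrightarrow> g \<in> BM \<Longrightarrow> (\<And>y. y \<in> D \<Longrightarrow> f y \<le> g y) \<Longrightarrow> Q t f x \<le> Q t g x"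
  unfolding Q_def by (intro integral_mono) (auto simp: integrable_K space_K)

lemma Q_nonneg: "0 \<le> t \<Longrightarrow> x \<in> D \<Longrightarrow> (\<And>y. y \<in> D \<Longrightarrow> 0 \<le> f y) \<Longrightarrow> 0 \<le> Q t f x"
  unfolding Q_def by (intro integral_nonneg_AE AE_I2) (auto simp: space_K)

lemma Q_const: "0 \<le> t \<Longrightarrow> x \<in> D \<Longrightarrow> Q t (\<lambda>_. c) x = c * Q t (\<lambda>_. 1) x"
  using Q_scale[of t c "\<lambda>_. 1"] by simp

lemma Q_one_le: "0 \<le> t \<Longrightarrow> x \<in> D \<Longrightarrow> Q t (\<lambda>_. 1) x \<le> 1"
  unfolding Q_def using subprob_space.subprob_measure_le_1[OF subprob_K] by simp

lemma Q_abs_le: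
  assumes "0 \<le> t" "x \<in> D" "f \<in> BM" "g \<in> BM" "\<And>y. y \<in> D \<Longrightarrow> \<bar>f y\<bar> \<le> g y"
  shows "\<bar>Q t f x\<bar> \<le> Q t g x"
proof -
  have "f y \<le> g y" "-1 * f y \<le> g y" if "y \<in> D" for y using assms(5)[OF that] by linarith+
  then have "Q t f x \<le> Q t g x" "Q t (\<lambda>y. -1 * f y) x \<le> Q t g x"
    using assms(1-4) BM_scale[OF assms(3), of "-1"] by (auto intro!: Q_mono)
  then show ?thesis unfolding Q_scale by simp
qed

lemma Q_abs_bound:
  assumes "0 \<le> t" "x \<in> D" "f \<in> BM" "\<And>y. y \<in> D \<Longrightarrow> \<bar>f y\<bar> \<le> B"
  shows "\<bar>Q t f x\<bar> \<le> B * Q t (\<lambda>_. 1) x"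
  using Q_abs_le[OF assms(1-3) BM_const assms(4)] unfolding Q_const[OF assms(1,2), of B] .

lemma Q_BM: assumes t: "0 \<le> t" and f: "f \<in> BM" shows "Q t f \<in> BM"
proof -
  obtain B where B: "0 \<le> B" "\<forall>x\<in>D. \<bar>f x\<bar> \<le> B" using BM_bound[OF f] by blast
  show ?thesis
  proof (rule BM_I)
    show "Q t f \<in> borel_measurable (restrict_space borel D)"
      unfolding Q_def using kernel[OF t] integral_measurable_subprob_algebra[OF BM_meas[OF f]]
      by (rule measurable_compose)
    show "\<bar>Q t f x\<bar> \<le> B" if "x \<in> D" for x
      using Q_abs_bound[OF t that f, of B] B(2) mult_left_mono[OF Q_one_le[OF t that] B(1)] by auto
  qed
qed

lemma Q_0: "x \<in> D \<Longrightarrow> f \<in> BM \<Longrightarrow> Q 0 f x = f x"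
  unfolding Q_def by (rule kernel_0)

lemma Q_semigroup:
  "0 \<le> s \<Longrightarrow> 0 \<le> t \<Longrightarrow> x \<in> D \<Longrightarrow> f \<in> BM \<Longrightarrow> Q (s + t) f x = Q s (Q t f) x"
  unfolding Q_def by (rule semigroup)

lemma Q_one_decreasing:
  assumes "0 \<le> s" "s \<le> t" "x \<in> D" shows "Q t (\<lambda>_. 1) x \<le> Q s (\<lambda>_. 1) x"
proof -
  have "Q t (\<lambda>_. 1) x = Q s (Q (t - s) (\<lambda>_. 1)) x"
    using Q_semigroup[of s "t - s" x "\<lambda>_. 1"] assms by simp
  also have "\<dots> \<le> Q s (\<lambda>_. 1) x"
    using assms by (intro Q_mono Q_BM) (auto intro: Q_one_le)
  finally show ?thesis .
qed

end

section \<open>Harris contraction\<close>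

text \<open>
  The hypotheses of the contraction argument: a positive eigenfunction \<open>h\<close>, a drift towards the sets
  \<open>{h \<ge> \<delta>}\<close>, and on each of these sets a minorization by a multiple of one measure \<open>\<xi>\<close>, at a
  time \<open>N\<close> that may depend on \<open>\<delta>\<close>.
\<close>

locale harris = killed_kernels D K for D :: "'a::{metric_space, second_countable_topology} set" and K +
  fixes h :: "'a \<Rightarrow> real" and \<kappa> :: real and \<xi> :: "'a measure"
  assumes h_BM: "h \<in> BM" and h_pos: "x \<in> D \<Longrightarrow> 0 < h x" and \<kappa>_pos: "0 < \<kappa>"
    and h_eigen: "0 \<le> t \<Longrightarrow> x \<in> D \<Longrightarrow> Q t h x = exp (- \<kappa> * t) * h x"
    and drift: "0 < \<epsilon> \<Longrightarrow> \<exists>C\<ge>0. \<forall>x\<in>D. Q 1 (\<lambda>_. 1) x \<le> \<epsilon> + C * h x"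
    and xi_finite: "finite_measure \<xi>" and sets_xi: "sets \<xi> = sets (restrict_space borel D)"
    and xi_nonzero: "emeasure \<xi> D \<noteq> 0"
    and minorization: "0 < \<delta> \<Longrightarrow> \<exists>N\<ge>1. \<exists>c>0. \<forall>x\<in>D. \<delta> \<le> h x \<longrightarrow>
          (\<forall>g\<in>BM. (\<forall>y\<in>D. 0 \<le> g y) \<longrightarrow> c * (\<integral>y. g y \<partial>\<xi>) \<le> Q N g x)"
begin

text \<open>
The semigroup rescaled by its growth rate; it fixes \<open>h\<close>.
\<close>

definition B :: "real \<Rightarrow> ('a \<Rightarrow> real) \<Rightarrow> 'a \<Rightarrow> real" where
  "B t f x = exp (\<kappa> * t) * Q t f x"

lemma B_add: "0 \<le> t \<Longrightarrow> x \<in> D \<Longrightarrow> f \<in> BM \<Longrightarrow> g \<in> BM \<Longrightarrow> B t (\<lambda>y. f y + g y) x = B t f x + B t g x"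
  by (simp add: B_def Q_add algebra_simps)

lemma B_diff: "0 \<le> t \<Longrightarrow> x \<in> D \<Longrightarrow> f \<in> BM \<Longrightarrow> g \<in> BM \<Longrightarrow> B t (\<lambda>y. f y - g y) x = B t f x - B t g x"
  by (simp add: B_def Q_diff algebra_simps)

lemma B_scale: "B t (\<lambda>y. c * f y) x = c * B t f x"
  by (simp add: B_def Q_scale)

lemma B_mono: "0 \<le> t \<Longrightarrow> x \<in> D \<Longrightarrow> f \<in> BM \<Longrightarrow> g \<in> BM \<Longrightarrow> (\<And>y. y \<in> D \<Longrightarrow> f y \<le> g y) \<Longrightarrow> B t f x \<le> B t g x"
  by (simp add: B_def Q_mono)

lemma B_abs_le:
  "0 \<le> t \<Longrightarrow> x \<in> D \<Longrightarrow> f \<in> BM \<Longrightarrow> g \<in> BM \<Longrightarrow> (\<And>y. y \<in> D \<Longrightarrow> \<bar>f y\<bar> \<le> g y) \<Longrightarrow> \<bar>B t f x\<bar> \<le> B t g x"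
  by (simp add: B_def Q_abs_le abs_mult)

lemma B_BM: "0 \<le> t \<Longrightarrow> f \<in> BM \<Longrightarrow> B t f \<in> BM"
  unfolding B_def by (intro BM_scale Q_BM)

lemma B_semigroup:
  "0 \<le> s \<Longrightarrow> 0 \<le> t \<Longrightarrow> x \<in> D \<Longrightarrow> f \<in> BM \<Longrightarrow> B (s + t) f x = B s (B t f) x"
  unfolding B_def[of "s + t"] B_def[of s] B_def[of t, abs_def]
  by (simp add: Q_semigroup Q_scale distrib_left exp_add)

lemma B_h: "0 \<le> t \<Longrightarrow> x \<in> D \<Longrightarrow> B t h x = h x"
  by (simp add: B_def h_eigen mult.assoc[symmetric] exp_minus)

lemma B_0: "x \<in> D \<Longrightarrow> f \<in> BM \<Longrightarrow> B 0 f x = f x"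
  by (simp add: B_def Q_0)

lemma B_affine:
  assumes "0 \<le> t" "x \<in> D" shows "B t (\<lambda>y. c + k * h y) x = c * B t (\<lambda>_. 1) x + k * h x"
proof -
  have "B t (\<lambda>y. c * 1 + k * h y) x = c * B t (\<lambda>_. 1) x + k * h x"
    using assms by (subst B_add) (simp_all only: BM_const BM_scale h_BM B_scale B_h)
  then show ?thesis by simp
qed

lemma h_bound: obtains H where "0 < H" "\<And>x. x \<in> D \<Longrightarrow> h x \<le> H"
proof -
  obtain H where "0 \<le> H" "\<And>x. x \<in> D \<Longrightarrow> \<bar>h x\<bar> \<le> H" using BM_bound[OF h_BM] by blast
  then show ?thesis using that[of "H + 1"] by force
qed

lemma B_bounded: "\<exists>M>0. \<forall>t\<ge>0. \<forall>x\<in>D. B t (\<lambda>_. 1) x \<le> M"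
proof -
  obtain H where H: "0 < H" "\<And>x. x \<in> D \<Longrightarrow> h x \<le> H" by (rule h_bound) blast
  obtain C0 where C0: "0 \<le> C0" "\<And>x. x \<in> D \<Longrightarrow> Q 1 (\<lambda>_. 1) x \<le> exp (-\<kappa>) / 2 + C0 * h x"
    using drift[of "exp (-\<kappa>) / 2"] by auto
  define C where "C = exp \<kappa> * C0"
  have C: "0 \<le> C" "B 1 (\<lambda>_. 1) x \<le> 1 / 2 + C * h x" if "x \<in> D" for x
    using mult_left_mono[OF C0(2)[OF that], of "exp \<kappa>"] C0(1)
    by (auto simp: B_def C_def algebra_simps exp_minus)
  have Cpos: "0 \<le> C" using C0(1) by (simp add: C_def)
  have ind: "B (real n) (\<lambda>_. 1) x \<le> 1 + 2 * C * h x" if x: "x \<in> D" for n x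
    using x
  proof (induction n arbitrary: x)
    case 0
    then show ?case using Q_one_le[of 0 x] h_pos[of x] Cpos by (simp add: B_def add_increasing2)
  next
    case (Suc n)
    have "B (real (Suc n)) (\<lambda>_. 1) x = B (real n) (B 1 (\<lambda>_. 1)) x"
      using B_semigroup[of "real n" 1 x "\<lambda>_. 1"] Suc by (simp add: add.commute)
    also have "\<dots> \<le> B (real n) (\<lambda>y. 1 / 2 + C * h y) x"
      using Suc.prems C by (intro B_mono B_BM BM_add BM_scale h_BM BM_const) auto
    also have "\<dots> = 1 / 2 * B (real n) (\<lambda>_. 1) x + C * h x"
      using Suc.prems by (simp add: B_affine)
    also have "\<dots> \<le> 1 + 2 * C * h x" using Suc.IH[OF Suc.prems] by simp
    finally show ?case .
  qed
  have "B t (\<lambda>_. 1) x \<le> exp \<kappa> * (1 + 2 * C * H)" if "0 \<le> t" "x \<in> D" for t x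
  proof -
    define n where "n = nat \<lfloor>t\<rfloor>"
    have n: "real n \<le> t" "t \<le> 1 + real n" using that(1) by (auto simp: n_def) linarith
    have "B t (\<lambda>_. 1) x \<le> exp (\<kappa> * (1 + real n)) * Q (real n) (\<lambda>_. 1) x"
      unfolding B_def using n Q_one_decreasing[of "real n" t x] that \<kappa>_pos
      by (intro mult_mono) (auto intro: Q_nonneg)
    also have "\<dots> = exp \<kappa> * B (real n) (\<lambda>_. 1) x" by (simp add: B_def algebra_simps exp_add)
    also have "\<dots> \<le> exp \<kappa> * (1 + 2 * C * h x)" using ind[OF that(2)] by simp
    also have "\<dots> \<le> exp \<kappa> * (1 + 2 * C * H)" using H(2)[OF that(2)] Cpos by (simp add: mult_left_mono)
    finally show ?thesis .
  qed
  moreover have "0 < exp \<kappa> * (1 + 2 * C * H)" using Cpos H(1) by (simp add: add_pos_nonneg)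
  ultimately show ?thesis by blast
qed

text \<open>
  The constant in front of \<open>h\<close> does not depend on \<open>t\<close>. This matters because the minorization time \<open>N\<close> is
  chosen after that constant.
\<close>

lemma B_drift: "\<exists>C\<ge>0. \<forall>t\<ge>1. \<forall>x\<in>D. B t (\<lambda>_. 1) x \<le> 1 / 4 + C * h x"
proof -
  obtain M where M: "0 < M" "\<And>t x. 0 \<le> t \<Longrightarrow> x \<in> D \<Longrightarrow> B t (\<lambda>_. 1) x \<le> M" using B_bounded by blast
  define e where "e = exp (-\<kappa>) / (4 * M)"
  obtain C where C: "0 \<le> C" "\<And>x. x \<in> D \<Longrightarrow> Q 1 (\<lambda>_. 1) x \<le> e + C * h x"
    using drift[of e] M by (auto simp: e_def)
  have one: "B 1 (\<lambda>_. 1) x \<le> 1 / (4 * M) + exp \<kappa> * C * h x" if "x \<in> D" for x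
    using mult_left_mono[OF C(2)[OF that], of "exp \<kappa>"]
    by (auto simp: B_def e_def algebra_simps exp_minus)
  have "B t (\<lambda>_. 1) x \<le> 1 / 4 + (exp \<kappa> * C) * h x" if "1 \<le> t" "x \<in> D" for t x
  proof -
    have "B t (\<lambda>_. 1) x = B (t - 1) (B 1 (\<lambda>_. 1)) x"
      using B_semigroup[of "t - 1" 1 x "\<lambda>_. 1"] that by simp
    also have "\<dots> \<le> B (t - 1) (\<lambda>y. 1 / (4 * M) + exp \<kappa> * C * h y) x"
      using that one by (intro B_mono B_BM BM_add BM_scale h_BM BM_const) auto
    also have "\<dots> = 1 / (4 * M) * B (t - 1) (\<lambda>_. 1) x + exp \<kappa> * C * h x"
      using that by (simp add: B_affine)
    also have "\<dots> \<le> 1 / (4 * M) * M + exp \<kappa> * C * h x"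
      using M that by (intro add_right_mono mult_left_mono) auto
    finally show ?thesis using M by simp
  qed
  then show ?thesis using C(1) by (intro exI[of _ "exp \<kappa> * C"]) auto
qed

text \<open>
  For \<open>f = h \<phi>\<close>, the bound \<open>\<bar>f x * h y - f y * h x\<bar> \<le> m * weight \<beta> x y\<close> says that \<open>\<phi>\<close> is \<open>m\<close>-Lipschitz for the
  distance \<open>2 + \<beta> / h x + \<beta> / h y\<close> of Hairer and Mattingly, multiplied out by \<open>h x * h y\<close>.
\<close>

definition weight :: "real \<Rightarrow> 'a \<Rightarrow> 'a \<Rightarrow> real" where
  "weight \<beta> x y = 2 * h x * h y + \<beta> * (h x + h y)"

text \<open>
  Subtracting a multiple of \<open>h\<close> turns the Lipschitz bound into a bound by the weight \<open>h + b\<close> itself.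
\<close>

lemma recentre:
  assumes m: "0 \<le> m" and b: "0 < b" and f: "\<And>x y. x \<in> D \<Longrightarrow> y \<in> D \<Longrightarrow> \<bar>f x * h y - f y * h x\<bar> \<le> m * weight b x y"
  shows "\<exists>c. \<forall>x\<in>D. \<bar>f x - c * h x\<bar> \<le> m * (h x + b)"
proof -
  define l where "l x = f x / h x - m * (1 + b / h x)" for x
  define u where "u x = f x / h x + m * (1 + b / h x)" for x
  have lu: "l x \<le> u y" if "x \<in> D" "y \<in> D" for x y
  proof -
    have p: "0 < h x" "0 < h y" using h_pos that by auto
    have "f x / h x - f y / h y = (f x * h y - f y * h x) / (h x * h y)" using p by (simp add: field_simps)
    also have "\<dots> \<le> (m * weight b x y) / (h x * h y)"
      using f[OF that] p by (intro divide_right_mono) auto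
    also have "\<dots> = m * (1 + b / h x) + m * (1 + b / h y)" using p by (simp add: weight_def field_simps)
    finally show ?thesis by (simp add: l_def u_def)
  qed
  define c where "c = (SUP x\<in>D. l x)"
  obtain x0 where "x0 \<in> D" using D_nonempty by blast
  have bdd: "bdd_above (l ` D)" using lu[OF _ \<open>x0 \<in> D\<close>] by (auto simp: bdd_above_def)
  have "\<bar>f x - c * h x\<bar> \<le> m * (h x + b)" if x: "x \<in> D" for x
  proof -
    have 1: "l x \<le> c" unfolding c_def using bdd x by (intro cSUP_upper)
    have 2: "c \<le> u x" unfolding c_def using D_nonempty lu x by (intro cSUP_least) auto
    have p: "0 < h x" using h_pos x .
    have "l x * h x = f x - m * (h x + b)" "u x * h x = f x + m * (h x + b)"
      using p by (simp_all add: l_def u_def field_simps)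
    then have "f x - m * (h x + b) \<le> c * h x" "c * h x \<le> f x + m * (h x + b)"
      using mult_right_mono[OF 1, of "h x"] mult_right_mono[OF 2, of "h x"] p by auto
    then show ?thesis by linarith
  qed
  then show ?thesis by blast
qed

text \<open>
  The contraction is strict uniformly over pairs of points: where \<open>h x\<close> or \<open>h y\<close> is small, the drift shrinks the
  terms with \<open>\<beta>\<close>; elsewhere the images of \<open>x\<close> and \<open>y\<close> share a multiple of \<open>\<xi>\<close>, which shrinks the term \<open>2 * h x * h y\<close>.
\<close>

lemma weighted_contraction:
  "\<exists>N>0. \<exists>\<beta>>0. \<exists>a. 1 / 2 \<le> a \<and> a < 1 \<and>
     (\<forall>f\<in>BM. \<forall>m\<ge>0. (\<forall>x\<in>D. \<forall>y\<in>D. \<bar>f x * h y - f y * h x\<bar> \<le> m * weight \<beta> x y) \<longrightarrow>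
        (\<forall>x\<in>D. \<forall>y\<in>D. \<bar>B N f x * h y - B N f y * h x\<bar> \<le> a * m * weight \<beta> x y))"
proof -
  obtain H where H: "0 < H" "\<And>x. x \<in> D \<Longrightarrow> h x \<le> H" by (rule h_bound) blast
  obtain C where C: "0 \<le> C" "\<And>t x. 1 \<le> t \<Longrightarrow> x \<in> D \<Longrightarrow> B t (\<lambda>_. 1) x \<le> 1 / 4 + C * h x"
    using B_drift by (elim exE conjE) (rule that, auto)
  \<comment> \<open>the threshold that separates pairs governed by the drift from pairs governed by the minorization\<close>
  define R where "R = 8 * C + 8"
  have R: "0 < R" using C(1) by (simp add: R_def)
  obtain N c0 where N: "1 \<le> N" and c0: "0 < c0" and
    min0: "\<And>x g. x \<in> D \<Longrightarrow> 1 / R \<le> h x \<Longrightarrow> g \<in> BM \<Longrightarrow> (\<forall>y\<in>D. 0 \<le> g y) \<Longrightarrow> c0 * (\<integral>y. g y \<partial>\<xi>) \<le> Q N g x"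
  proof -
    have "0 < 1 / R" using R by simp
    from minorization[OF this] show ?thesis by (elim exE conjE) (rule that, auto)
  qed
  define c where "c = c0 / H"
  have c: "0 < c" using c0 H(1) by (simp add: c_def)
  have N0: "0 \<le> N" using N by simp
  \<comment> \<open>dividing by the bound on \<open>h\<close> makes the lower bound proportional to \<open>h x\<close>, as the Doob transform requires\<close>
  have min: "c * h x * (\<integral>y. g y \<partial>\<xi>) \<le> B N g x"
    if "x \<in> D" "1 / R \<le> h x" "g \<in> BM" "\<forall>y\<in>D. 0 \<le> g y" for x g
  proof -
    have sp: "space \<xi> = D" using sets_eq_imp_space_eq[OF sets_xi] by (simp add: space_restrict_space)
    have i: "0 \<le> (\<integral>y. g y \<partial>\<xi>)" using that(4) sp by (intro integral_nonneg_AE AE_I2) auto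
    have "c * h x \<le> c0" using H that(1) c0 by (simp add: c_def field_simps)
    then have "c * h x * (\<integral>y. g y \<partial>\<xi>) \<le> c0 * (\<integral>y. g y \<partial>\<xi>)" using i by (rule mult_right_mono)
    also have "\<dots> \<le> Q N g x" by (rule min0[OF that])
    also have "\<dots> = 1 * Q N g x" by simp
    also have "\<dots> \<le> B N g x" unfolding B_def
      using \<kappa>_pos N0 that(4) by (intro mult_right_mono Q_nonneg[OF N0 that(1)]) auto
    finally show ?thesis .
  qed
  have inth: "0 < (\<integral>y. h y \<partial>\<xi>)"
  proof -
    have sp: "space \<xi> = D" using sets_eq_imp_space_eq[OF sets_xi] by (simp add: space_restrict_space)
    have i: "integrable \<xi> h" using finite_measure_integrable[OF h_BM xi_finite sets_xi] .
    have "(\<integral>y. h y \<partial>\<xi>) \<noteq> 0"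
    proof
      assume "(\<integral>y. h y \<partial>\<xi>) = 0"
      then have "AE y in \<xi>. h y = 0"
        using integral_nonneg_eq_0_iff_AE[OF i AE_I2] h_pos sp by (simp add: less_imp_le)
      then have "AE y in \<xi>. False"
        using AE_space by eventually_elim (metis h_pos sp less_irrefl)
      then have "emeasure \<xi> (space \<xi>) = 0" using AE_iff_measurable[of "space \<xi>" \<xi> "\<lambda>_. False"] by simp
      then show False using xi_nonzero sp by simp
    qed
    moreover have "0 \<le> (\<integral>y. h y \<partial>\<xi>)" using h_pos sp by (intro integral_nonneg_AE AE_I2) (auto intro: less_imp_le)
    ultimately show ?thesis by simp
  qed
  define q where "q = c * (\<integral>y. h y \<partial>\<xi>)"
  have q: "0 < q" using c inth by (simp add: q_def)
  \<comment> \<open>\<open>b\<close> is so small that the error \<open>b * C\<close> of the drift is less than the gain \<open>q\<close> of the minorization\<close>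
  define b where "b = q / (2 * (C + 1))"
  have b: "0 < b" "b * C \<le> q / 2" "b \<le> q / 2"
    using q C(1) by (auto simp: b_def field_simps)
  define a where "a = max (1 / 2) (1 - b)"
  have a: "1 / 2 \<le> a" "1 - b \<le> a" "a < 1" using b(1) by (auto simp: a_def)
  have "\<bar>B N f x * h y - B N f y * h x\<bar> \<le> a * m * weight b x y"
    if f: "f \<in> BM" and m: "0 \<le> m"
      and le: "\<And>x y. x \<in> D \<Longrightarrow> y \<in> D \<Longrightarrow> \<bar>f x * h y - f y * h x\<bar> \<le> m * weight b x y"
      and x: "x \<in> D" and y: "y \<in> D" for f m x y
  proof -
    obtain k where k: "\<And>x. x \<in> D \<Longrightarrow> \<bar>f x - k * h x\<bar> \<le> m * (h x + b)"
      using recentre[OF m b(1) le] by blast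
    define g where "g y = f y - k * h y" for y
    have g: "g \<in> BM" unfolding g_def by (intro BM_diff BM_scale f h_BM)
    have gw: "\<bar>g z\<bar> \<le> m * (h z + b * 1)" if "z \<in> D" for z using k[OF that] by (simp add: g_def)
    have wB: "(\<lambda>y. m * (h y + b * 1)) \<in> BM" by (intro BM_scale BM_add h_BM BM_const)
    have Bg: "B N g z = B N f z - k * h z" if "z \<in> D" for z
      unfolding g_def using that N0 by (subst B_diff) (simp_all add: f h_BM BM_scale B_scale B_h)
    have Bw: "B N (\<lambda>y. m * (h y + b * 1)) z = m * (h z + b * B N (\<lambda>_. 1) z)" if "z \<in> D" for z
      unfolding B_scale using that N0
      by (subst B_add) (simp_all add: h_BM BM_scale B_scale B_h del: mult_1_right)
    define s where "s = h x + h y"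
    define p where "p = h x * h y"
    have hxy: "0 < h x" "0 < h y" using h_pos x y by auto
    have pos: "0 < h x" "0 < h y" "0 < s" "0 < p"
      unfolding s_def p_def using hxy by (simp_all add: add_pos_pos)
    have eq: "B N f x * h y - B N f y * h x = B N g x * h y - B N g y * h x"
      unfolding Bg[OF x] Bg[OF y] by (simp add: algebra_simps)
    have drift': "h z + b * B N (\<lambda>_. 1) z \<le> h z + b * (1 / 4 + C * h z)" if "z \<in> D" for z
      using C(2)[OF N that] b(1) by simp
    have we: "weight b x y = 2 * p + b * s" by (simp add: weight_def p_def s_def)
    consider "R * p \<le> s" | "s < R * p" by linarith
    then show ?thesis
    proof cases
      \<comment> \<open>\<open>h\<close> is small at one of the points: the drift alone contracts\<close>
      case 1
      have gz: "\<bar>B N g z\<bar> \<le> m * (h z + b * (1 / 4 + C * h z))" if "z \<in> D" for z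
        using B_abs_le[OF N0 that g wB gw] Bw[OF that] mult_left_mono[OF drift'[OF that] m] by simp
      have "\<bar>B N g x * h y - B N g y * h x\<bar> \<le> \<bar>B N g x\<bar> * h y + \<bar>B N g y\<bar> * h x"
        using pos by (intro abs_cross_diff_le)
      also have "\<dots> \<le> m * (h x + b * (1 / 4 + C * h x)) * h y + m * (h y + b * (1 / 4 + C * h y)) * h x"
        using gz x y pos by (intro add_mono mult_right_mono) auto
      also have "\<dots> = m * (2 * p + 2 * b * C * p + b / 4 * s)" by (simp add: p_def s_def algebra_simps)
      also have "\<dots> \<le> m * (a * (2 * p + b * s))"
      proof (rule mult_left_mono[OF _ m])
        have "b * (R * p) / 4 \<le> b * s / 4" using 1 b(1) by simp
        moreover have "b * s / 4 \<le> (a - 1 / 4) * (b * s)"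
          using a(1) b(1) pos mult_right_mono[of "1 / 4" "a - 1 / 4" "b * s"] by simp
        moreover have "(1 - a) * (2 * p) \<le> b * (2 * p)" using a(2) pos by (intro mult_right_mono) auto
        ultimately show "2 * p + 2 * b * C * p + b / 4 * s \<le> a * (2 * p + b * s)"
          by (simp add: R_def algebra_simps)
      qed
      finally show ?thesis unfolding eq we by (simp only: mult_ac)
    next
      \<comment> \<open>\<open>h\<close> is bounded below at both points: the common part \<open>c * h z * I\<close> cancels in the difference\<close>
      case 2
      have big: "1 / R \<le> h x" "1 / R \<le> h y"
      proof -
        have "h y < R * (h x * h y)" "h x < R * (h x * h y)"
          using 2 pos unfolding s_def p_def by linarith+
        then have "1 * h y < (R * h x) * h y" "1 * h x < (R * h y) * h x" by (simp_all only: mult_1_left mult_ac)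
        then have "1 < R * h x" "1 < R * h y" using pos by (simp_all only: mult_less_cancel_right_pos)
        then show "1 / R \<le> h x" "1 / R \<le> h y" using R by (simp_all add: field_simps)
      qed
      have gw': "0 \<le> m * (h z + b * 1) - g z" "0 \<le> m * (h z + b * 1) + g z" if "z \<in> D" for z
        using gw[OF that] by linarith+
      define I where "I = (\<integral>y. g y \<partial>\<xi>)"
      have Ig: "integrable \<xi> g" and Iw: "integrable \<xi> (\<lambda>y. m * (h y + b * 1))"
        and Ih: "integrable \<xi> h" and I1: "integrable \<xi> (\<lambda>_. 1::real)"
        using finite_measure_integrable[OF _ xi_finite sets_xi] g wB h_BM BM_const by auto
      have wI: "m * (\<integral>y. h y \<partial>\<xi>) \<le> (\<integral>y. m * (h y + b * 1) \<partial>\<xi>)"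
      proof -
        have "(\<integral>y. m * h y \<partial>\<xi>) \<le> (\<integral>y. m * (h y + b * 1) \<partial>\<xi>)"
          using b(1) m Ih Iw by (intro integral_mono mult_left_mono integrable_mult_right) auto
        then show ?thesis by simp
      qed
      have gz: "\<bar>B N g z - c * h z * I\<bar> \<le> m * (h z + b * (1 / 4 + C * h z) - q * h z)"
        if z: "z \<in> D" "1 / R \<le> h z" for z
      proof -
        have "c * h z * (\<integral>y. m * (h y + b * 1) - g y \<partial>\<xi>) \<le> B N (\<lambda>y. m * (h y + b * 1) - g y) z"
          using z gw' by (intro min BM_diff wB g) auto
        moreover have "c * h z * (\<integral>y. m * (h y + b * 1) + g y \<partial>\<xi>) \<le> B N (\<lambda>y. m * (h y + b * 1) + g y) z"
          using z gw' by (intro min BM_add wB g) auto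
        moreover have "(\<integral>y. m * (h y + b * 1) - g y \<partial>\<xi>) = (\<integral>y. m * (h y + b * 1) \<partial>\<xi>) - I"
          "(\<integral>y. m * (h y + b * 1) + g y \<partial>\<xi>) = (\<integral>y. m * (h y + b * 1) \<partial>\<xi>) + I"
          unfolding I_def using Iw Ig by (rule Bochner_Integration.integral_diff Bochner_Integration.integral_add)+
        moreover have "c * h z * (m * (\<integral>y. h y \<partial>\<xi>)) \<le> c * h z * (\<integral>y. m * (h y + b * 1) \<partial>\<xi>)"
          using wI c h_pos[OF z(1)] by (intro mult_left_mono) auto
        moreover have "B N (\<lambda>y. m * (h y + b * 1) - g y) z = B N (\<lambda>y. m * (h y + b * 1)) z - B N g z"
           "B N (\<lambda>y. m * (h y + b * 1) + g y) z = B N (\<lambda>y. m * (h y + b * 1)) z + B N g z"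
          by (intro B_diff B_add wB g N0 z)+
        ultimately have "\<bar>B N g z - c * h z * I\<bar> \<le> B N (\<lambda>y. m * (h y + b * 1)) z - c * h z * (m * (\<integral>y. h y \<partial>\<xi>))"
          by (simp only: abs_le_iff right_diff_distrib distrib_left) linarith
        also have "\<dots> \<le> m * (h z + b * (1 / 4 + C * h z)) - c * h z * (m * (\<integral>y. h y \<partial>\<xi>))"
          unfolding Bw[OF z(1)] using mult_left_mono[OF drift'[OF z(1)] m] by simp
        finally show ?thesis by (simp add: q_def algebra_simps)
      qed
      have "\<bar>B N g x * h y - B N g y * h x\<bar> = \<bar>(B N g x - c * h x * I) * h y - (B N g y - c * h y * I) * h x\<bar>"
        by (simp add: algebra_simps)
      also have "\<dots> \<le> \<bar>B N g x - c * h x * I\<bar> * h y + \<bar>B N g y - c * h y * I\<bar> * h x"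
        using pos by (intro abs_cross_diff_le)
      also have "\<dots> \<le> m * (h x + b * (1 / 4 + C * h x) - q * h x) * h y + m * (h y + b * (1 / 4 + C * h y) - q * h y) * h x"
        using gz x y big pos by (intro add_mono mult_right_mono) auto
      also have "\<dots> = m * (2 * p + 2 * (b * C) * p + b / 4 * s - 2 * q * p)" by (simp add: p_def s_def algebra_simps)
      also have "\<dots> \<le> m * (a * (2 * p + b * s))"
      proof (rule mult_left_mono[OF _ m])
        have "(b * C) * p \<le> q / 2 * p" using b(2) pos by (intro mult_right_mono) auto
        moreover have "(1 - a) * p \<le> q / 2 * p" using a(2) b(3) pos by (intro mult_right_mono) auto
        moreover have "b * s / 4 \<le> a * (b * s)"
          using a(1) b(1) pos mult_right_mono[of "1 / 4" a "b * s"] by simp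
        ultimately show "2 * p + 2 * (b * C) * p + b / 4 * s - 2 * q * p \<le> a * (2 * p + b * s)"
          by (simp add: algebra_simps)
      qed
      finally show ?thesis unfolding eq we by (simp only: mult_ac)
    qed
  qed
  then show ?thesis using N a b(1) by (intro exI[of _ N] conjI exI[of _ b] exI[of _ a]) auto
qed

lemma B_abs_bound:
  assumes "0 \<le> t" "x \<in> D" "f \<in> BM" "\<And>y. y \<in> D \<Longrightarrow> \<bar>f y\<bar> \<le> F"
  shows "\<bar>B t f x\<bar> \<le> F * B t (\<lambda>_. 1) x"
  using mult_left_mono[OF Q_abs_bound[OF assms], of "exp (\<kappa> * t)"] by (simp add: B_def abs_mult algebra_simps)

text \<open>
  Iterating the contraction at multiples of \<open>N\<close>; the remaining time, less than \<open>N\<close>, only costs a constant.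
\<close>

lemma geometric_decay:
  "\<exists>C\<ge>0. \<exists>\<alpha>>0. \<forall>f\<in>BM. \<forall>F\<ge>0. (\<forall>x\<in>D. \<bar>f x\<bar> \<le> F) \<longrightarrow>
     (\<forall>t\<ge>0. \<forall>x\<in>D. \<forall>y\<in>D. \<bar>B t f x * h y - B t f y * h x\<bar> \<le> C * F * exp (- \<alpha> * t))"
proof -
  obtain H where H: "0 < H" "\<And>x. x \<in> D \<Longrightarrow> h x \<le> H" by (rule h_bound) blast
  obtain M where M: "0 < M" "\<And>t x. 0 \<le> t \<Longrightarrow> x \<in> D \<Longrightarrow> B t (\<lambda>_. 1) x \<le> M" using B_bounded by blast
  obtain N b a where N: "0 < N" and b: "0 < b" and a: "1 / 2 \<le> a" "a < 1" and
    contr: "\<forall>f\<in>BM. \<forall>m\<ge>0. (\<forall>x\<in>D. \<forall>y\<in>D. \<bar>f x * h y - f y * h x\<bar> \<le> m * weight b x y) \<longrightarrow>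
        (\<forall>x\<in>D. \<forall>y\<in>D. \<bar>B N f x * h y - B N f y * h x\<bar> \<le> a * m * weight b x y)"
    using weighted_contraction by (elim exE conjE) (rule that)
  define W where "W = 2 * H * H + b * (H + H)"
  have W: "0 \<le> weight b x y" "weight b x y \<le> W" if "x \<in> D" "y \<in> D" for x y
  proof -
    have p: "0 < h x" "0 < h y" "h x \<le> H" "h y \<le> H" using that h_pos H by auto
    then have "h x * h y \<le> H * H" "b * (h x + h y) \<le> b * (H + H)" "0 \<le> h x * h y" "0 \<le> b * (h x + h y)"
      using b by (auto intro!: mult_mono add_mono)
    then show "0 \<le> weight b x y" "weight b x y \<le> W" by (auto simp: W_def weight_def)
  qed
  have W0: "0 \<le> W" using H b by (simp add: W_def)
  have iter: "\<forall>x\<in>D. \<forall>y\<in>D. \<bar>B (real n * N) f x * h y - B (real n * N) f y * h x\<bar> \<le> a ^ n * m * weight b x y"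
    if "f \<in> BM" "0 \<le> m" "\<forall>x\<in>D. \<forall>y\<in>D. \<bar>f x * h y - f y * h x\<bar> \<le> m * weight b x y" for f m n
  proof (induction n)
    case 0
    show ?case using that(3) by (simp add: B_0 that(1))
  next
    case (Suc n)
    have "B (real n * N) f \<in> BM" "0 \<le> a ^ n * m" using N a that by (auto intro!: B_BM)
    then have "\<forall>x\<in>D. \<forall>y\<in>D. \<bar>B N (B (real n * N) f) x * h y - B N (B (real n * N) f) y * h x\<bar> \<le> a * (a ^ n * m) * weight b x y"
      using contr Suc.IH by blast
    moreover have "B N (B (real n * N) f) x = B (real (Suc n) * N) f x" if "x \<in> D" for x
      using B_semigroup[of N "real n * N" x f] N that \<open>f \<in> BM\<close> by (simp add: algebra_simps)
    ultimately show ?case by (simp add: algebra_simps)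
  qed
  define \<alpha> where "\<alpha> = - ln a / N"
  have \<alpha>: "0 < \<alpha>" using a N by (simp add: \<alpha>_def divide_neg_pos)
  have "\<bar>B t f x * h y - B t f y * h x\<bar> \<le> (2 * M / b * W) * F * exp (- \<alpha> * t)"
    if f: "f \<in> BM" and F: "0 \<le> F" "\<forall>x\<in>D. \<bar>f x\<bar> \<le> F" and t: "0 \<le> t" and xy: "x \<in> D" "y \<in> D" for f F t x y
  proof -
    define n where "n = nat \<lfloor>t / N\<rfloor>"
    define r where "r = t - real n * N"
    have "real n \<le> t / N" "t / N < real n + 1" using t N by (auto simp: n_def)
    then have r: "0 \<le> r" "r \<le> N" using N by (auto simp: r_def field_simps)
    have g: "B r f \<in> BM" using r f by (intro B_BM)
    have gb: "\<bar>B r f z\<bar> \<le> F * M" if "z \<in> D" for z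
      using B_abs_bound[OF r(1) that f, of F] F mult_left_mono[OF M(2)[OF r(1) that] F(1)] by auto
    have "\<bar>B r f z * h w - B r f w * h z\<bar> \<le> (F * M / b) * weight b z w" if "z \<in> D" "w \<in> D" for z w
    proof -
      have p: "0 < h z" "0 < h w" using h_pos that by auto
      have "\<bar>B r f z * h w - B r f w * h z\<bar> \<le> \<bar>B r f z\<bar> * h w + \<bar>B r f w\<bar> * h z"
        using p by (intro abs_cross_diff_le)
      also have "\<dots> \<le> F * M * h w + F * M * h z" using gb that p by (intro add_mono mult_right_mono) auto
      also have "\<dots> = (F * M / b) * (b * (h z + h w))" using b by (simp add: field_simps)
      also have "\<dots> \<le> (F * M / b) * weight b z w"
        using F M b p by (intro mult_left_mono) (auto simp: weight_def)
      finally show ?thesis .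
    qed
    then have "\<forall>x\<in>D. \<forall>y\<in>D. \<bar>B (real n * N) (B r f) x * h y - B (real n * N) (B r f) y * h x\<bar> \<le> a ^ n * (F * M / b) * weight b x y"
      using F M b by (intro iter g) auto
    moreover have "B (real n * N) (B r f) z = B t f z" if "z \<in> D" for z
      using B_semigroup[of "real n * N" r z f] N r f that by (simp add: r_def)
    ultimately have "\<bar>B t f x * h y - B t f y * h x\<bar> \<le> a ^ n * (F * M / b) * weight b x y" using xy by simp
    also have "\<dots> \<le> (2 * exp (- \<alpha> * t)) * (F * M / b) * W"
    proof (intro mult_mono W xy)
      have "a ^ n = exp (real n * ln a)" using a by (simp add: exp_of_nat_mult)
      also have "\<dots> = exp (- \<alpha> * (t - r))" using N by (simp add: \<alpha>_def r_def)
      also have "\<dots> \<le> exp (- \<alpha> * t + \<alpha> * N)" using r \<alpha> by (simp add: algebra_simps)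
      also have "\<dots> = exp (- \<alpha> * t) * exp (\<alpha> * N)" by (rule exp_add)
      also have "exp (\<alpha> * N) = 1 / a" using N a by (simp add: \<alpha>_def exp_minus field_simps)
      also have "exp (- \<alpha> * t) * (1 / a) \<le> exp (- \<alpha> * t) * 2"
        using a by (intro mult_left_mono) (auto simp: field_simps)
      finally show "a ^ n \<le> 2 * exp (- \<alpha> * t)" by simp
    qed (use F M b W0 W xy a in auto)
    finally show ?thesis by (simp add: algebra_simps)
  qed
  then show ?thesis using M b W0 \<alpha> by (intro exI[of _ "2 * M / b * W"] conjI exI[of _ \<alpha>]) auto
qed

text \<open>
  Integrating the previous bound in \<open>y\<close> against the rescaled kernel at time \<open>s\<close>, started at \<open>x0\<close>, replaces \<open>B t f y\<close> by
  \<open>B (t + s) f x0\<close>. With \<open>x = x0\<close> this is a Cauchy estimate, whose limit defines \<open>\<Lambda> f\<close>.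
\<close>

lemma rank_one_limit:
  assumes x0: "x0 \<in> D"
  shows "\<exists>\<Lambda>. \<exists>C\<ge>0. \<exists>\<alpha>>0. \<forall>f\<in>BM. \<forall>F\<ge>0. (\<forall>x\<in>D. \<bar>f x\<bar> \<le> F) \<longrightarrow>
     (\<forall>t\<ge>0. \<forall>x\<in>D. \<bar>B t f x * h x0 - \<Lambda> f * h x\<bar> \<le> C * F * exp (- \<alpha> * t))"
proof -
  obtain M where M: "0 < M" "\<And>t x. 0 \<le> t \<Longrightarrow> x \<in> D \<Longrightarrow> B t (\<lambda>_. 1) x \<le> M" using B_bounded by blast
  obtain C a where C: "0 \<le> C" and a: "0 < a" and
    decay: "\<forall>f\<in>BM. \<forall>F\<ge>0. (\<forall>x\<in>D. \<bar>f x\<bar> \<le> F) \<longrightarrow>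
     (\<forall>t\<ge>0. \<forall>x\<in>D. \<forall>y\<in>D. \<bar>B t f x * h y - B t f y * h x\<bar> \<le> C * F * exp (- a * t))"
    using geometric_decay by (elim exE conjE) (rule that)
  have h0: "0 < h x0" using h_pos x0 by simp
  define \<Lambda> where "\<Lambda> f = lim (\<lambda>n. B (real n) f x0)" for f
  have step: "\<bar>B t f x * h x0 - B (t + s) f x0 * h x\<bar> \<le> C * M * F * exp (- a * t)"
    if f: "f \<in> BM" and F: "0 \<le> F" "\<forall>x\<in>D. \<bar>f x\<bar> \<le> F" and t: "0 \<le> t" "0 \<le> s" and x: "x \<in> D" for f F t s x
  proof -
    have "B s (\<lambda>y. B t f x * h y - h x * B t f y) x0 = B t f x * h x0 - h x * B (t + s) f x0"
      using t x0 B_semigroup[OF t(2,1) x0 f] f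
      by (subst B_diff) (simp_all add: BM_scale h_BM B_BM B_scale B_h add.commute)
    moreover have "\<bar>B s (\<lambda>y. B t f x * h y - h x * B t f y) x0\<bar> \<le> (C * F * exp (- a * t)) * B s (\<lambda>_. 1) x0"
    proof (rule B_abs_bound[OF t(2) x0])
      show "(\<lambda>y. B t f x * h y - h x * B t f y) \<in> BM" using t f by (intro BM_diff BM_scale h_BM B_BM)
      fix y assume "y \<in> D"
      then have "\<bar>B t f x * h y - B t f y * h x\<bar> \<le> C * F * exp (- a * t)"
        using decay f F t x by blast
      then show "\<bar>B t f x * h y - h x * B t f y\<bar> \<le> C * F * exp (- a * t)" by (simp add: mult.commute)
    qed
    moreover have "(C * F * exp (- a * t)) * B s (\<lambda>_. 1) x0 \<le> (C * F * exp (- a * t)) * M"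
      using C F by (intro mult_left_mono M t x0) auto
    ultimately show ?thesis by (simp add: mult_ac)
  qed
  have lim: "(\<lambda>n. B (real n) f x0) \<longlonglongrightarrow> \<Lambda> f" if f: "f \<in> BM" for f
  proof -
    obtain F where F: "0 \<le> F" "\<forall>x\<in>D. \<bar>f x\<bar> \<le> F" using BM_bound[OF f] by blast
    define E where "E = C * M * F / h x0"
    have E: "\<bar>B t f x0 - B (t + s) f x0\<bar> \<le> E * exp (- a * t)" if "0 \<le> t" "0 \<le> s" for t s
    proof -
      have "\<bar>B t f x0 - B (t + s) f x0\<bar> * h x0 = \<bar>B t f x0 * h x0 - B (t + s) f x0 * h x0\<bar>"
        using h0 by (simp add: left_diff_distrib[symmetric] abs_mult)
      also have "\<dots> \<le> C * M * F * exp (- a * t)" using step[OF f F that x0] .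
      finally show ?thesis using h0 by (simp add: E_def field_simps)
    qed
    have "(\<lambda>n. E * exp (- a * real n)) \<longlonglongrightarrow> E * 0"
      by (intro tendsto_mult_left filterlim_compose[OF exp_at_bot] filterlim_tendsto_neg_mult_at_bot[OF tendsto_const]
          filterlim_real_sequentially) (use a in simp)
    then have E0: "(\<lambda>n. E * exp (- a * real n)) \<longlonglongrightarrow> 0" by simp
    have "Cauchy (\<lambda>n. B (real n) f x0)"
    proof (rule metric_CauchyI)
      fix e :: real assume "0 < e"
      then have "eventually (\<lambda>n. \<bar>E * exp (- a * real n)\<bar> < e / 2) sequentially"
        using E0[THEN tendstoD, of "e / 2"] by simp
      then obtain n where n: "\<bar>E * exp (- a * real n)\<bar> < e / 2" by (auto simp: eventually_sequentially)
      have "dist (B (real m) f x0) (B (real k) f x0) < e" if "n \<le> m" "n \<le> k" for m k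
        using E[of "real n" "real m - real n"] E[of "real n" "real k - real n"] that n
        by (simp add: dist_real_def)
      then show "\<exists>M. \<forall>m\<ge>M. \<forall>n\<ge>M. dist (B (real m) f x0) (B (real n) f x0) < e" by blast
    qed
    then show ?thesis unfolding \<Lambda>_def by (simp add: Cauchy_convergent_iff convergent_LIMSEQ_iff)
  qed
  have "\<bar>B t f x * h x0 - \<Lambda> f * h x\<bar> \<le> C * M * F * exp (- a * t)"
    if f: "f \<in> BM" and F: "0 \<le> F" "\<forall>x\<in>D. \<bar>f x\<bar> \<le> F" and t: "0 \<le> t" and x: "x \<in> D" for f F t x
  proof (rule LIMSEQ_le_const2)
    show "(\<lambda>n. \<bar>B t f x * h x0 - B (real n) f x0 * h x\<bar>) \<longlonglongrightarrow> \<bar>B t f x * h x0 - \<Lambda> f * h x\<bar>"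
      by (intro tendsto_intros lim f)
    show "\<exists>N. \<forall>n\<ge>N. \<bar>B t f x * h x0 - B (real n) f x0 * h x\<bar> \<le> C * M * F * exp (- a * t)"
    proof (intro exI allI impI)
      fix n assume "nat \<lceil>t\<rceil> \<le> n"
      then have "0 \<le> real n - t" by linarith
      from step[OF f F t this x] show "\<bar>B t f x * h x0 - B (real n) f x0 * h x\<bar> \<le> C * M * F * exp (- a * t)" by simp
    qed
  qed
  then show ?thesis using C M a by (intro exI[of _ \<Lambda>] exI[of _ "C * M"] conjI exI[of _ a]) auto
qed

end

section \<open>The quasi-stationary distribution\<close>

text \<open>
  The limit functional \<open>\<Lambda>\<close> of the rescaled semigroup with its rate of convergence, fixed for the rest of the construction.
\<close>

locale harris_limit = harris +
  fixes x0 :: 'a and \<Lambda> :: "('a \<Rightarrow> real) \<Rightarrow> real" and C \<alpha> :: real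
  assumes x0: "x0 \<in> D" and C_nonneg: "0 \<le> C" and \<alpha>_pos: "0 < \<alpha>"
    and limit: "f \<in> BM \<Longrightarrow> 0 \<le> F \<Longrightarrow> (\<And>x. x \<in> D \<Longrightarrow> \<bar>f x\<bar> \<le> F) \<Longrightarrow> 0 \<le> t \<Longrightarrow> x \<in> D \<Longrightarrow>
       \<bar>B t f x * h x0 - \<Lambda> f * h x\<bar> \<le> C * F * exp (- \<alpha> * t)"
begin

lemma h0_pos: "0 < h x0" using h_pos x0 by simp

lemma exp_decay: "(\<lambda>n. E * exp (- \<alpha> * real n)) \<longlonglongrightarrow> 0"
proof -
  have "(\<lambda>n. E * exp (- \<alpha> * real n)) \<longlonglongrightarrow> E * 0"
    by (intro tendsto_mult_left filterlim_compose[OF exp_at_bot] filterlim_tendsto_neg_mult_at_bot[OF tendsto_const]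
        filterlim_real_sequentially) (use \<alpha>_pos in simp)
  then show ?thesis by simp
qed

lemma limit_error:
  assumes "f \<in> BM" "0 \<le> F" "\<And>x. x \<in> D \<Longrightarrow> \<bar>f x\<bar> \<le> F" "0 \<le> t"
  shows "\<bar>B t f x0 - \<Lambda> f\<bar> \<le> C / h x0 * F * exp (- \<alpha> * t)"
proof -
  have "\<bar>B t f x0 - \<Lambda> f\<bar> * h x0 = \<bar>B t f x0 * h x0 - \<Lambda> f * h x0\<bar>"
    using h0_pos by (simp add: left_diff_distrib[symmetric] abs_mult)
  also have "\<dots> \<le> C * F * exp (- \<alpha> * t)" using limit[OF assms x0] .
  finally show ?thesis using h0_pos by (simp add: field_simps)
qed

lemma limit_shift: assumes f: "f \<in> BM" and s: "0 \<le> s" shows "(\<lambda>n. B (real n + s) f x0) \<longlonglongrightarrow> \<Lambda> f"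
proof -
  obtain F where F: "0 \<le> F" "\<forall>x\<in>D. \<bar>f x\<bar> \<le> F" using BM_bound[OF f] by blast
  have "\<bar>B (real n + s) f x0 - \<Lambda> f\<bar> \<le> (C / h x0 * F * exp (- \<alpha> * s)) * exp (- \<alpha> * real n)" for n
    using limit_error[OF f F(1), of "real n + s"] F s by (simp add: exp_add[symmetric] algebra_simps exp_diff exp_minus divide_simps)
  then have "(\<lambda>n. B (real n + s) f x0 - \<Lambda> f) \<longlonglongrightarrow> 0"
    by (intro Lim_null_comparison[OF _ exp_decay[of "C / h x0 * F * exp (- \<alpha> * s)"]] always_eventually) (simp add: algebra_simps)
  then show ?thesis by (rule LIM_zero_cancel)
qed

lemma limit_seq: "f \<in> BM \<Longrightarrow> (\<lambda>n. B (real n) f x0) \<longlonglongrightarrow> \<Lambda> f"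
  using limit_shift[of f 0] by simp

lemma \<Lambda>_unique: "f \<in> BM \<Longrightarrow> (\<And>n. B (real n) f x0 = u n) \<Longrightarrow> u \<longlonglongrightarrow> l \<Longrightarrow> \<Lambda> f = l"
  using limit_seq[of f] LIMSEQ_unique by simp blast

lemma \<Lambda>_add: "f \<in> BM \<Longrightarrow> g \<in> BM \<Longrightarrow> \<Lambda> (\<lambda>x. f x + g x) = \<Lambda> f + \<Lambda> g"
  by (rule \<Lambda>_unique[where u = "\<lambda>n. B (real n) f x0 + B (real n) g x0"])
     (auto intro!: BM_add B_add x0 tendsto_add limit_seq)

lemma \<Lambda>_scale: "f \<in> BM \<Longrightarrow> \<Lambda> (\<lambda>x. c * f x) = c * \<Lambda> f"
  by (rule \<Lambda>_unique[where u = "\<lambda>n. c * B (real n) f x0"])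
     (auto intro!: BM_scale B_scale tendsto_mult_left limit_seq)

lemma \<Lambda>_nonneg: "f \<in> BM \<Longrightarrow> (\<And>x. x \<in> D \<Longrightarrow> 0 \<le> f x) \<Longrightarrow> 0 \<le> \<Lambda> f"
  by (rule LIMSEQ_le_const[OF limit_seq]) (auto simp: B_def intro!: exI[of _ 0] mult_nonneg_nonneg Q_nonneg x0)

lemma \<Lambda>_mono: "f \<in> BM \<Longrightarrow> g \<in> BM \<Longrightarrow> (\<And>x. x \<in> D \<Longrightarrow> f x \<le> g x) \<Longrightarrow> \<Lambda> f \<le> \<Lambda> g"
  by (rule LIMSEQ_le[OF limit_seq limit_seq]) (auto intro!: B_mono x0)

lemma \<Lambda>_cong: "f \<in> BM \<Longrightarrow> g \<in> BM \<Longrightarrow> (\<And>x. x \<in> D \<Longrightarrow> f x = g x) \<Longrightarrow> \<Lambda> f = \<Lambda> g"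
  by (intro antisym \<Lambda>_mono) auto

lemma \<Lambda>_eigen: assumes f: "f \<in> BM" and s: "0 \<le> s" shows "\<Lambda> (Q s f) = exp (- \<kappa> * s) * \<Lambda> f"
proof (rule \<Lambda>_unique[where u = "\<lambda>n. exp (- \<kappa> * s) * B (real n + s) f x0"])
  show "B (real n) (Q s f) x0 = exp (- \<kappa> * s) * B (real n + s) f x0" for n
    using Q_semigroup[of "real n" s x0 f] x0 f s by (simp add: B_def exp_add[symmetric] mult.assoc[symmetric] algebra_simps)
qed (auto intro!: Q_BM f s tendsto_mult_left limit_shift)

lemma \<Lambda>_one_pos: "0 < \<Lambda> (\<lambda>_. 1)"
proof -
  obtain H where H: "0 < H" "\<And>x. x \<in> D \<Longrightarrow> h x \<le> H" by (rule h_bound) blast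
  have "\<Lambda> h = h x0" by (rule \<Lambda>_unique[where u = "\<lambda>_. h x0"]) (auto intro: h_BM B_h x0)
  moreover have "\<Lambda> h \<le> \<Lambda> (\<lambda>x. H * 1)" using H by (intro \<Lambda>_mono h_BM BM_const) auto
  ultimately have "0 < H * \<Lambda> (\<lambda>_. 1)" using h0_pos \<Lambda>_scale[OF BM_const, of H 1] by simp
  then show ?thesis using H by (simp add: zero_less_mult_iff)
qed

text \<open>
  Since the convergence to \<open>\<Lambda>\<close> is uniform over functions bounded by \<open>F\<close>, dominated convergence for the kernels passes to \<open>\<Lambda>\<close>.
  Countable additivity of \<open>\<Lambda>\<close> on indicators is a special case.
\<close>

lemma \<Lambda>_tendsto:
  assumes f: "\<And>k. f k \<in> BM" and F: "\<And>k x. x \<in> D \<Longrightarrow> \<bar>f k x\<bar> \<le> F"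
    and g: "g \<in> BM" and lim: "\<And>x. x \<in> D \<Longrightarrow> (\<lambda>k. f k x) \<longlonglongrightarrow> g x"
  shows "(\<lambda>k. \<Lambda> (f k)) \<longlonglongrightarrow> \<Lambda> g"
proof (rule LIMSEQ_I)
  fix e :: real assume e: "0 < e"
  have F0: "0 \<le> F" using F[OF x0, of 0] by linarith
  have gF: "\<bar>g x\<bar> \<le> F" if "x \<in> D" for x
    by (rule LIMSEQ_le_const2[OF tendsto_rabs[OF lim[OF that]]]) (use F that in auto)
  have "eventually (\<lambda>n. \<bar>C / h x0 * F * exp (- \<alpha> * real n)\<bar> < e / 3) sequentially"
    using exp_decay[of "C / h x0 * F", THEN tendstoD, of "e / 3"] e by simp
  then obtain n where n: "\<bar>C / h x0 * F * exp (- \<alpha> * real n)\<bar> < e / 3" by (auto simp: eventually_sequentially)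
  have sp: "space (K (real n) x0) = D" "sets (K (real n) x0) = sets (restrict_space borel D)"
    by (simp_all add: space_K sets_K x0)
  have "(\<lambda>k. Q (real n) (f k) x0) \<longlonglongrightarrow> Q (real n) g x0"
    unfolding Q_def
  proof (rule integral_dominated_convergence[where w = "\<lambda>_. F"])
    show "integrable (K (real n) x0) (\<lambda>_. F)" by (rule integrable_K) (auto simp: x0)
    show "g \<in> borel_measurable (K (real n) x0)" "f k \<in> borel_measurable (K (real n) x0)" for k
      using BM_meas[OF g] BM_meas[OF f] measurable_cong_sets[OF sp(2) refl] by blast+
  qed (auto simp: sp lim F)
  then have "(\<lambda>k. B (real n) (f k) x0) \<longlonglongrightarrow> B (real n) g x0" unfolding B_def by (rule tendsto_mult_left)
  then have "eventually (\<lambda>k. \<bar>B (real n) (f k) x0 - B (real n) g x0\<bar> < e / 3) sequentially"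
    using tendstoD[of _ _ _ "e / 3"] e by (fastforce simp: dist_real_def)
  then obtain N where N: "\<And>k. N \<le> k \<Longrightarrow> \<bar>B (real n) (f k) x0 - B (real n) g x0\<bar> < e / 3"
    by (auto simp: eventually_sequentially)
  have "\<bar>\<Lambda> (f k) - \<Lambda> g\<bar> < e" if "N \<le> k" for k
    using N[OF that] n limit_error[OF f F0 F, of "real n" k] limit_error[OF g F0 gF, of "real n"] by linarith
  then show "\<exists>N. \<forall>k\<ge>N. norm (\<Lambda> (f k) - \<Lambda> g) < e" by auto
qed

text \<open>
The functional \<open>\<Lambda>\<close>, normalised and restricted to indicators, as a measure on \<open>D\<close>.
\<close>

definition \<mu> :: "'a measure" where
  "\<mu> = measure_of D (sets (restrict_space borel D)) (\<lambda>A. ennreal (\<Lambda> (indicator A) / \<Lambda> (\<lambda>_. 1)))"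

lemma sets_\<mu>: "sets \<mu> = sets (restrict_space borel D)"
  using sets.sigma_sets_eq[of "restrict_space borel D"] sets.space_closed[of "restrict_space borel D"]
  by (simp add: \<mu>_def sets_measure_of space_restrict_space)

lemma space_\<mu>: "space \<mu> = D"
  using sets_eq_imp_space_eq[OF sets_\<mu>] by (simp add: space_restrict_space)

lemma emeasure_\<mu>:
  assumes A: "A \<in> sets (restrict_space borel D)"
  shows "emeasure \<mu> A = ennreal (\<Lambda> (indicator A) / \<Lambda> (\<lambda>_. 1))"
proof -
  let ?M = "sets (restrict_space borel D)" and ?f = "\<lambda>A. ennreal (\<Lambda> (indicator A) / \<Lambda> (\<lambda>_. 1))"
  have sa: "sigma_algebra D ?M"
    using sets.sigma_algebra_axioms[of "restrict_space borel D"] by (simp add: space_restrict_space)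
  interpret sigma_algebra D ?M by fact
  have nn: "0 \<le> \<Lambda> (indicator A)" if "A \<in> ?M" for A using that by (intro \<Lambda>_nonneg) auto
  have "indicator {} = (\<lambda>_::'a. 0::real)" by auto
  moreover have e0: "\<Lambda> (\<lambda>_. 0) = 0" using \<Lambda>_scale[OF BM_const, of 0 0] by simp
  ultimately have e: "\<Lambda> (indicator {}) = 0" by simp
  have pos: "positive ?M ?f" using e by (simp add: positive_def)
  have "countably_additive ?M ?f"
  proof (rule empty_continuous_imp_countably_additive[OF pos])
    show "additive ?M ?f"
      unfolding additive_def
    proof (intro ballI impI)
      fix A B assume AB: "A \<in> ?M" "B \<in> ?M" "A \<inter> B = {}"
      have "\<Lambda> (indicator (A \<union> B)) = \<Lambda> (\<lambda>x. indicator A x + indicator B x)"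
        using AB by (intro \<Lambda>_cong BM_add BM_indicator) (auto simp: indicator_def)
      then have "\<Lambda> (indicator (A \<union> B)) = \<Lambda> (indicator A) + \<Lambda> (indicator B)"
        using AB by (simp add: \<Lambda>_add)
      then show "?f (A \<union> B) = ?f A + ?f B"
        using nn AB \<Lambda>_one_pos by (simp add: add_divide_distrib)
    qed
    fix A :: "nat \<Rightarrow> 'a set" assume A: "range A \<subseteq> ?M" "decseq A" "(\<Inter>i. A i) = {}"
    have "(\<lambda>k. \<Lambda> (indicator (A k))) \<longlonglongrightarrow> \<Lambda> (\<lambda>_. 0)"
    proof (rule \<Lambda>_tendsto[where F = 1])
      show "(\<lambda>k. indicator (A k) x :: real) \<longlonglongrightarrow> 0" for x
      proof -
        have "(\<lambda>k. indicator (A k) x :: real) \<longlonglongrightarrow> indicator (\<Inter>k. A k) x"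
          by (rule LIMSEQ_indicator_decseq[OF A(2)])
        then show ?thesis using A(3) by simp
      qed
    qed (use A in \<open>auto simp: indicator_def\<close>)
    then have "(\<lambda>k. \<Lambda> (indicator (A k)) / \<Lambda> (\<lambda>_. 1)) \<longlonglongrightarrow> 0 / \<Lambda> (\<lambda>_. 1)"
      using \<Lambda>_one_pos by (intro tendsto_divide) (auto simp: e0)
    then show "(\<lambda>i. ?f (A i)) \<longlonglongrightarrow> 0" using tendsto_ennrealI by fastforce
  qed auto
  then show ?thesis unfolding \<mu>_def by (intro emeasure_measure_of_sigma[OF sa pos] A)
qed

lemma measure_\<mu>: "A \<in> sets (restrict_space borel D) \<Longrightarrow> measure \<mu> A = \<Lambda> (indicator A) / \<Lambda> (\<lambda>_. 1)"
  using \<Lambda>_one_pos \<Lambda>_nonneg[of "indicator A"] by (simp add: measure_def emeasure_\<mu>)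

lemma D_sets: "D \<in> sets (restrict_space borel D)"
  using sets.top[of "restrict_space borel D"] by (simp add: space_restrict_space)

lemma prob_\<mu>: "prob_space \<mu>"
proof
  have "\<Lambda> (indicator D) = \<Lambda> (\<lambda>_. 1)" using D_sets by (intro \<Lambda>_cong) auto
  then show "emeasure \<mu> (space \<mu>) = 1" using \<Lambda>_one_pos by (simp add: space_\<mu> emeasure_\<mu> D_sets)
qed

lemma \<mu>_prob: "\<mu> \<in> prob_measures_on D"
  using prob_\<mu> sets_\<mu> by (simp add: space_prob_algebra)

lemma integral_\<mu>: assumes f: "f \<in> BM" shows "(\<integral>x. f x \<partial>\<mu>) = \<Lambda> f / \<Lambda> (\<lambda>_. 1)"
proof -
  interpret prob_space \<mu> by (rule prob_\<mu>)
  have int: "integrable \<mu> g" if "g \<in> BM" for g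
    using that sets_\<mu> by (intro finite_measure_integrable) unfold_locales
  have meas: "borel_measurable \<mu> = borel_measurable (restrict_space borel D)"
    using measurable_cong_sets[OF sets_\<mu> refl] by blast
  have nonneg: "\<forall>F. (\<forall>x\<in>D. u x \<le> F) \<longrightarrow> (\<integral>x. u x \<partial>\<mu>) = \<Lambda> u / \<Lambda> (\<lambda>_. 1)"
    if "u \<in> borel_measurable \<mu>" "\<And>x. 0 \<le> u x" for u
    using that
  proof (induction rule: borel_measurable_induct_real)
    case (set A)
    then show ?case using measure_\<mu>[of A] by (simp add: sets_\<mu>)
  next
    case (mult u c)
    show ?case
    proof (intro allI impI)
      fix F assume F: "\<forall>x\<in>D. c * u x \<le> F"
      show "(\<integral>x. c * u x \<partial>\<mu>) = \<Lambda> (\<lambda>x. c * u x) / \<Lambda> (\<lambda>_. 1)"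
      proof (cases "c = 0")
        case True
        then show ?thesis using \<Lambda>_scale[OF BM_const, of 0 0] by simp
      next
        case False
        then have c: "0 < c" using mult by simp
        then have F': "\<forall>x\<in>D. u x \<le> F / c" using F by (simp add: field_simps)
        then have "u \<in> BM" using mult meas by (intro BM_I[where B = "F / c"]) auto
        have "(\<integral>x. u x \<partial>\<mu>) = \<Lambda> u / \<Lambda> (\<lambda>_. 1)" using mult F' by blast
        then show ?thesis using \<open>u \<in> BM\<close> by (simp add: \<Lambda>_scale)
      qed
    qed
  next
    case (add u v)
    show ?case
    proof (intro allI impI)
      fix F assume F: "\<forall>x\<in>D. v x + u x \<le> F"
      have "u x \<le> F" "v x \<le> F" if "x \<in> D" for x
        using F[rule_format, OF that] add.hyps(2)[of x] add.hyps(4)[of x] by linarith+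
      then have F': "\<forall>x\<in>D. u x \<le> F" "\<forall>x\<in>D. v x \<le> F" by auto
      then have "u \<in> BM" "v \<in> BM" using add.hyps(1-4) meas by (auto intro!: BM_I[where B = F])
      moreover have "(\<integral>x. u x \<partial>\<mu>) = \<Lambda> u / \<Lambda> (\<lambda>_. 1)" "(\<integral>x. v x \<partial>\<mu>) = \<Lambda> v / \<Lambda> (\<lambda>_. 1)"
        using F' add.IH by blast+
      ultimately show "(\<integral>x. v x + u x \<partial>\<mu>) = \<Lambda> (\<lambda>x. v x + u x) / \<Lambda> (\<lambda>_. 1)"
        using int by (simp add: \<Lambda>_add add_divide_distrib)
    qed
  next
    case (seq U)
    show ?case
    proof (intro allI impI)
      fix F assume F: "\<forall>x\<in>D. u x \<le> F"
      have UF: "U i x \<le> F" if "x \<in> D" for i x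
      proof -
        have "U i x \<le> u x"
          using seq.hyps(3) seq.hyps(4)[of x] that by (intro incseq_le) (auto simp: space_\<mu> incseq_def le_fun_def)
        then show ?thesis using F that by force
      qed
      have UB: "U i \<in> BM" for i using seq UF meas by (intro BM_I[where B = F]) auto
      have ub: "u \<in> BM" using seq.prems F meas that by (intro BM_I[where B = F]) auto
      have "(\<lambda>i. \<integral>x. U i x \<partial>\<mu>) \<longlonglongrightarrow> (\<integral>x. u x \<partial>\<mu>)"
      proof (rule integral_dominated_convergence[where w = "\<lambda>_. F"])
        show "u \<in> borel_measurable \<mu>" "U i \<in> borel_measurable \<mu>" for i using UB ub BM_meas meas by auto
      qed (use seq UF in \<open>auto simp: space_\<mu>\<close>)
      moreover have "(\<lambda>i. \<Lambda> (U i) / \<Lambda> (\<lambda>_. 1)) \<longlonglongrightarrow> \<Lambda> u / \<Lambda> (\<lambda>_. 1)"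
        using \<Lambda>_one_pos seq UF
        by (intro tendsto_divide[OF \<Lambda>_tendsto[where F = F] tendsto_const] UB ub) (auto simp: space_\<mu>)
      moreover have "(\<integral>x. U i x \<partial>\<mu>) = \<Lambda> (U i) / \<Lambda> (\<lambda>_. 1)" for i using seq UF by blast
      ultimately show "(\<integral>x. u x \<partial>\<mu>) = \<Lambda> u / \<Lambda> (\<lambda>_. 1)" using LIMSEQ_unique by simp
    qed
  qed
  obtain F where F: "0 \<le> F" "\<forall>x\<in>D. \<bar>f x\<bar> \<le> F" using BM_bound[OF f] by blast
  define u where "u x = max 0 (f x + F)" for x
  have fm: "f \<in> borel_measurable \<mu>" using BM_meas[OF f] unfolding meas .
  have um: "u \<in> borel_measurable \<mu>" unfolding u_def using fm by measurable
  have uD: "u x = f x + F" "u x \<le> 2 * F" "0 \<le> u x" if "x \<in> D" for x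
    using F(2)[rule_format, OF that] by (auto simp: u_def)
  have uB: "u \<in> BM" using um meas uD by (intro BM_I[where B = "2 * F"]) auto
  have "(\<integral>x. u x \<partial>\<mu>) = \<Lambda> u / \<Lambda> (\<lambda>_. 1)"
  proof -
    have "\<forall>F. (\<forall>x\<in>D. u x \<le> F) \<longrightarrow> (\<integral>x. u x \<partial>\<mu>) = \<Lambda> u / \<Lambda> (\<lambda>_. 1)"
      by (rule nonneg[OF um]) (simp add: u_def)
    then show ?thesis using uD(2) by blast
  qed
  moreover have "(\<integral>x. u x \<partial>\<mu>) = (\<integral>x. f x + F * 1 \<partial>\<mu>)"
    by (intro Bochner_Integration.integral_cong) (auto simp: uD space_\<mu>)
  moreover have "(\<integral>x. f x + F * 1 \<partial>\<mu>) = (\<integral>x. f x \<partial>\<mu>) + F"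
    using int[OF f] by (subst Bochner_Integration.integral_add) (auto simp: prob_space)
  moreover have "\<Lambda> u = \<Lambda> (\<lambda>x. f x + F * 1)"
    using uB f uD by (intro \<Lambda>_cong BM_add BM_const) auto
  moreover have "\<Lambda> (\<lambda>x. f x + F * 1) = \<Lambda> f + F * \<Lambda> (\<lambda>_. 1)"
    unfolding \<Lambda>_add[OF f BM_scale[OF BM_const]] \<Lambda>_scale[OF BM_const] ..
  ultimately show ?thesis using \<Lambda>_one_pos by (simp add: add_divide_distrib)
qed

lemma \<mu>_quasi_stationary:
  assumes "0 \<le> t" "f \<in> BM" shows "(\<integral>x. Q t f x \<partial>\<mu>) = exp (- \<kappa> * t) * (\<integral>x. f x \<partial>\<mu>)"
  using assms by (simp add: integral_\<mu> Q_BM \<Lambda>_eigen)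

text \<open>
  Numerator and denominator of the conditioned law converge, after rescaling, to \<open>\<Lambda> (indicator A) * r / h x0\<close> and \<open>\<Lambda> 1 * r / h x0\<close> with the
  same error, where \<open>r\<close> is the integral of \<open>h\<close>. As \<open>h \<le> H\<close>, the rescaled denominator is at least \<open>r / H\<close>, whence the factor \<open>1 / r\<close>.
\<close>

lemma \<mu>_attracts:
  "\<exists>C'>0. \<forall>\<rho>\<in>prob_measures_on D. \<forall>t\<ge>0. \<forall>A\<in>sets (restrict_space borel D).
     \<bar>(\<integral>x. Q t (indicator A) x \<partial>\<rho>) / (\<integral>x. Q t (\<lambda>_. 1) x \<partial>\<rho>) - measure \<mu> A\<bar>
       \<le> C' / (\<integral>x. h x \<partial>\<rho>) * exp (- \<alpha> * t)"
proof -
  obtain H where H: "0 < H" "\<And>x. x \<in> D \<Longrightarrow> h x \<le> H" by (rule h_bound) blast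
  \<comment> \<open>the summand 1 only serves to make the constant positive\<close>
  define C' where "C' = 2 * C * H / h x0 + 1"
  have C': "0 < C'" using C_nonneg H h0_pos by (auto simp: C'_def intro!: add_nonneg_pos)
  have "\<bar>(\<integral>x. Q t (indicator A) x \<partial>\<rho>) / (\<integral>x. Q t (\<lambda>_. 1) x \<partial>\<rho>) - measure \<mu> A\<bar>
       \<le> C' / (\<integral>x. h x \<partial>\<rho>) * exp (- \<alpha> * t)"
    if \<rho>: "\<rho> \<in> prob_measures_on D" and t: "0 \<le> t" and A: "A \<in> sets (restrict_space borel D)" for \<rho> t A
  proof -
    have sr: "sets \<rho> = sets (restrict_space borel D)" and pr: "prob_space \<rho>"
      using \<rho> by (auto simp: space_prob_algebra)
    have spr: "space \<rho> = D" using sets_eq_imp_space_eq[OF sr] by (simp add: space_restrict_space)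
    interpret prob_space \<rho> by (rule pr)
    have int: "integrable \<rho> g" if "g \<in> BM" for g
      using that sr by (intro finite_measure_integrable) unfold_locales
    define r where "r = (\<integral>x. h x \<partial>\<rho>)"
    define e where "e = C * exp (- \<alpha> * t)"
    have e: "0 \<le> e" using C_nonneg by (simp add: e_def)
    have r: "0 < r"
    proof -
      have "r \<noteq> 0"
      proof
        assume "r = 0"
        then have "AE x in \<rho>. h x = 0"
          using integral_nonneg_eq_0_iff_AE[OF int[OF h_BM] AE_I2] h_pos spr by (simp add: less_imp_le r_def)
        then have "AE x in \<rho>. False" using AE_space by eventually_elim (metis h_pos spr less_irrefl)
        then show False by simp
      qed
      moreover have "0 \<le> r" unfolding r_def using h_pos spr by (intro integral_nonneg_AE AE_I2) (auto intro: less_imp_le)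
      ultimately show ?thesis by simp
    qed
    have est: "\<bar>(\<integral>x. B t f x \<partial>\<rho>) * h x0 - \<Lambda> f * r\<bar> \<le> e" if f: "f \<in> BM" "\<And>x. x \<in> D \<Longrightarrow> \<bar>f x\<bar> \<le> 1" for f
    proof -
      have i: "integrable \<rho> (B t f)" "integrable \<rho> h" using int B_BM[OF t f(1)] h_BM by auto
      have "(\<integral>x. B t f x \<partial>\<rho>) * h x0 - \<Lambda> f * r = (\<integral>x. B t f x * h x0 - \<Lambda> f * h x \<partial>\<rho>)"
        using i by (simp add: r_def)
      moreover have "\<bar>\<integral>x. B t f x * h x0 - \<Lambda> f * h x \<partial>\<rho>\<bar> \<le> (\<integral>x. e \<partial>\<rho>)"
      proof (rule integral_abs_bound[THEN order_trans], rule integral_mono)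
        fix x assume "x \<in> space \<rho>"
        then show "\<bar>B t f x * h x0 - \<Lambda> f * h x\<bar> \<le> e"
          using limit[OF f(1), where F = 1] f(2) t by (simp add: spr e_def)
      qed (use i in auto)
      ultimately show ?thesis by (simp add: prob_space)
    qed
    define N where "N = (\<integral>x. B t (indicator A) x \<partial>\<rho>)"
    define Z where "Z = (\<integral>x. B t (\<lambda>_. 1) x \<partial>\<rho>)"
    define lA where "lA = \<Lambda> (indicator A)"
    define l1 where "l1 = \<Lambda> (\<lambda>_. 1)"
    have l: "0 \<le> lA" "lA \<le> l1" "0 < l1"
      using A \<Lambda>_one_pos by (auto simp: lA_def l1_def intro!: \<Lambda>_nonneg \<Lambda>_mono simp: indicator_def)
    have 1: "\<bar>N * h x0 - lA * r\<bar> \<le> e" unfolding N_def lA_def by (rule est) (use A in \<open>auto simp: indicator_def\<close>)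
    have 2: "\<bar>Z * h x0 - l1 * r\<bar> \<le> e" unfolding Z_def l1_def by (rule est) auto
    have Z: "r / H \<le> Z"
    proof -
      have "(\<integral>x. B t (\<lambda>y. h y) x / H \<partial>\<rho>) \<le> Z" unfolding Z_def
      proof (rule integral_mono)
        show "integrable \<rho> (B t (\<lambda>_. 1))" by (intro int B_BM t BM_const)
        show "integrable \<rho> (\<lambda>x. B t (\<lambda>y. h y) x / H)" using int[OF B_BM[OF t h_BM]] by simp
        fix x assume "x \<in> space \<rho>"
        then have x: "x \<in> D" by (simp add: spr)
        have "B t (\<lambda>y. h y) x \<le> B t (\<lambda>y. H * 1) x" using x t H by (intro B_mono h_BM BM_const) auto
        also have "\<dots> = H * B t (\<lambda>_. 1) x" by (rule B_scale)
        finally show "B t (\<lambda>y. h y) x / H \<le> B t (\<lambda>_. 1) x" using H by (simp add: field_simps)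
      qed
      moreover have "(\<integral>x. B t (\<lambda>y. h y) x / H \<partial>\<rho>) = r / H"
      proof -
        have "(\<integral>x. B t (\<lambda>y. h y) x / H \<partial>\<rho>) = (\<integral>x. h x / H \<partial>\<rho>)"
          by (rule Bochner_Integration.integral_cong[OF refl]) (simp add: B_h t spr)
        then show ?thesis by (simp add: r_def)
      qed
      ultimately show ?thesis by (simp only:)
    qed
    have Z0: "0 < Z" using Z r H by (smt (verit) divide_pos_pos)
    have QB: "(\<integral>x. Q t (indicator A) x \<partial>\<rho>) / (\<integral>x. Q t (\<lambda>_. 1) x \<partial>\<rho>) = N / Z"
      by (simp add: N_def Z_def B_def)
    have "(N * l1 - lA * Z) * h x0 = l1 * (N * h x0 - lA * r) - lA * (Z * h x0 - l1 * r)"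
      by (simp add: algebra_simps)
    then have "\<bar>N * l1 - lA * Z\<bar> * h x0 = \<bar>l1 * (N * h x0 - lA * r) - lA * (Z * h x0 - l1 * r)\<bar>"
      using h0_pos by (metis abs_mult abs_of_pos)
    also have "\<dots> \<le> l1 * e + l1 * e"
    proof -
      have "\<bar>l1 * (N * h x0 - lA * r)\<bar> \<le> l1 * e" "\<bar>lA * (Z * h x0 - l1 * r)\<bar> \<le> l1 * e"
        unfolding abs_mult using 1 2 l e by (auto intro!: mult_mono)
      then show ?thesis by linarith
    qed
    finally have key: "\<bar>N * l1 - lA * Z\<bar> \<le> 2 * l1 * e / h x0" using h0_pos by (simp add: field_simps)
    have "N / Z - lA / l1 = (N * l1 - lA * Z) / (Z * l1)" using Z0 l(3) by (simp add: field_simps)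
    then have "\<bar>N / Z - lA / l1\<bar> = \<bar>N * l1 - lA * Z\<bar> / (Z * l1)"
      using Z0 l(3) by (simp add: abs_mult)
    also have "\<dots> \<le> (2 * l1 * e / h x0) / (Z * l1)" using key Z0 l by (intro divide_right_mono) auto
    also have "\<dots> = 2 * e / (h x0 * Z)" using l by simp
    also have "\<dots> \<le> 2 * e / (h x0 * (r / H))"
      using Z r H h0_pos e Z0 by (intro divide_left_mono mult_left_mono mult_pos_pos) auto
    also have "\<dots> = (2 * C * H / h x0) / r * exp (- \<alpha> * t)" using H r h0_pos by (simp add: e_def)
    also have "\<dots> \<le> C' / r * exp (- \<alpha> * t)"
      using r by (intro mult_right_mono divide_right_mono) (auto simp: C'_def)
    finally show ?thesis unfolding QB measure_\<mu>[OF A] lA_def[symmetric] l1_def[symmetric] r_def[symmetric] .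
  qed
  then show ?thesis using C' by blast
qed

end

section \<open>Drift and minorization from the Green operator\<close>

lemma vanishing_on_bounds:
  assumes f: "f \<in> vanishing_on D"
  shows "continuous_on D f"
    and "0 < e \<Longrightarrow> \<exists>L. compact L \<and> L \<subseteq> D \<and> (\<forall>x\<in>D - L. \<bar>f x\<bar> \<le> e)"
    and "\<exists>B\<ge>0. \<forall>x\<in>D. \<bar>f x\<bar> \<le> B"
proof -
  have approx: "\<exists>g. continuous_on D g \<and> (\<exists>L. compact L \<and> L \<subseteq> D \<and> (\<forall>x\<in>D - L. g x = 0)) \<and> (\<forall>x\<in>D. \<bar>f x - g x\<bar> \<le> e)"
    if "0 < e" for e
    using f that unfolding vanishing_on_def compactly_supported_on_def by blast
  have "\<exists>g. continuous_on D g \<and> (\<forall>x\<in>D. \<bar>f x - g x\<bar> \<le> 1 / real (Suc n))" for n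
    using approx[of "1 / real (Suc n)"] by (auto simp del: of_nat_Suc)
  then obtain g where g: "\<And>n. continuous_on D (g n) \<and> (\<forall>x\<in>D. \<bar>f x - g n x\<bar> \<le> 1 / real (Suc n))"
    by metis
  show cont: "continuous_on D f"
  proof (rule uniform_limit_theorem)
    show "\<forall>\<^sub>F n in sequentially. continuous_on D (g n)" using g by simp
    show "uniform_limit D g f sequentially"
    proof (rule uniform_limitI)
      fix e :: real assume "0 < e"
      then obtain N where N: "1 / real (Suc N) < e" using nat_approx_posE by blast
      show "\<forall>\<^sub>F n in sequentially. \<forall>x\<in>D. dist (g n x) (f x) < e"
        unfolding eventually_sequentially
      proof (intro exI allI impI ballI)
        fix n x assume n: "N \<le> n" and x: "x \<in> D"
        have "\<bar>f x - g n x\<bar> \<le> 1 / real (Suc n)" using g x by blast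
        also have "\<dots> \<le> 1 / real (Suc N)" using n by (simp add: frac_le)
        finally show "dist (g n x) (f x) < e" using N by (simp add: dist_real_def abs_minus_commute)
      qed
    qed
  qed simp
  show small: "\<exists>L. compact L \<and> L \<subseteq> D \<and> (\<forall>x\<in>D - L. \<bar>f x\<bar> \<le> e)" if e: "0 < e" for e
  proof -
    obtain g L where "compact L" "L \<subseteq> D" and g: "\<forall>x\<in>D - L. g x = 0" "\<forall>x\<in>D. \<bar>f x - g x\<bar> \<le> e"
      using approx[OF e] by blast
    moreover have "\<bar>f x\<bar> \<le> e" if "x \<in> D - L" for x using g(1)[rule_format, OF that] g(2)[rule_format, of x] that by simp
    ultimately show ?thesis by blast
  qed
  show "\<exists>B\<ge>0. \<forall>x\<in>D. \<bar>f x\<bar> \<le> B"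
  proof -
    obtain L where L: "compact L" "L \<subseteq> D" "\<forall>x\<in>D - L. \<bar>f x\<bar> \<le> 1" using small[of 1] by auto
    have "bounded (f ` L)"
      using L cont continuous_on_subset by (intro compact_imp_bounded compact_continuous_image) blast+
    then obtain B where "\<forall>x\<in>L. \<bar>f x\<bar> \<le> B" by (auto simp: bounded_iff)
    then have "\<bar>f x\<bar> \<le> max 1 \<bar>B\<bar>" if "x \<in> D" for x using L(3) that by (cases "x \<in> L") force+
    then show ?thesis by (intro exI[of _ "max 1 \<bar>B\<bar>"]) auto
  qed
qed

text \<open>
  Kernels whose total mass decays exponentially, uniformly in the starting point, so that the Green operator is
  defined by an absolutely convergent integral.
\<close>

locale transient_kernels = killed_kernels D K
  for D :: "'a::{metric_space, second_countable_topology} set" and K +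
  fixes E c :: real
  assumes c_pos: "0 < c" and E_nonneg: "0 \<le> E"
    and decay: "0 \<le> t \<Longrightarrow> x \<in> D \<Longrightarrow> measure (K t x) D \<le> E * exp (- c * t)"
begin

abbreviation BC :: "('a \<Rightarrow> real) set" where "BC \<equiv> bounded_continuous_on D"

lemma BC_BM: "f \<in> BC \<Longrightarrow> f \<in> BM"
  by (auto simp: bounded_continuous_on_def bounded_measurable_on_def intro: borel_measurable_continuous_on_restrict)

lemma Q_one_decay: "0 \<le> t \<Longrightarrow> x \<in> D \<Longrightarrow> Q t (\<lambda>_. 1) x \<le> E * exp (- c * t)"
  using decay[of t x] by (simp add: Q_def space_K)

lemma Q_right_continuous: "0 \<le> t \<Longrightarrow> x \<in> D \<Longrightarrow> f \<in> BC \<Longrightarrow> ((\<lambda>s. Q s f x) \<longlongrightarrow> Q t f x) (at_right t)"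
  unfolding Q_def by (rule right_continuous)

text \<open>
The curve \<open>t \<mapsto> Q t f x\<close>, extended by 0 to negative times.
\<close>

definition flow :: "('a \<Rightarrow> real) \<Rightarrow> 'a \<Rightarrow> real \<Rightarrow> real" where
  "flow f x t = indicator {0..} t *\<^sub>R Q t f x"

text \<open>
The Green operator.
\<close>

definition G :: "('a \<Rightarrow> real) \<Rightarrow> 'a \<Rightarrow> real" where
  "G f x = (\<integral>t. flow f x t \<partial>lborel)"

text \<open>
  Times are approximated strictly from the right by the grid \<open>(n + 1) / (k + 1)\<close>, which takes countably many values;
  right-continuity gives the limit.
\<close>

lemma flow_joint_measurable:
  assumes f: "f \<in> BC"
  shows "(\<lambda>(t, x). flow f x t) \<in> borel_measurable (borel \<Otimes>\<^sub>M restrict_space borel D)"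
proof (rule borel_measurable_LIMSEQ_real[where u = "\<lambda>k p. indicator {0..} (fst p) *\<^sub>R
    Q ((real (nat \<lfloor>fst p * real (Suc k)\<rfloor>) + 1) / real (Suc k)) f (snd p)"])
  let ?s = "\<lambda>k t. (real (nat \<lfloor>t * real (Suc k)\<rfloor>) + 1) / real (Suc k)"
  let ?M = "borel \<Otimes>\<^sub>M restrict_space borel D :: (real \<times> 'a) measure"
  fix k
  have m: "(\<lambda>p. (\<lambda>n p. Q ((real n + 1) / real (Suc k)) f (snd p)) (nat \<lfloor>fst p * real (Suc k)\<rfloor>) p) \<in> borel_measurable ?M"
  proof (rule measurable_compose_countable[where f = "\<lambda>n p. Q ((real n + 1) / real (Suc k)) f (snd p)"])
    fix n :: nat
    have "Q ((real n + 1) / real (Suc k)) f \<in> BM" using f by (intro Q_BM BC_BM) auto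
    then show "(\<lambda>p. Q ((real n + 1) / real (Suc k)) f (snd p)) \<in> borel_measurable ?M"
      using BM_meas by (intro measurable_compose[OF measurable_snd]) auto
  next
    show "(\<lambda>p. nat \<lfloor>fst p * real (Suc k)\<rfloor>) \<in> ?M \<rightarrow>\<^sub>M count_space UNIV" by measurable
  qed
  show "(\<lambda>p. indicator {0..} (fst p) *\<^sub>R Q (?s k (fst p)) f (snd p)) \<in> borel_measurable ?M"
  proof (intro borel_measurable_scaleR)
    show "(\<lambda>p. indicator {0..} (fst p) :: real) \<in> borel_measurable ?M" by measurable
  qed (use m in simp)
next
  let ?s = "\<lambda>k t. (real (nat \<lfloor>t * real (Suc k)\<rfloor>) + 1) / real (Suc k)"
  fix p :: "real \<times> 'a" assume p: "p \<in> space (borel \<Otimes>\<^sub>M restrict_space borel D)"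
  obtain t x where tx: "p = (t, x)" by force
  have x: "x \<in> D" using p tx by (auto simp: space_pair_measure space_restrict_space)
  show "(\<lambda>k. indicator {0..} (fst p) *\<^sub>R Q (?s k (fst p)) f (snd p)) \<longlonglongrightarrow> (case p of (t, x) \<Rightarrow> flow f x t)"
  proof (cases "0 \<le> t")
    case True
    have b: "t < ?s k t" "?s k t \<le> t + 1 / real (Suc k)" for k
    proof -
      have gen: "t < (n + 1) / K" "(n + 1) / K \<le> t + 1 / K" if "t * K < n + 1" "n \<le> t * K" "0 < K" for n K :: real
        using that by (simp_all add: field_simps)
      have "0 \<le> t * real (Suc k)" using True by simp
      then have "t * real (Suc k) < real (nat \<lfloor>t * real (Suc k)\<rfloor>) + 1" "real (nat \<lfloor>t * real (Suc k)\<rfloor>) \<le> t * real (Suc k)"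
        by (auto simp: of_nat_nat)
      from gen[OF this] show "t < ?s k t" "?s k t \<le> t + 1 / real (Suc k)" by simp_all
    qed
    have "filterlim (\<lambda>k. ?s k t) (at_right t) sequentially"
      unfolding filterlim_at
    proof
      show "(\<lambda>k. ?s k t) \<longlonglongrightarrow> t"
      proof (rule tendsto_sandwich[where f = "\<lambda>_. t" and h = "\<lambda>k. t + 1 / real (Suc k)"])
        show "(\<lambda>k. t + 1 / real (Suc k)) \<longlonglongrightarrow> t" using tendsto_add[OF tendsto_const LIMSEQ_inverse_real_of_nat, of t] by (simp add: inverse_eq_divide)
        show "(\<lambda>_. t) \<longlonglongrightarrow> t" by simp
        show "\<forall>\<^sub>F k in sequentially. t \<le> ?s k t" by (intro always_eventually allI less_imp_le b(1))
        show "\<forall>\<^sub>F k in sequentially. ?s k t \<le> t + 1 / real (Suc k)" by (intro always_eventually allI b(2))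
      qed
      show "\<forall>\<^sub>F k in sequentially. ?s k t \<in> {t<..} \<and> ?s k t \<noteq> t"
        using b(1) by (intro always_eventually) (auto simp: less_imp_neq[THEN not_sym])
    qed
    then have "(\<lambda>k. Q (?s k t) f x) \<longlonglongrightarrow> Q t f x" by (rule filterlim_compose[OF Q_right_continuous[OF True x f]])
    then show ?thesis using True by (simp add: tx flow_def)
  qed (simp add: tx flow_def)
qed

lemma flow_measurable: assumes "f \<in> BC" "x \<in> D" shows "flow f x \<in> borel_measurable borel"
  using measurable_compose[OF measurable_Pair1' flow_joint_measurable[OF assms(1)]]
    measurable_compose[OF measurable_Pair2'[of x "restrict_space borel D" borel] flow_joint_measurable[OF assms(1)]] assms(2)
  by (simp add: space_restrict_space)

lemma exp_tail: "integrable lborel (\<lambda>t. indicator {S..} t *\<^sub>R exp (- c * t))"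
  "(\<integral>t. indicator {S..} t *\<^sub>R exp (- c * t) \<partial>lborel) = exp (- c * S) / c"
proof -
  have lim: "((\<lambda>t. - exp (- c * t) / c) \<longlongrightarrow> - 0 / c) at_top"
    by (intro tendsto_intros filterlim_compose[OF exp_at_bot] filterlim_tendsto_neg_mult_at_bot[OF tendsto_const] filterlim_ident)
       (use c_pos in auto)
  have "(\<integral>\<^sup>+t. ennreal (exp (- c * t)) * indicator {S..} t \<partial>lborel) = ennreal (- 0 / c - - exp (- c * S) / c)"
    using c_pos by (intro nn_integral_FTC_atLeast lim) (auto intro!: derivative_eq_intros)
  then have n: "(\<integral>\<^sup>+t. ennreal (indicator {S..} t *\<^sub>R exp (- c * t)) \<partial>lborel) = ennreal (exp (- c * S) / c)"
    by (simp add: indicator_mult_ennreal ennreal_mult' ennreal_indicator[symmetric] mult.commute)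
  have "has_bochner_integral lborel (\<lambda>t. indicator {S..} t *\<^sub>R exp (- c * t)) (exp (- c * S) / c)"
    using c_pos n by (intro has_bochner_integral_nn_integral) auto
  then show "integrable lborel (\<lambda>t. indicator {S..} t *\<^sub>R exp (- c * t))"
    "(\<integral>t. indicator {S..} t *\<^sub>R exp (- c * t) \<partial>lborel) = exp (- c * S) / c"
    by (auto simp: has_bochner_integral_iff)
qed

lemma flow_bound:
  assumes f: "f \<in> BM" "\<And>y. y \<in> D \<Longrightarrow> \<bar>f y\<bar> \<le> F" and x: "x \<in> D"
  shows "\<bar>flow f x t\<bar> \<le> F * E * (indicator {0..} t *\<^sub>R exp (- c * t))"
proof (cases "0 \<le> t")
  case True
  have "0 \<le> F" using f(2)[OF x] by linarith
  then have "F * Q t (\<lambda>_. 1) x \<le> F * (E * exp (- c * t))" using Q_one_decay[OF True x] by (intro mult_left_mono)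
  then show ?thesis using Q_abs_bound[OF True x f] True by (simp add: flow_def mult.assoc)
qed (simp add: flow_def)

lemma flow_integrable: assumes f: "f \<in> BC" and x: "x \<in> D" shows "integrable lborel (flow f x)"
proof -
  obtain F where "\<forall>y\<in>D. \<bar>f y\<bar> \<le> F" using BM_bound[OF BC_BM[OF f]] by blast
  then have "\<bar>flow f x t\<bar> \<le> F * E * (indicator {0..} t *\<^sub>R exp (- c * t))" for t
    using flow_bound[OF BC_BM[OF f] _ x] by blast
  then have "AE t in lborel. norm (flow f x t) \<le> norm (F * E * (indicator {0..} t *\<^sub>R exp (- c * t)))"
    by (intro AE_I2) (metis abs_ge_self order_trans real_norm_def)
  then show ?thesis
    using flow_measurable[OF f x]
    by (intro Bochner_Integration.integrable_bound[OF integrable_mult_right[OF exp_tail(1)]]) auto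
qed

lemma one_BC [simp]: "(\<lambda>_. 1) \<in> BC"
  by (simp add: bounded_continuous_on_def image_constant_conv)

text \<open>
The mass \<open>Q t 1\<close> decreases in \<open>t\<close>, so that its value at time 1 is at most its integral over \<open>[0, 1]\<close>.
\<close>

lemma Q_one_le_G: assumes x: "x \<in> D" shows "Q 1 (\<lambda>_. 1) x \<le> G (\<lambda>_. 1) x"
proof -
  have "(\<integral>t. indicator {0..1::real} t *\<^sub>R Q 1 (\<lambda>_. 1) x \<partial>lborel) \<le> G (\<lambda>_. 1) x"
    unfolding G_def
  proof (rule integral_mono)
    show "integrable lborel (flow (\<lambda>_. 1) x)" by (rule flow_integrable) (use x in auto)
    fix t :: real
    show "indicator {0..1} t *\<^sub>R Q 1 (\<lambda>_. 1) x \<le> flow (\<lambda>_. 1) x t"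
      using Q_one_decreasing[of t 1 x] Q_nonneg[of t x "\<lambda>_. 1"] x by (auto simp: flow_def indicator_def)
  qed simp
  then show ?thesis by simp
qed

lemma Q_pos_right:
  assumes f: "f \<in> BC" and t: "0 \<le> t" "x \<in> D" "0 < Q t f x"
  shows "\<exists>\<eta>>0. \<forall>s\<in>{t..t + \<eta>}. Q t f x / 2 \<le> Q s f x"
proof -
  have "eventually (\<lambda>s. Q t f x / 2 < Q s f x) (at_right t)"
    using Q_right_continuous[OF t(1,2) f] t(3) by (intro order_tendstoD) auto
  then obtain b where b: "t < b" "\<And>s. t < s \<Longrightarrow> s < b \<Longrightarrow> Q t f x / 2 < Q s f x"
    unfolding eventually_at_right_field by blast
  have "Q t f x / 2 \<le> Q s f x" if "s \<in> {t..t + (b - t) / 2}" for s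
    using b(2)[of s] that t(3) b(1) by (cases "s = t") (auto simp: field_simps)
  then show ?thesis using b(1) by (intro exI[of _ "(b - t) / 2"]) auto
qed

lemma G_pos:
  assumes f: "f \<in> BC" "\<And>y. y \<in> D \<Longrightarrow> 0 \<le> f y" and t: "0 \<le> t" "x \<in> D" "0 < Q t f x"
  shows "0 < G f x"
proof -
  obtain \<eta> where \<eta>: "0 < \<eta>" "\<forall>s\<in>{t..t + \<eta>}. Q t f x / 2 \<le> Q s f x" using Q_pos_right[OF f(1) t] by blast
  have "0 < \<eta> * (Q t f x / 2)" using \<eta> t by simp
  also have "\<dots> = (\<integral>s. indicator {t..t + \<eta>} s *\<^sub>R (Q t f x / 2) \<partial>lborel)" using \<eta> by simp
  also have "\<dots> \<le> G f x"
    unfolding G_def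
  proof (rule integral_mono)
    show "integrable lborel (flow f x)" by (rule flow_integrable) (use f t in auto)
    fix s :: real
    show "indicator {t..t + \<eta>} s *\<^sub>R (Q t f x / 2) \<le> flow f x s"
      using \<eta>(2) Q_nonneg[of s x f] t f(2) by (auto simp: flow_def indicator_def)
  qed (use \<eta> in simp)
  finally show ?thesis .
qed

text \<open>
  Exponential decay makes the contribution of times after \<open>S\<close> to \<open>G f\<close> small, uniformly in \<open>x\<close>. So a lower bound for
  \<open>G f x\<close> forces \<open>Q s f x\<close> to be bounded below at some time \<open>s \<le> S\<close>.
\<close>

lemma G_truncation:
  assumes f: "f \<in> BC" and \<gamma>: "0 < \<gamma>"
  shows "\<exists>S>0. \<exists>q>0. \<forall>x\<in>D. \<gamma> \<le> G f x \<longrightarrow> (\<exists>s\<in>{0..S}. q \<le> Q s f x)"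
proof -
  obtain F where F: "0 \<le> F" "\<forall>y\<in>D. \<bar>f y\<bar> \<le> F" using BM_bound[OF BC_BM[OF f]] by blast
  have "((\<lambda>S. F * E * (exp (- c * S) / c)) \<longlongrightarrow> F * E * (0 / c)) at_top"
    by (intro tendsto_intros filterlim_compose[OF exp_at_bot] filterlim_tendsto_neg_mult_at_bot[OF tendsto_const] filterlim_ident)
       (use c_pos in auto)
  then have "eventually (\<lambda>S. F * E * (exp (- c * S) / c) < \<gamma> / 4) at_top"
    using \<gamma> by (intro order_tendstoD) auto
  then obtain S where S: "0 < S" "F * E * (exp (- c * S) / c) < \<gamma> / 4"
    using eventually_conj[OF eventually_gt_at_top[of 0]] by (metis (mono_tags, lifting) eventually_happens trivial_limit_at_top_linorder)
  define q where "q = \<gamma> / (4 * S)"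
  have q: "0 < q" using \<gamma> S by (simp add: q_def)
  have "\<exists>s\<in>{0..S}. q \<le> Q s f x" if x: "x \<in> D" and G: "\<gamma> \<le> G f x" for x
  proof (rule ccontr)
    assume "\<not> ?thesis"
    then have less: "Q s f x \<le> q" if "0 \<le> s" "s \<le> S" for s using that by force
    have "G f x \<le> (\<integral>t. indicator {0..S} t *\<^sub>R q + F * E * (indicator {S..} t *\<^sub>R exp (- c * t)) \<partial>lborel)"
      unfolding G_def
    proof (rule integral_mono)
      show "integrable lborel (flow f x)" using flow_integrable f x by auto
      show "integrable lborel (\<lambda>t. indicator {0..S} t *\<^sub>R q + F * E * (indicator {S..} t *\<^sub>R exp (- c * t)))"
        using S by (intro Bochner_Integration.integrable_add integrable_mult_right exp_tail) auto
      fix t :: real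
      have b: "flow f x t \<le> F * E * (indicator {0..} t *\<^sub>R exp (- c * t))"
        using flow_bound[OF BC_BM[OF f] _ x, of F t] F(2) by auto
      consider "t < 0" | "0 \<le> t" "t < S" | "t = S" | "S < t" by linarith
      then show "flow f x t \<le> indicator {0..S} t *\<^sub>R q + F * E * (indicator {S..} t *\<^sub>R exp (- c * t))"
      proof cases
        case 1
        then show ?thesis using S F E_nonneg by (simp add: flow_def)
      next
        case 2
        then show ?thesis using less by (simp add: flow_def)
      next
        case 3
        then show ?thesis using less[of t] S F E_nonneg by (simp add: flow_def add_increasing2)
      next
        case 4
        then show ?thesis using b S by simp
      qed
    qed
    also have "\<dots> = S * q + F * E * (exp (- c * S) / c)"
    proof -
      have "(\<integral>t. F * E * (indicator {S..} t *\<^sub>R exp (- c * t)) \<partial>lborel) = F * E * (exp (- c * S) / c)"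
        by (simp only: integral_mult_right_zero exp_tail(2))
      moreover have "(\<integral>t. indicator {0..S} t *\<^sub>R q \<partial>lborel) = S * q" using S by simp
      moreover have "integrable lborel (\<lambda>t. indicator {0..S} t *\<^sub>R q)" using S by simp
      ultimately show ?thesis
        by (simp only: Bochner_Integration.integral_add integrable_mult_right exp_tail(1))
    qed
    also have "\<dots> = \<gamma> / 4 + F * E * (exp (- c * S) / c)" using S by (simp add: q_def)
    also have "\<dots> < \<gamma>" using S(2) \<gamma> by linarith
    finally show False using G by simp
  qed
  then show ?thesis using S q by blast
qed

text \<open>
Fubini's theorem and the semigroup property.
\<close>

lemma Q_of_G:
  assumes f: "f \<in> BC" and t: "0 \<le> t" and x: "x \<in> D"
  shows "Q t (G f) x = (\<integral>s. indicator {t..} s *\<^sub>R Q s f x \<partial>lborel)"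
proof -
  obtain F where F: "0 \<le> F" "\<forall>y\<in>D. \<bar>f y\<bar> \<le> F" using BM_bound[OF BC_BM[OF f]] by blast
  interpret k: subprob_space "K t x" by (rule subprob_K[OF t x])
  interpret pair_sigma_finite lborel "K t x" by unfold_locales
  have sK: "sets (K t x) = sets (restrict_space borel D)" "space (K t x) = D" using t x by (auto simp: sets_K space_K)
  have gb: "norm (flow f y s) \<le> F * E * (indicator {0..} s *\<^sub>R exp (- c * s))" if "y \<in> D" for y s
    using flow_bound[OF BC_BM[OF f] _ that, of F s] F(2) by simp
  have meas: "(\<lambda>(s, y). flow f y s) \<in> borel_measurable (lborel \<Otimes>\<^sub>M K t x)"
    using flow_joint_measurable[OF f] measurable_cong_sets[OF sets_pair_measure_cong[OF sets_lborel sK(1)] refl] by blast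
  have gK: "integrable (K t x) (\<lambda>y. flow f y s)" for s
    unfolding flow_def using Q_BM[OF _ BC_BM[OF f], of s] integrable_K[OF t x] by (cases "0 \<le> s") auto
  have "integrable (lborel \<Otimes>\<^sub>M K t x) (\<lambda>(s, y). flow f y s)"
  proof (rule Fubini_integrable[OF meas])
    have "integrable lborel (\<lambda>s. \<integral>y. norm (flow f y s) \<partial>K t x)"
    proof (rule Bochner_Integration.integrable_bound[OF integrable_mult_right[OF exp_tail(1), of "F * E"]])
      show "(\<lambda>s. \<integral>y. norm (flow f y s) \<partial>K t x) \<in> borel_measurable lborel"
        using meas by measurable
      show "AE s in lborel. norm (\<integral>y. norm (flow f y s) \<partial>K t x) \<le> norm (F * E * (indicator {0..} s *\<^sub>R exp (- c * s)))"
      proof (rule AE_I2)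
        fix s :: real
        let ?e = "F * E * (indicator {0..} s *\<^sub>R exp (- c * s))"
        have e: "0 \<le> ?e" using F E_nonneg by simp
        have "(\<integral>y. norm (flow f y s) \<partial>K t x) \<le> (\<integral>y. ?e \<partial>K t x)"
          using gb sK gK by (intro integral_mono integrable_norm) auto
        also have "\<dots> = measure (K t x) (space (K t x)) * ?e"
          by (simp only: lebesgue_integral_const real_scaleR_def)
        also have "\<dots> \<le> 1 * ?e" using k.subprob_measure_le_1 e by (intro mult_right_mono)
        finally have "(\<integral>y. norm (flow f y s) \<partial>K t x) \<le> ?e" by (simp only: mult_1_left)
        then show "norm (\<integral>y. norm (flow f y s) \<partial>K t x) \<le> norm ?e" using e by simp
      qed
    qed
    then show "integrable lborel (\<lambda>s. \<integral>y. norm (case (s, y) of (s, y) \<Rightarrow> flow f y s) \<partial>K t x)" by simp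
    show "AE s in lborel. integrable (K t x) (\<lambda>y. case (s, y) of (s, y) \<Rightarrow> flow f y s)" using gK by simp
  qed
  then have "(\<integral>y. (\<integral>s. flow f y s \<partial>lborel) \<partial>K t x) = (\<integral>s. (\<integral>y. flow f y s \<partial>K t x) \<partial>lborel)"
    by (rule Fubini_integral)
  then have "Q t (G f) x = (\<integral>s. (\<integral>y. flow f y s \<partial>K t x) \<partial>lborel)" by (simp add: Q_def[of t] G_def[abs_def])
  also have "\<dots> = (\<integral>s. indicator {0..} s *\<^sub>R Q (t + s) f x \<partial>lborel)"
    using Q_semigroup[OF t _ x BC_BM[OF f]]
    by (intro Bochner_Integration.integral_cong) (auto simp: flow_def Q_def[of t] indicator_def)
  also have "\<dots> = (\<integral>s. indicator {t..} (t + 1 * s) *\<^sub>R Q (t + 1 * s) f x \<partial>lborel)"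
    by (intro Bochner_Integration.integral_cong) (auto simp: indicator_def)
  also have "\<dots> = (\<integral>s. indicator {t..} s *\<^sub>R Q s f x \<partial>lborel)"
    using lborel_integral_real_affine[of 1 "\<lambda>s. indicator {t..} s *\<^sub>R Q s f x" t] by simp
  finally show ?thesis .
qed

text \<open>
  Along a fixed starting point, \<open>u t = Q t f x\<close> satisfies \<open>u t = \<kappa> * \<integral>\<^sub>t\<^sup>\<infinity> u\<close>. The tail integral \<open>v\<close> is Lipschitz, so \<open>u\<close> is continuous
  and \<open>v' = - \<kappa> * v\<close>.
\<close>

lemma eigen_exponential:
  assumes f: "f \<in> BC" and \<kappa>: "0 < \<kappa>" and eig: "\<And>x. x \<in> D \<Longrightarrow> G f x = 1 / \<kappa> * f x"
    and t: "0 \<le> t" and x: "x \<in> D"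
  shows "Q t f x = exp (- \<kappa> * t) * f x"
proof -
  obtain F where F: "0 \<le> F" "\<forall>y\<in>D. \<bar>f y\<bar> \<le> F" using BM_bound[OF BC_BM[OF f]] by blast
  define u where "u s = Q s f x" for s
  define v where "v s = (\<integral>r. indicator {s..} r *\<^sub>R u r \<partial>lborel)" for s
  have fB: "f \<in> BM" by (rule BC_BM[OF f])
  have uv: "u s = \<kappa> * v s" if "0 \<le> s" for s
  proof -
    have "Q s (G f) x = Q s (\<lambda>y. 1 / \<kappa> * f y) x" by (rule Q_cong[OF that x eig])
    also have "\<dots> = 1 / \<kappa> * u s" unfolding u_def by (rule Q_scale)
    finally show ?thesis using Q_of_G[OF f that x] \<kappa> by (simp add: v_def u_def)
  qed
  have ub: "\<bar>u s\<bar> \<le> F" if "0 \<le> s" for s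
    using Q_abs_bound[OF that x fB, of F] F mult_left_mono[OF Q_one_le[OF that x] F(1)] by (simp add: u_def)
  have int: "integrable lborel (\<lambda>r. indicator A r *\<^sub>R u r)" if "A \<in> sets borel" "A \<subseteq> {0..}" for A
  proof -
    have "integrable lborel (\<lambda>r. indicator A r *\<^sub>R flow f x r)" using that by (intro integrable_mult_indicator flow_integrable f x) auto
    moreover have "(\<lambda>r. indicator A r *\<^sub>R flow f x r) = (\<lambda>r. indicator A r *\<^sub>R u r)" using that(2) by (auto simp: fun_eq_iff flow_def u_def indicator_def)
    ultimately show ?thesis by simp
  qed
  have split: "v s = (\<integral>r. indicator {s..<s'} r *\<^sub>R u r \<partial>lborel) + v s'" if "0 \<le> s" "s \<le> s'" for s s'
  proof -
    have "v s = (\<integral>r. indicator {s..<s'} r *\<^sub>R u r + indicator {s'..} r *\<^sub>R u r \<partial>lborel)"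
      unfolding v_def using that by (intro Bochner_Integration.integral_cong) (auto simp: indicator_def)
    also have "\<dots> = (\<integral>r. indicator {s..<s'} r *\<^sub>R u r \<partial>lborel) + v s'"
      unfolding v_def using that by (intro Bochner_Integration.integral_add int) auto
    finally show ?thesis .
  qed
  have lip: "\<bar>v s - v s'\<bar> \<le> F * (s' - s)" if "0 \<le> s" "s \<le> s'" for s s'
  proof -
    have "\<bar>v s - v s'\<bar> \<le> (\<integral>r. \<bar>indicator {s..<s'} r *\<^sub>R u r\<bar> \<partial>lborel)"
      using split[OF that] integral_abs_bound by simp
    also have "\<dots> \<le> (\<integral>r. indicator {s..<s'} r *\<^sub>R F \<partial>lborel)"
    proof (rule integral_mono)
      show "integrable lborel (\<lambda>r. \<bar>indicator {s..<s'} r *\<^sub>R u r\<bar>)" using that by (intro integrable_abs int) auto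
      show "integrable lborel (\<lambda>r. indicator {s..<s'} r *\<^sub>R F)" using that by simp
    qed (use that ub in \<open>auto simp: indicator_def\<close>)
    also have "\<dots> = F * (s' - s)" using that by simp
    finally show ?thesis .
  qed
  have vc: "continuous_on {0..} v"
  proof (rule lipschitz_on_continuous_on)
    show "F-lipschitz_on {0..} v"
    proof (rule lipschitz_onI)
      fix s s' :: real assume "s \<in> {0..}" "s' \<in> {0..}"
      then show "dist (v s) (v s') \<le> F * dist s s'"
        using lip[of s s'] lip[of s' s] by (cases "s \<le> s'") (auto simp: dist_real_def abs_minus_commute)
    qed (rule F)
  qed
  have "continuous_on {0..t} (\<lambda>s. \<kappa> * v s)"
    by (intro continuous_intros continuous_on_subset[OF vc]) auto
  then have uc: "continuous_on {0..t} u"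
    by (rule continuous_on_cong[OF refl, THEN iffD1, rotated]) (simp add: uv)
  have v_int: "v s = v 0 - integral {0..s} u" if "0 \<le> s" for s
  proof -
    have "(\<integral>r. indicator {0..<s} r *\<^sub>R u r \<partial>lborel) = (LINT r:{0..s}|lborel. u r)"
      unfolding set_lebesgue_integral_def
    proof (rule integral_cong_AE)
      show "AE r in lborel. indicator {0..<s} r *\<^sub>R u r = indicator {0..s} r *\<^sub>R u r"
        using AE_lborel_singleton[of s] by eventually_elim (auto simp: indicator_def)
      show "(\<lambda>r. indicator {0..<s} r *\<^sub>R u r) \<in> borel_measurable lborel"
        by (rule borel_measurable_integrable, rule int) auto
      show "(\<lambda>r. indicator {0..s} r *\<^sub>R u r) \<in> borel_measurable lborel"
        by (rule borel_measurable_integrable, rule int) auto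
    qed
    also have "\<dots> = integral {0..s} u"
      by (rule set_borel_integral_eq_integral) (use int[of "{0..s}"] in \<open>simp add: set_integrable_def\<close>)
    finally show ?thesis using split[of 0 s] that by simp
  qed
  have "((\<lambda>s. exp (\<kappa> * s) * v s) has_field_derivative 0) (at s within {0..t})" if s: "s \<in> {0..t}" for s
  proof -
    have "((\<lambda>s. v 0 - integral {0..s} u) has_real_derivative (0 - u s)) (at s within {0..t})"
      by (intro derivative_intros integral_has_real_derivative uc s)
    then have "(v has_real_derivative (0 - u s)) (at s within {0..t})"
      by (rule has_field_derivative_transform_within[OF _ zero_less_one s]) (rule v_int[symmetric], simp)
    then have "((\<lambda>s. exp (\<kappa> * s) * v s) has_real_derivative (exp (\<kappa> * s) * (0 - u s) + exp (\<kappa> * s) * \<kappa> * v s)) (at s within {0..t})"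
      by (auto intro!: derivative_eq_intros)
    moreover have "exp (\<kappa> * s) * (0 - u s) + exp (\<kappa> * s) * \<kappa> * v s = 0" using uv[of s] s by simp
    ultimately show ?thesis by (simp only:)
  qed
  then have "\<exists>k. \<forall>s\<in>{0..t}. exp (\<kappa> * s) * v s = k"
    by (intro has_field_derivative_zero_constant convex_closed_interval)
  then obtain k where k: "\<And>s. s \<in> {0..t} \<Longrightarrow> exp (\<kappa> * s) * v s = k" by blast
  have "exp (\<kappa> * t) * v t = v 0" using k[of t] k[of 0] t by simp
  then have "exp (\<kappa> * t) * u t = u 0" using uv[OF t] uv[of 0] by (simp add: algebra_simps)
  then have "u t = exp (- \<kappa> * t) * u 0" by (simp add: exp_minus field_simps)
  then show ?thesis using Q_0[OF x fB] by (simp add: u_def)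
qed

lemma dominated_integral:
  assumes \<xi>: "finite_measure \<xi>" "sets \<xi> = sets (restrict_space borel D)" and t: "0 \<le> t" and x: "x \<in> D"
    and le: "\<And>A. A \<in> sets (restrict_space borel D) \<Longrightarrow> emeasure \<xi> A \<le> emeasure (K t x) A"
    and f: "f \<in> BM" "\<And>y. y \<in> D \<Longrightarrow> 0 \<le> f y"
  shows "(\<integral>y. f y \<partial>\<xi>) \<le> Q t f x"
proof -
  have sp: "space \<xi> = D" using sets_eq_imp_space_eq[OF \<xi>(2)] by (simp add: space_restrict_space)
  have s: "sets \<xi> = sets (K t x)" using \<xi>(2) sets_K[OF t x] by simp
  have "\<xi> \<le> K t x"
    unfolding le_measure[OF s]
    using le \<xi>(2) by simp
  then have "(\<integral>\<^sup>+y. ennreal (f y) \<partial>\<xi>) \<le> (\<integral>\<^sup>+y. ennreal (f y) \<partial>K t x)" by (rule nn_integral_mono_measure[OF s])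
  also have "\<dots> = ennreal (Q t f x)"
    unfolding Q_def using f t x by (intro nn_integral_eq_integral integrable_K AE_I2) (auto simp: space_K)
  also have "(\<integral>\<^sup>+y. ennreal (f y) \<partial>\<xi>) = ennreal (\<integral>y. f y \<partial>\<xi>)"
    using f sp by (intro nn_integral_eq_integral finite_measure_integrable[OF f(1) \<xi>] AE_I2) auto
  finally show ?thesis using Q_nonneg[OF t x f(2)] by simp
qed

text \<open>
  The second part says that mass which is in \<open>U\<close> at time \<open>s\<close> turns into a multiple of \<open>\<xi>\<close> after a further time \<open>T\<close>. Integrating it
  against \<open>\<xi>\<close> itself gives \<open>\<xi> Q\<^sub>r \<ge> p \<xi>\<close> for \<open>r\<close> in an interval, because \<open>s \<mapsto> \<integral> Q s f d\<xi>\<close> is right-continuous and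
  not identically 0. The first part iterates this; the admissible interval of times grows with \<open>n\<close>.
\<close>

lemma renewal_bound:
  assumes \<xi>: "finite_measure \<xi>" "sets \<xi> = sets (restrict_space borel D)" "emeasure \<xi> D \<noteq> 0"
    and T: "0 < T" and f: "f \<in> BC" "\<And>y. y \<in> D \<Longrightarrow> 0 \<le> f y \<and> f y \<le> 1" "\<And>y. y \<in> D - U \<Longrightarrow> f y = 0"
    and acc: "\<And>x. x \<in> D \<Longrightarrow> \<exists>t\<ge>0. 0 < Q t f x"
    and minor: "\<And>x g. x \<in> U \<inter> D \<Longrightarrow> g \<in> BM \<Longrightarrow> (\<And>y. y \<in> D \<Longrightarrow> 0 \<le> g y) \<Longrightarrow> (\<integral>y. g y \<partial>\<xi>) \<le> Q T g x"
  shows "\<exists>a>0. \<exists>\<eta>>0. \<exists>p>0. \<forall>n\<ge>1. \<forall>r\<in>{real n * a..real n * (a + \<eta>)}. \<forall>g\<in>BM. (\<forall>y\<in>D. 0 \<le> g y) \<longrightarrow>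
     p ^ n * (\<integral>y. g y \<partial>\<xi>) \<le> (\<integral>y. Q r g y \<partial>\<xi>)"
    and "x \<in> D \<Longrightarrow> 0 \<le> s \<Longrightarrow> g \<in> BM \<Longrightarrow> (\<And>y. y \<in> D \<Longrightarrow> 0 \<le> g y) \<Longrightarrow>
     Q s f x * (\<integral>y. g y \<partial>\<xi>) \<le> Q (s + T) g x"
proof -
  interpret finite_measure \<xi> by fact
  have sp: "space \<xi> = D" using sets_eq_imp_space_eq[OF \<xi>(2)] by (simp add: space_restrict_space)
  have int: "integrable \<xi> g" if "g \<in> BM" for g using finite_measure_integrable[OF that \<xi>(1,2)] .
  have fB: "f \<in> BM" using f(1) by (rule BC_BM)
  show step: "Q s f x * (\<integral>y. g y \<partial>\<xi>) \<le> Q (s + T) g x"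
    if x: "x \<in> D" and s: "0 \<le> s" and g: "g \<in> BM" "\<And>y. y \<in> D \<Longrightarrow> 0 \<le> g y" for x s g
  proof -
    have "Q s (\<lambda>y. (\<integral>y. g y \<partial>\<xi>) * f y) x \<le> Q s (Q T g) x"
    proof (rule Q_mono[OF s x])
      show "(\<lambda>y. (\<integral>y. g y \<partial>\<xi>) * f y) \<in> BM" by (rule BM_scale[OF fB])
      show "Q T g \<in> BM" using T g by (intro Q_BM) auto
      fix y assume y: "y \<in> D"
      have i: "0 \<le> (\<integral>y. g y \<partial>\<xi>)" using g sp by (intro integral_nonneg_AE AE_I2) auto
      show "(\<integral>y. g y \<partial>\<xi>) * f y \<le> Q T g y"
      proof (cases "y \<in> U")
        case True
        have "(\<integral>y. g y \<partial>\<xi>) * f y \<le> (\<integral>y. g y \<partial>\<xi>)" using i f(2)[OF y] by (simp add: mult_left_le)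
        also have "\<dots> \<le> Q T g y" using True y g by (intro minor) auto
        finally show ?thesis .
      next
        case False
        then show ?thesis using f(3)[of y] y T g by (simp add: Q_nonneg)
      qed
    qed
    then show ?thesis unfolding Q_scale using Q_semigroup[OF s _ x g(1), of T] T by (simp add: mult.commute)
  qed
  have "\<exists>s0\<ge>0. 0 < (\<integral>y. Q s0 f y \<partial>\<xi>)"
  proof (rule ccontr)
    assume no: "\<not> ?thesis"
    have ae: "AE y in \<xi>. Q s f y = 0" if "0 \<le> s" for s
    proof -
      have nn: "AE y in \<xi>. 0 \<le> Q s f y" using f(2) sp that by (intro AE_I2 Q_nonneg) auto
      have "(\<integral>y. Q s f y \<partial>\<xi>) = 0"
        using no that integral_nonneg_AE[OF nn] by force
      then show ?thesis using integral_nonneg_eq_0_iff_AE[OF int[OF Q_BM[OF that fB]] nn] by simp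
    qed
    \<comment> \<open>by right-continuity, a positive value at some time gives a positive value at a rational time\<close>
    have "AE y in \<xi>. \<forall>q::rat. 0 \<le> q \<longrightarrow> Q (of_rat q) f y = 0"
      unfolding AE_all_countable using ae by simp
    then have "AE y in \<xi>. False"
      using AE_space
    proof eventually_elim
      case (elim y)
      then have y: "y \<in> D" using sp by simp
      obtain t where t: "0 \<le> t" "0 < Q t f y" using acc[OF y] by blast
      obtain \<eta> where \<eta>: "0 < \<eta>" "\<forall>s\<in>{t..t + \<eta>}. Q t f y / 2 \<le> Q s f y"
        using Q_pos_right[OF f(1) t(1) y t(2)] by blast
      obtain q :: rat where q: "t < of_rat q" "of_rat q < t + \<eta>" using of_rat_dense[of t "t + \<eta>"] \<eta>(1) by auto
      then have "0 \<le> q" using t(1) by (metis less_le_not_le nle_le of_rat_0 of_rat_less order_less_le_trans)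
      moreover have "0 < Q (of_rat q) f y" using \<eta>(2)[rule_format, of "of_rat q"] q t(2) by simp
      ultimately show False using elim(1) by force
    qed
    then have "emeasure \<xi> (space \<xi>) = 0" using AE_iff_measurable[of "space \<xi>" \<xi> "\<lambda>_. False"] by simp
    then show False using \<xi>(3) sp by simp
  qed
  then obtain s0 where s0: "0 \<le> s0" "0 < (\<integral>y. Q s0 f y \<partial>\<xi>)" by blast
  define p where "p s = (\<integral>y. Q s f y \<partial>\<xi>)" for s
  have p_tendsto: "(p \<longlongrightarrow> p s0) (at_right s0)"
    unfolding tendsto_at_iff_sequentially comp_def
  proof (intro allI impI)
    fix S :: "nat \<Rightarrow> real" assume S: "\<forall>i. S i \<in> {s0<..} - {s0}" "S \<longlonglongrightarrow> s0"
    have r: "filterlim S (at_right s0) sequentially"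
      unfolding filterlim_at using S by (auto intro!: always_eventually)
    have S0: "0 \<le> S i" for i using S(1) s0(1) by (auto intro: order_trans[OF s0(1)] less_imp_le)
    show "(\<lambda>i. p (S i)) \<longlonglongrightarrow> p s0"
      unfolding p_def
    proof (rule integral_dominated_convergence[where w = "\<lambda>_. 1"])
      show "Q s0 f \<in> borel_measurable \<xi>" "Q (S i) f \<in> borel_measurable \<xi>" for i
        using int[OF Q_BM[OF s0(1) fB]] int[OF Q_BM[OF S0 fB]] by auto
      show "AE y in \<xi>. (\<lambda>i. Q (S i) f y) \<longlonglongrightarrow> Q s0 f y"
        using sp by (intro AE_I2 filterlim_compose[OF Q_right_continuous[OF s0(1) _ f(1)] r]) auto
      show "AE y in \<xi>. norm (Q (S i) f y) \<le> 1" for i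
      proof (rule AE_I2)
        fix y assume "y \<in> space \<xi>"
        then have y: "y \<in> D" using sp by simp
        have "\<bar>Q (S i) f y\<bar> \<le> 1 * Q (S i) (\<lambda>_. 1) y" by (rule Q_abs_bound[OF S0 y fB]) (use f(2) in auto)
        then show "norm (Q (S i) f y) \<le> 1" using Q_one_le[OF S0 y] by (smt (verit) mult_1 real_norm_def)
      qed
    qed simp
  qed
  have "eventually (\<lambda>s. p s0 / 2 < p s) (at_right s0)"
    by (rule order_tendstoD(1)[OF p_tendsto]) (use s0(2) in \<open>simp add: p_def\<close>)
  then obtain b where b: "s0 < b" "\<And>s. s0 < s \<Longrightarrow> s < b \<Longrightarrow> p s0 / 2 < p s"
    unfolding eventually_at_right_field by blast
  define \<eta> where "\<eta> = (b - s0) / 2"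
  define a where "a = s0 + T"
  define q where "q = p s0 / 2"
  have \<eta>: "0 < \<eta>" "0 < a" "0 < q" using b(1) T s0 by (auto simp: \<eta>_def a_def q_def p_def)
  have q: "q \<le> p s" if "s \<in> {s0..s0 + \<eta>}" for s
    using b(2)[of s] that s0(2) b(1) by (cases "s = s0") (auto simp: field_simps q_def \<eta>_def p_def)
  have one: "q * (\<integral>y. g y \<partial>\<xi>) \<le> (\<integral>y. Q r g y \<partial>\<xi>)"
    if r: "r \<in> {a..a + \<eta>}" and g: "g \<in> BM" "\<forall>y\<in>D. 0 \<le> g y" for r g
  proof -
    have rT: "0 \<le> r - T" "r - T \<in> {s0..s0 + \<eta>}" using r s0 by (auto simp: a_def)
    have "0 \<le> (\<integral>y. g y \<partial>\<xi>)" using g sp by (intro integral_nonneg_AE AE_I2) auto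
    then have "q * (\<integral>y. g y \<partial>\<xi>) \<le> p (r - T) * (\<integral>y. g y \<partial>\<xi>)" using q[OF rT(2)] by (rule mult_right_mono[rotated])
    also have "\<dots> = (\<integral>x. Q (r - T) f x * (\<integral>y. g y \<partial>\<xi>) \<partial>\<xi>)" by (simp add: p_def)
    also have "\<dots> \<le> (\<integral>x. Q r g x \<partial>\<xi>)"
    proof (rule integral_mono)
      show "integrable \<xi> (\<lambda>x. Q (r - T) f x * (\<integral>y. g y \<partial>\<xi>))" using int[OF Q_BM[OF rT(1) fB]] by simp
      show "integrable \<xi> (Q r g)" using rT T g by (intro int Q_BM) auto
      fix x assume "x \<in> space \<xi>"
      then show "Q (r - T) f x * (\<integral>y. g y \<partial>\<xi>) \<le> Q r g x" using step[of x "r - T" g] rT g sp by simp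
    qed
    finally show ?thesis .
  qed
  have "q ^ n * (\<integral>y. g y \<partial>\<xi>) \<le> (\<integral>y. Q r g y \<partial>\<xi>)"
    if "1 \<le> n" "r \<in> {real n * a..real n * (a + \<eta>)}" "g \<in> BM" "\<forall>y\<in>D. 0 \<le> g y" for n r g
    using that
  proof (induction n arbitrary: r g rule: dec_induct)
    case base
    then show ?case using one[of r g] by simp
  next
    case (step n)
    \<comment> \<open>splitting \<open>r\<close> into equal parts keeps each part in \<open>[a, a + \<eta>]\<close>\<close>
    define r2 where "r2 = r / real (Suc n)"
    define r1 where "r1 = r - r2"
    have r2: "r2 \<in> {a..a + \<eta>}" using step.prems(1) by (simp add: r2_def field_simps)
    have "r1 = real n * r2" by (simp add: r1_def r2_def field_simps)
    then have r1: "r1 \<in> {real n * a..real n * (a + \<eta>)}" using r2 by (auto intro: mult_left_mono)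
    have nn: "0 \<le> r2" "0 \<le> r1" using r2 r1 \<eta> by (auto intro: order_trans[rotated])
    have "q ^ Suc n * (\<integral>y. g y \<partial>\<xi>) = q ^ n * (q * (\<integral>y. g y \<partial>\<xi>))" by simp
    also have "\<dots> \<le> q ^ n * (\<integral>y. Q r2 g y \<partial>\<xi>)" using one[OF r2 step.prems(2,3)] \<eta> by (intro mult_left_mono) auto
    also have "\<dots> \<le> (\<integral>y. Q r1 (Q r2 g) y \<partial>\<xi>)"
      using step.prems nn by (intro step.IH r1 Q_BM ballI Q_nonneg) auto
    also have "\<dots> = (\<integral>y. Q r g y \<partial>\<xi>)"
      using Q_semigroup[OF nn(2,1) _ step.prems(2)] sp
      by (intro Bochner_Integration.integral_cong) (auto simp: r1_def)
    finally show ?case .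
  qed
  then show "\<exists>a>0. \<exists>\<eta>>0. \<exists>p>0. \<forall>n\<ge>1. \<forall>r\<in>{real n * a..real n * (a + \<eta>)}. \<forall>g\<in>BM. (\<forall>y\<in>D. 0 \<le> g y) \<longrightarrow>
     p ^ n * (\<integral>y. g y \<partial>\<xi>) \<le> (\<integral>y. Q r g y \<partial>\<xi>)"
    using \<eta> by blast
qed

text \<open>
  That \<open>G f\<close> lies in \<open>C\<^sub>0(D)\<close> is used twice: for \<open>f = 1\<close>, decay at the boundary gives the drift; for a
  function \<open>f\<close> that is positive exactly on \<open>U\<close>, continuity gives the minorization.
\<close>

theorem harris_from_green:
  assumes G_C0: "\<And>f. f \<in> BC \<Longrightarrow> G f \<in> vanishing_on D"
    and h: "h \<in> vanishing_on D" "\<And>x. x \<in> D \<Longrightarrow> 0 < h x"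
    and \<kappa>: "0 < \<kappa>" "\<And>x. x \<in> D \<Longrightarrow> G h x = 1 / \<kappa> * h x"
    and U: "open U" "\<And>x. x \<in> D \<Longrightarrow> \<exists>t\<ge>0. 0 < measure (K t x) (U \<inter> D)"
    and \<xi>: "sets \<xi> = sets (restrict_space borel D)" "emeasure \<xi> D \<noteq> 0" and T: "0 < T"
    and minor: "\<And>x A. x \<in> U \<inter> D \<Longrightarrow> A \<in> sets (restrict_space borel D) \<Longrightarrow> emeasure \<xi> A \<le> emeasure (K T x) A"
  shows "harris D K h \<kappa> \<xi>"
proof -
  have sp: "space \<xi> = D" using sets_eq_imp_space_eq[OF \<xi>(1)] by (simp add: space_restrict_space)
  have Ds: "D \<in> sets (restrict_space borel D)"
    using sets.top[of "restrict_space borel D"] by (simp add: space_restrict_space)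
  have "continuous_on D h" using vanishing_on_bounds(1)[OF h(1)] .
  moreover have "bounded (h ` D)" using vanishing_on_bounds(3)[OF h(1)] by (auto simp: bounded_iff)
  ultimately have hC: "h \<in> BC" by (simp add: bounded_continuous_on_def)
  \<comment> \<open>the case distinction is needed because \<open>infdist y {} = 0\<close>\<close>
  define f where "f y = (if U = UNIV then 1 else min 1 (infdist y (- U)))" for y
  have f_pos: "0 < f y" if "y \<in> U" for y
  proof (cases "U = UNIV")
    case False
    then have "infdist y (- U) \<noteq> 0"
      using in_closed_iff_infdist_zero[of "- U" y] U(1) that by (auto simp: closed_Compl)
    then show ?thesis using False infdist_nonneg[of y "- U"] by (simp add: f_def)
  qed (simp add: f_def)
  have f_zero: "f y = 0" if "y \<notin> U" for y using that by (auto simp: f_def)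
  have f01: "0 \<le> f y \<and> f y \<le> 1" for y by (auto simp: f_def infdist_nonneg)
  have "continuous_on D f" unfolding f_def by (cases "U = UNIV") (auto intro!: continuous_intros)
  then have f: "f \<in> BC" using f01 by (auto simp: bounded_continuous_on_def bounded_iff intro!: exI[of _ 1])
  have UD: "U \<inter> D \<in> sets (restrict_space borel D)"
    using U(1) by (auto simp: sets_restrict_space)
  have acc: "\<exists>t\<ge>0. 0 < Q t f x" if x: "x \<in> D" for x
  proof -
    obtain t where t: "0 \<le> t" "0 < measure (K t x) (U \<inter> D)" using U(2)[OF x] by blast
    have nn: "0 \<le> Q t f x" using f01 by (intro Q_nonneg t x) auto
    have "Q t f x \<noteq> 0"
    proof
      assume "Q t f x = 0"
      then have "AE y in K t x. f y = 0"
        using integral_nonneg_eq_0_iff_AE[OF integrable_K[OF t(1) x BC_BM[OF f]]] f01 by (auto simp: Q_def)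
      then have "AE y in K t x. y \<notin> U \<inter> D" by eventually_elim (use f_pos in force)
      moreover have "{y \<in> space (K t x). \<not> y \<notin> U \<inter> D} = U \<inter> D" using space_K[OF t(1) x] by auto
      ultimately have "emeasure (K t x) (U \<inter> D) = 0"
        using UD sets_K[OF t(1) x] AE_iff_measurable[of "U \<inter> D" "K t x" "\<lambda>y. y \<notin> U \<inter> D"] by simp
      then have "measure (K t x) (U \<inter> D) = 0" by (simp add: measure_def)
      then show False using t by simp
    qed
    then show ?thesis using nn t by (intro exI[of _ t]) auto
  qed
  obtain x1 where x1: "x1 \<in> U \<inter> D"
  proof -
    obtain x where x: "x \<in> D" using D_nonempty by blast
    obtain t where "0 < measure (K t x) (U \<inter> D)" using U(2)[OF x] by blast
    then have "U \<inter> D \<noteq> {}" by auto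
    then show ?thesis using that by blast
  qed
  have fin: "finite_measure \<xi>"
  proof
    interpret k: subprob_space "K T x1" using x1 T by (intro subprob_K) auto
    have "emeasure \<xi> (space \<xi>) \<le> emeasure (K T x1) D" using minor[OF x1 Ds] sp by simp
    then show "emeasure \<xi> (space \<xi>) \<noteq> \<infinity>" using k.emeasure_finite[of D] by (auto simp: top_unique)
  qed
  have minor': "(\<integral>y. g y \<partial>\<xi>) \<le> Q T g x" if "x \<in> U \<inter> D" "g \<in> BM" "\<And>y. y \<in> D \<Longrightarrow> 0 \<le> g y" for x g
    using dominated_integral[OF fin \<xi>(1) less_imp_le[OF T] _ minor[OF that(1)] that(2,3)] that(1) by blast
  have fU: "\<And>y. y \<in> D - U \<Longrightarrow> f y = 0" using f_zero by auto
  have f01D: "\<And>y. y \<in> D \<Longrightarrow> 0 \<le> f y \<and> f y \<le> 1" by (rule f01)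
  have "\<exists>a>0. \<exists>\<eta>>0. \<exists>p>0. \<forall>n\<ge>1. \<forall>r\<in>{real n * a..real n * (a + \<eta>)}. \<forall>g\<in>BM. (\<forall>y\<in>D. 0 \<le> g y) \<longrightarrow>
     p ^ n * (\<integral>y. g y \<partial>\<xi>) \<le> (\<integral>y. Q r g y \<partial>\<xi>)"
    by (rule renewal_bound(1)[where f = f and U = U and T = T]) (fact fin \<xi> T f f01D fU acc minor')+
  then obtain a \<eta> p where a: "0 < a" "0 < \<eta>" "0 < p" and renew: "\<forall>n\<ge>1. \<forall>r\<in>{real n * a..real n * (a + \<eta>)}. \<forall>g\<in>BM. (\<forall>y\<in>D. 0 \<le> g y) \<longrightarrow>
     p ^ n * (\<integral>y. g y \<partial>\<xi>) \<le> (\<integral>y. Q r g y \<partial>\<xi>)"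
    by (elim exE conjE) (rule that)
  have enter: "Q s f x * (\<integral>y. g y \<partial>\<xi>) \<le> Q (s + T) g x"
    if "x \<in> D" "0 \<le> s" "g \<in> BM" "\<And>y. y \<in> D \<Longrightarrow> 0 \<le> g y" for x s g
    by (rule renewal_bound(2)[where f = f and U = U and T = T]) (fact fin \<xi> T f f01D fU acc minor' that)+
  have Gf_pos: "0 < G f x" if "x \<in> D" for x
    using acc[OF that] G_pos[OF f _ _ that] f01 by blast
  have compact_min: "\<exists>b>0. \<forall>x\<in>L. b \<le> w x" if L: "compact L" "L \<subseteq> D" and w: "continuous_on D w" "\<And>x. x \<in> D \<Longrightarrow> 0 < w x" for L and w :: "'a \<Rightarrow> real"
  proof (cases "L = {}")
    case False
    then obtain z where "z \<in> L" "\<forall>x\<in>L. w z \<le> w x"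
      using continuous_attains_inf[OF L(1) False continuous_on_subset[OF w(1) L(2)]] by blast
    then show ?thesis using w(2) L(2) by blast
  qed (auto intro: exI[of _ 1])
  have drift: "\<exists>C\<ge>0. \<forall>x\<in>D. Q 1 (\<lambda>_. 1) x \<le> \<epsilon> + C * h x" if \<epsilon>: "0 < \<epsilon>" for \<epsilon>
  proof -
    obtain L where L: "compact L" "L \<subseteq> D" "\<forall>x\<in>D - L. \<bar>G (\<lambda>_. 1) x\<bar> \<le> \<epsilon>"
      using vanishing_on_bounds(2)[OF G_C0[OF one_BC] \<epsilon>] by blast
    obtain b where b: "0 < b" "\<forall>x\<in>L. b \<le> h x"
      using compact_min[OF L(1,2) \<open>continuous_on D h\<close> h(2)] by blast
    have "Q 1 (\<lambda>_. 1) x \<le> \<epsilon> + 1 / b * h x" if x: "x \<in> D" for x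
    proof (cases "x \<in> L")
      case True
      then have "1 \<le> 1 / b * h x" using b by (simp add: field_simps)
      then show ?thesis using Q_one_le[of 1 x] x \<epsilon> by simp
    next
      case False
      then have "Q 1 (\<lambda>_. 1) x \<le> \<epsilon>" using L(3) Q_one_le_G[OF x] x by force
      moreover have "0 \<le> 1 / b * h x" using h(2)[OF x] b by simp
      ultimately show ?thesis by linarith
    qed
    then show ?thesis using b by (intro exI[of _ "1 / b"]) auto
  qed
  have minorization: "\<exists>N\<ge>1. \<exists>c>0. \<forall>x\<in>D. \<delta> \<le> h x \<longrightarrow>
      (\<forall>g\<in>BM. (\<forall>y\<in>D. 0 \<le> g y) \<longrightarrow> c * (\<integral>y. g y \<partial>\<xi>) \<le> Q N g x)" if \<delta>: "0 < \<delta>" for \<delta>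
  proof -
    obtain L where L: "compact L" "L \<subseteq> D" "\<forall>x\<in>D - L. \<bar>h x\<bar> \<le> \<delta> / 2"
      using vanishing_on_bounds(2)[OF h(1), of "\<delta> / 2"] \<delta> by auto
    obtain b where b: "0 < b" "\<forall>x\<in>L. b \<le> G f x"
      using compact_min[OF L(1,2) vanishing_on_bounds(1)[OF G_C0[OF f]] Gf_pos] by blast
    obtain S q where S: "0 < S" "0 < q" "\<forall>x\<in>D. b \<le> G f x \<longrightarrow> (\<exists>s\<in>{0..S}. q \<le> Q s f x)"
      using G_truncation[OF f b(1)] by blast
    \<comment> \<open>large enough that the window \<open>n * \<eta>\<close> covers all delays \<open>s \<le> S\<close>; the last term ensures \<open>N \<ge> 1\<close>\<close>
    define n where "n = max 1 (max (nat \<lceil>S / \<eta>\<rceil>) (nat \<lceil>1 / a\<rceil>))"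
    have "S / \<eta> \<le> real n" "1 / a \<le> real n" by (auto simp: n_def le_max_iff_disj of_nat_max)
    then have n: "1 \<le> n" "S \<le> real n * \<eta>" "1 \<le> real n * a" using a by (auto simp: n_def field_simps)
    define N where "N = T + S + real n * a"
    have "q * p ^ n * (\<integral>y. g y \<partial>\<xi>) \<le> Q N g x"
      if x: "x \<in> D" "\<delta> \<le> h x" and g: "g \<in> BM" "\<forall>y\<in>D. 0 \<le> g y" for x g
    proof -
      have "x \<in> L" using L(3) x \<delta> h(2)[OF x(1)] by (rule_tac ccontr) force
      then obtain s where s: "s \<in> {0..S}" "q \<le> Q s f x" using S(3) b(2) x(1) by blast
      define r where "r = S - s + real n * a"
      have r: "r \<in> {real n * a..real n * (a + \<eta>)}" using s n by (simp add: r_def algebra_simps)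
      have r0: "0 \<le> r" using s n by (simp add: r_def)
      have gr: "Q r g \<in> BM" "\<And>y. y \<in> D \<Longrightarrow> 0 \<le> Q r g y" using g r0 by (auto intro!: Q_BM Q_nonneg)
      have i: "0 \<le> (\<integral>y. g y \<partial>\<xi>)" using g sp by (intro integral_nonneg_AE AE_I2) auto
      have "q * (p ^ n * (\<integral>y. g y \<partial>\<xi>)) \<le> Q s f x * (\<integral>y. Q r g y \<partial>\<xi>)"
        using renew n r g s S(2) a(3) i by (intro mult_mono) auto
      also have "\<dots> \<le> Q (s + T) (Q r g) x" using s by (intro enter x gr) auto
      also have "\<dots> = Q N g x"
      proof -
        have "N = (s + T) + r" by (simp add: N_def r_def)
        then show ?thesis using Q_semigroup[of "s + T" r x g] s T r0 x g by simp
      qed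
      finally show ?thesis by (simp add: mult.assoc)
    qed
    moreover have "1 \<le> N" using n T S by (simp add: N_def)
    moreover have "0 < q * p ^ n" using S a by simp
    ultimately show ?thesis by blast
  qed
  show ?thesis
  proof (rule harris.intro[OF killed_kernels_axioms], rule harris_axioms.intro)
    show "h \<in> BM" using hC by (rule BC_BM)
    show "Q t h x = exp (- \<kappa> * t) * h x" if "0 \<le> t" "x \<in> D" for t x
      by (rule eigen_exponential[OF hC \<kappa> that])
  qed (fact h(2) \<kappa>(1) drift fin \<xi> minorization)+
qed

end

section \<open>The Markov property for functionals of the future path\<close>

lemma grid_point_between:
  fixes a b e :: real
  assumes "0 \<le> a" "a < b" "0 < e"
  shows "\<exists>k0. \<forall>k\<ge>k0. \<exists>j. a \<le> real j * (e / 2 ^ k) \<and> real j * (e / 2 ^ k) < b"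
proof -
  obtain k0 where k0: "e / (b - a) < 2 ^ k0" using real_arch_pow[of 2 "e / (b - a)"] by auto
  have "\<exists>j. a \<le> real j * (e / 2 ^ k) \<and> real j * (e / 2 ^ k) < b" if "k0 \<le> k" for k
  proof -
    define d where "d = e / 2 ^ k"
    have d: "0 < d" using assms by (simp add: d_def)
    have "e / (b - a) < 2 ^ k" using k0 that power_increasing[of k0 k "2::real"] by linarith
    then have db: "d < b - a" using assms by (simp add: d_def field_simps)
    define j where "j = nat \<lceil>a / d\<rceil>"
    have "0 \<le> a / d" using assms d by simp
    then have "a / d \<le> real j" "real j < a / d + 1" by (auto simp: j_def) linarith+
    then have "a \<le> real j * d" "real j * d < a + d" using d by (simp_all add: field_simps)
    then show ?thesis using db unfolding d_def by (intro exI[of _ j]) auto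
  qed
  then show ?thesis by blast
qed

context feller_process
begin

lemma space_law [simp]: "space (Pr x) = space \<A>"
  using sets_eq_imp_space_eq[OF sets_law] .

lemma sets_F: "0 \<le> t \<Longrightarrow> A \<in> sets (F t) \<Longrightarrow> A \<in> sets \<A>"
  using filtration_subalgebra[of t] by (auto simp: subalgebra_def)

lemma space_F: "0 \<le> t \<Longrightarrow> space (F t) = space \<A>"
  using filtration_subalgebra[of t] by (auto simp: subalgebra_def)

lemma measurable_F_mono: "0 \<le> s \<Longrightarrow> s \<le> t \<Longrightarrow> f \<in> F s \<rightarrow>\<^sub>M N \<Longrightarrow> f \<in> F t \<rightarrow>\<^sub>M N"
  using filtration_mono[of s t] space_F[of s] space_F[of t] by (auto simp: measurable_def)

lemma measurable_F_A: "0 \<le> t \<Longrightarrow> f \<in> F t \<rightarrow>\<^sub>M N \<Longrightarrow> f \<in> \<A> \<rightarrow>\<^sub>M N"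
  using measurable_from_subalg[OF filtration_subalgebra] .

lemma measurable_law: "f \<in> \<A> \<rightarrow>\<^sub>M N \<Longrightarrow> f \<in> Pr x \<rightarrow>\<^sub>M N"
  using measurable_cong_sets[OF sets_law refl] by blast

lemma X_measurable: "0 \<le> t \<Longrightarrow> X t \<in> \<A> \<rightarrow>\<^sub>M borel"
  using measurable_F_A[OF _ adapted] .

text \<open>
Bounded random variables: measurable for the ambient \<open>\<sigma>\<close>-algebra, respectively for \<open>F t\<close>.
\<close>

definition bmeas :: "('w \<Rightarrow> real) \<Rightarrow> bool" where
  "bmeas Z \<longleftrightarrow> Z \<in> borel_measurable \<A> \<and> (\<exists>C. \<forall>\<omega>\<in>space \<A>. \<bar>Z \<omega>\<bar> \<le> C)"

definition bmeasF :: "real \<Rightarrow> ('w \<Rightarrow> real) \<Rightarrow> bool" where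
  "bmeasF t Z \<longleftrightarrow> Z \<in> borel_measurable (F t) \<and> (\<exists>C. \<forall>\<omega>\<in>space \<A>. \<bar>Z \<omega>\<bar> \<le> C)"

lemma bmeasF_bmeas: "0 \<le> t \<Longrightarrow> bmeasF t Z \<Longrightarrow> bmeas Z"
  unfolding bmeas_def bmeasF_def using measurable_F_A[of t Z borel] by blast

lemma bmeas_integrable: assumes "bmeas Z" shows "integrable (Pr x) Z"
proof -
  interpret prob_space "Pr x" by (rule prob_law)
  obtain C where "\<forall>\<omega>\<in>space \<A>. \<bar>Z \<omega>\<bar> \<le> C" "Z \<in> borel_measurable \<A>" using assms by (auto simp: bmeas_def)
  then have "AE \<omega> in Pr x. norm (Z \<omega>) \<le> C" "Z \<in> borel_measurable (Pr x)"
    by (auto intro!: AE_I2 measurable_law)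
  then show ?thesis by (rule integrable_const_bound)
qed

lemma bounded_product:
  assumes "\<exists>C::real. \<forall>\<omega>\<in>S. \<bar>Y \<omega>\<bar> \<le> C" "\<exists>C::real. \<forall>\<omega>\<in>S. \<bar>Z \<omega>\<bar> \<le> C"
  shows "\<exists>C. \<forall>\<omega>\<in>S. \<bar>Y \<omega> * Z \<omega>\<bar> \<le> C"
proof -
  obtain C C' where C: "\<forall>\<omega>\<in>S. \<bar>Y \<omega>\<bar> \<le> C" "\<forall>\<omega>\<in>S. \<bar>Z \<omega>\<bar> \<le> C'" using assms by (elim exE)
  have "\<bar>Y \<omega> * Z \<omega>\<bar> \<le> C * C'" if "\<omega> \<in> S" for \<omega>
  proof -
    have "\<bar>Y \<omega>\<bar> \<le> C" "\<bar>Z \<omega>\<bar> \<le> C'" using C that by auto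
    then show ?thesis unfolding abs_mult by (intro mult_mono) linarith+
  qed
  then show ?thesis by blast
qed

lemma bmeas_mult: "bmeas Y \<Longrightarrow> bmeas Z \<Longrightarrow> bmeas (\<lambda>\<omega>. Y \<omega> * Z \<omega>)"
  unfolding bmeas_def by (intro conjI borel_measurable_times bounded_product) (elim conjE, assumption)+

lemma bmeasF_mult: "bmeasF t Y \<Longrightarrow> bmeasF t Z \<Longrightarrow> bmeasF t (\<lambda>\<omega>. Y \<omega> * Z \<omega>)"
  unfolding bmeasF_def by (intro conjI borel_measurable_times bounded_product) (elim conjE, assumption)+

lemma bmeasF_mono: "0 \<le> s \<Longrightarrow> s \<le> t \<Longrightarrow> bmeasF s Z \<Longrightarrow> bmeasF t Z"
  unfolding bmeasF_def using measurable_F_mono by blast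

text \<open>
Bounded Borel functions on the whole space.
\<close>

definition bfun :: "('a \<Rightarrow> real) \<Rightarrow> bool" where
  "bfun f \<longleftrightarrow> f \<in> borel_measurable borel \<and> (\<exists>C. \<forall>x. \<bar>f x\<bar> \<le> C)"

lemma bfun_X_F: "0 \<le> t \<Longrightarrow> bfun f \<Longrightarrow> bmeasF t (\<lambda>\<omega>. f (X t \<omega>))"
  unfolding bfun_def bmeasF_def using measurable_compose[OF adapted] by blast

lemma bfun_X: "0 \<le> t \<Longrightarrow> bfun f \<Longrightarrow> bmeas (\<lambda>\<omega>. f (X t \<omega>))"
  using bmeasF_bmeas bfun_X_F by blast

lemma bfun_mult: "bfun f \<Longrightarrow> bfun g \<Longrightarrow> bfun (\<lambda>x. f x * g x)"
  unfolding bfun_def using bounded_product[of UNIV f g] borel_measurable_times[of f borel g] by simp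

lemma prob_kernel: "0 \<le> t \<Longrightarrow> prob_space (P t x)" "0 \<le> t \<Longrightarrow> sets (P t x) = sets borel"
  using measurable_space[OF kernel, of t x] by (auto simp: space_prob_algebra)

lemma kernel_bfun: assumes t: "0 \<le> t" and f: "bfun f" shows "bfun (\<lambda>x. \<integral>y. f y \<partial>P t x)"
proof -
  obtain C where fm: "f \<in> borel_measurable borel" and C: "\<forall>x. \<bar>f x\<bar> \<le> C" using f by (auto simp: bfun_def)
  have "(\<lambda>x. \<integral>y. f y \<partial>P t x) \<in> borel_measurable borel"
    using measurable_prob_algebraD[OF kernel[OF t]] integral_measurable_subprob_algebra[OF fm] by (rule measurable_compose)
  moreover have "\<bar>\<integral>y. f y \<partial>P t x\<bar> \<le> C" for x
  proof -
    interpret prob_space "P t x" by (rule prob_kernel[OF t])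
    have "f \<in> borel_measurable (P t x)" using fm measurable_cong_sets[OF prob_kernel(2)[OF t] refl] by blast
    then have i: "integrable (P t x) f" using C by (intro integrable_const_bound[where B = C]) auto
    have "\<bar>\<integral>y. f y \<partial>P t x\<bar> \<le> (\<integral>y. \<bar>f y\<bar> \<partial>P t x)" by (rule integral_abs_bound)
    also have "\<dots> \<le> (\<integral>y. C \<partial>P t x)" using i C by (intro integral_mono) auto
    finally show ?thesis by (simp add: prob_space)
  qed
  ultimately show ?thesis by (auto simp: bfun_def)
qed

lemma simple_markov:
  assumes t: "0 \<le> t" "0 \<le> s" and f: "bfun f" and Z: "bmeasF t Z"
  shows "(\<integral>\<omega>. Z \<omega> * f (X (t + s) \<omega>) \<partial>Pr x) = (\<integral>\<omega>. Z \<omega> * (\<integral>y. f y \<partial>P s (X t \<omega>)) \<partial>Pr x)"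
proof -
  interpret prob_space "Pr x" by (rule prob_law)
  have sub: "subalgebra (Pr x) (F t)" using filtration_subalgebra[OF t(1)] by (simp add: subalgebra_def sets_law)
  interpret finite_measure_subalgebra "Pr x" "F t" by unfold_locales (rule sub)
  have ts: "0 \<le> t + s" using t by simp
  have i: "integrable (Pr x) (\<lambda>\<omega>. Z \<omega> * f (X (t + s) \<omega>))"
    using bmeas_integrable[OF bmeas_mult[OF bmeasF_bmeas[OF t(1) Z] bfun_X[OF ts f]]] .
  have fm: "(\<lambda>\<omega>. f (X (t + s) \<omega>)) \<in> borel_measurable (Pr x)"
    using bfun_X[OF ts f] measurable_law by (auto simp: bmeas_def)
  have Zm: "Z \<in> borel_measurable (F t)" using Z by (simp add: bmeasF_def)
  have mk: "AE \<omega> in Pr x. real_cond_exp (Pr x) (F t) (\<lambda>\<omega>. f (X (t + s) \<omega>)) \<omega> = (\<integral>y. f y \<partial>P s (X t \<omega>))"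
    using f by (intro markov_property t) (auto simp: bfun_def bounded_measurable_on_def bounded_iff)
  have "(\<integral>\<omega>. Z \<omega> * f (X (t + s) \<omega>) \<partial>Pr x) = (\<integral>\<omega>. Z \<omega> * real_cond_exp (Pr x) (F t) (\<lambda>\<omega>. f (X (t + s) \<omega>)) \<omega> \<partial>Pr x)"
    using real_cond_exp_intg(2)[OF i Zm fm] by simp
  also have "\<dots> = (\<integral>\<omega>. Z \<omega> * (\<integral>y. f y \<partial>P s (X t \<omega>)) \<partial>Pr x)"
  proof (rule integral_cong_AE)
    show "(\<lambda>\<omega>. Z \<omega> * real_cond_exp (Pr x) (F t) (\<lambda>\<omega>. f (X (t + s) \<omega>)) \<omega>) \<in> borel_measurable (Pr x)"
      using real_cond_exp_intg(1)[OF i Zm fm] by auto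
    show "(\<lambda>\<omega>. Z \<omega> * (\<integral>y. f y \<partial>P s (X t \<omega>))) \<in> borel_measurable (Pr x)"
      using bmeas_integrable[OF bmeas_mult[OF bmeasF_bmeas[OF t(1) Z] bfun_X[OF t(1) kernel_bfun[OF t(2) f]]]] by auto
    show "AE \<omega> in Pr x. Z \<omega> * real_cond_exp (Pr x) (F t) (\<lambda>\<omega>. f (X (t + s) \<omega>)) \<omega> = Z \<omega> * (\<integral>y. f y \<partial>P s (X t \<omega>))"
      using mk by eventually_elim simp
  qed
  finally show ?thesis .
qed

lemma starts_at: "AE \<omega> in Pr x. X 0 \<omega> = x"
proof -
  interpret prob_space "Pr x" by (rule prob_law)
  have m: "{\<omega> \<in> space \<A>. X 0 \<omega> = x} \<in> sets (Pr x)"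
  proof -
    have "X 0 -` {x} \<inter> space \<A> \<in> sets \<A>" using X_measurable[of 0] by (rule measurable_sets) auto
    moreover have "X 0 -` {x} \<inter> space \<A> = {\<omega> \<in> space \<A>. X 0 \<omega> = x}" by auto
    ultimately show ?thesis by (simp add: sets_law)
  qed
  have "AE \<omega> in Pr x. \<omega> \<in> {\<omega> \<in> space \<A>. X 0 \<omega> = x}"
    using initial[of x] m by (simp add: prob_eq_1)
  then show ?thesis by eventually_elim simp
qed

lemma integral_starts_at:
  assumes f: "bfun f" shows "(\<integral>\<omega>. f (X 0 \<omega>) \<partial>Pr x) = f x"
proof -
  interpret prob_space "Pr x" by (rule prob_law)
  have "(\<integral>\<omega>. f (X 0 \<omega>) \<partial>Pr x) = (\<integral>\<omega>. f x \<partial>Pr x)"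
  proof (rule integral_cong_AE)
    show "AE \<omega> in Pr x. f (X 0 \<omega>) = f x" using starts_at by eventually_elim simp
  qed (use bmeas_integrable[OF bfun_X[OF _ f]] in auto)
  then show ?thesis using prob_space by simp
qed

text \<open>
  A functional \<open>W\<close> of the path, where \<open>W t\<close> is to be thought of as the functional applied to the path shifted by \<open>t\<close>, satisfies the
  Markov property if conditioning \<open>W t\<close> on \<open>F t\<close> amounts to averaging \<open>W 0\<close> under the law started at \<open>X t\<close>. There are
  no shift operators on the sample space, and measurability of \<open>x \<mapsto> Pr x\<close> is not assumed; measurability of
  \<open>y \<mapsto> \<integral> W 0 d(Pr y)\<close> is therefore part of the definition.
\<close>

definition markov_functional :: "(real \<Rightarrow> 'w \<Rightarrow> real) \<Rightarrow> bool" where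
  "markov_functional W \<longleftrightarrow> (\<forall>t\<ge>0. bmeas (W t)) \<and> bfun (\<lambda>y. \<integral>\<omega>. W 0 \<omega> \<partial>Pr y) \<and>
     (\<forall>x t Z. 0 \<le> t \<longrightarrow> bmeasF t Z \<longrightarrow>
        (\<integral>\<omega>. Z \<omega> * W t \<omega> \<partial>Pr x) = (\<integral>\<omega>. Z \<omega> * (\<integral>\<omega>'. W 0 \<omega>' \<partial>Pr (X t \<omega>)) \<partial>Pr x))"

lemma markov_functionalI:
  assumes W: "\<And>t. 0 \<le> t \<Longrightarrow> bmeas (W t)" and \<Phi>: "bfun \<Phi>"
    and eq: "\<And>x t Z. 0 \<le> t \<Longrightarrow> bmeasF t Z \<Longrightarrow> (\<integral>\<omega>. Z \<omega> * W t \<omega> \<partial>Pr x) = (\<integral>\<omega>. Z \<omega> * \<Phi> (X t \<omega>) \<partial>Pr x)"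
  shows "markov_functional W"
proof -
  have "(\<integral>\<omega>. W 0 \<omega> \<partial>Pr y) = \<Phi> y" for y
  proof -
    have "bmeasF 0 (\<lambda>_. 1)" by (auto simp: bmeasF_def)
    from eq[OF _ this, of y] have "(\<integral>\<omega>. W 0 \<omega> \<partial>Pr y) = (\<integral>\<omega>. \<Phi> (X 0 \<omega>) \<partial>Pr y)" by simp
    then show ?thesis by (simp add: integral_starts_at[OF \<Phi>])
  qed
  then show ?thesis using assms by (simp add: markov_functional_def)
qed

text \<open>
Finitely many times on a regular grid, by induction on their number.
\<close>

lemma markov_functional_product:
  assumes d: "0 \<le> d" and g: "\<And>j. bfun (g j)"
  shows "markov_functional (\<lambda>t \<omega>. \<Prod>j<n. g j (X (t + real j * d) \<omega>))"
proof -
  have meas: "bmeas (\<lambda>\<omega>. \<Prod>j<n. g j (X (t + real j * d) \<omega>))" if "0 \<le> t" "\<And>j. bfun (g j)" for n t and g :: "nat \<Rightarrow> 'a \<Rightarrow> real"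
  proof (induction n)
    case 0
    then show ?case by (auto simp: bmeas_def)
  next
    case (Suc n)
    have "bmeas (\<lambda>\<omega>. g n (X (t + real n * d) \<omega>))" using that d by (intro bfun_X) auto
    then show ?case using bmeas_mult[OF Suc.IH] by simp
  qed
  have "\<exists>\<Phi>. bfun \<Phi> \<and> (\<forall>x t Z. 0 \<le> t \<longrightarrow> bmeasF t Z \<longrightarrow>
     (\<integral>\<omega>. Z \<omega> * (\<Prod>j<n. g j (X (t + real j * d) \<omega>)) \<partial>Pr x) = (\<integral>\<omega>. Z \<omega> * \<Phi> (X t \<omega>) \<partial>Pr x))"
    if "\<And>j. bfun (g j)" for g :: "nat \<Rightarrow> 'a \<Rightarrow> real"
    using that
  proof (induction n arbitrary: g)
    case 0
    have "bfun (\<lambda>_. 1)" by (auto simp: bfun_def)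
    then show ?case by (intro exI[of _ "\<lambda>_. 1"]) simp
  next
    case (Suc n)
    obtain \<Phi> where \<Phi>: "bfun \<Phi>" and eq: "\<And>x t Z. 0 \<le> t \<Longrightarrow> bmeasF t Z \<Longrightarrow>
     (\<integral>\<omega>. Z \<omega> * (\<Prod>j<n. g (Suc j) (X (t + real j * d) \<omega>)) \<partial>Pr x) = (\<integral>\<omega>. Z \<omega> * \<Phi> (X t \<omega>) \<partial>Pr x)"
      using Suc.IH[of "\<lambda>j. g (Suc j)"] Suc.prems by blast
    define \<Psi> where "\<Psi> y = g 0 y * (\<integral>z. \<Phi> z \<partial>P d y)" for y
    have "bfun \<Psi>" unfolding \<Psi>_def by (intro bfun_mult Suc.prems kernel_bfun d \<Phi>)
    moreover have "(\<integral>\<omega>. Z \<omega> * (\<Prod>j<Suc n. g j (X (t + real j * d) \<omega>)) \<partial>Pr x) = (\<integral>\<omega>. Z \<omega> * \<Psi> (X t \<omega>) \<partial>Pr x)"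
      if t: "0 \<le> t" and Z: "bmeasF t Z" for x t Z
    proof -
      have Zg: "bmeasF t (\<lambda>\<omega>. Z \<omega> * g 0 (X t \<omega>))" by (intro bmeasF_mult Z bfun_X_F t Suc.prems)
      have "(\<integral>\<omega>. Z \<omega> * (\<Prod>j<Suc n. g j (X (t + real j * d) \<omega>)) \<partial>Pr x)
          = (\<integral>\<omega>. (Z \<omega> * g 0 (X t \<omega>)) * (\<Prod>j<n. g (Suc j) (X ((t + d) + real j * d) \<omega>)) \<partial>Pr x)"
        by (simp only: prod.lessThan_Suc_shift) (simp add: algebra_simps)
      also have "\<dots> = (\<integral>\<omega>. (Z \<omega> * g 0 (X t \<omega>)) * \<Phi> (X (t + d) \<omega>) \<partial>Pr x)"
        using t d by (intro eq bmeasF_mono[OF _ _ Zg]) auto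
      also have "\<dots> = (\<integral>\<omega>. (Z \<omega> * g 0 (X t \<omega>)) * (\<integral>z. \<Phi> z \<partial>P d (X t \<omega>)) \<partial>Pr x)"
        by (rule simple_markov[OF t d \<Phi> Zg])
      finally show ?thesis by (simp add: \<Psi>_def mult.assoc)
    qed
    ultimately show ?case by blast
  qed
  then obtain \<Phi> where "bfun \<Phi>" "\<And>x t Z. 0 \<le> t \<Longrightarrow> bmeasF t Z \<Longrightarrow>
     (\<integral>\<omega>. Z \<omega> * (\<Prod>j<n. g j (X (t + real j * d) \<omega>)) \<partial>Pr x) = (\<integral>\<omega>. Z \<omega> * \<Phi> (X t \<omega>) \<partial>Pr x)"
    using g by blast
  then show ?thesis using meas g by (intro markov_functionalI) auto
qed

lemma markov_functionalD:
  assumes "markov_functional W"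
  shows "0 \<le> t \<Longrightarrow> bmeas (W t)" and "bfun (\<lambda>y. \<integral>\<omega>. W 0 \<omega> \<partial>Pr y)"
    and "0 \<le> t \<Longrightarrow> bmeasF t Z \<Longrightarrow>
        (\<integral>\<omega>. Z \<omega> * W t \<omega> \<partial>Pr x) = (\<integral>\<omega>. Z \<omega> * (\<integral>\<omega>'. W 0 \<omega>' \<partial>Pr (X t \<omega>)) \<partial>Pr x)"
  using assms unfolding markov_functional_def by simp_all

lemma markov_functional_lim:
  assumes W: "\<And>k. markov_functional (W k)" and C: "\<And>k t \<omega>. 0 \<le> t \<Longrightarrow> \<omega> \<in> space \<A> \<Longrightarrow> \<bar>W k t \<omega>\<bar> \<le> C"
    and lim: "\<And>t \<omega>. 0 \<le> t \<Longrightarrow> \<omega> \<in> space \<A> \<Longrightarrow> (\<lambda>k. W k t \<omega>) \<longlonglongrightarrow> V t \<omega>"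
  shows "markov_functional V"
proof -
  have Vm: "bmeas (V t)" if t: "0 \<le> t" for t
  proof -
    have "V t \<in> borel_measurable \<A>"
    proof (rule borel_measurable_LIMSEQ_real)
      show "(\<lambda>k. W k t \<omega>) \<longlonglongrightarrow> V t \<omega>" if "\<omega> \<in> space \<A>" for \<omega> using lim[OF t that] .
      show "W k t \<in> borel_measurable \<A>" for k using markov_functionalD(1)[OF W t] unfolding bmeas_def by (rule conjunct1)
    qed
    moreover have "\<forall>\<omega>\<in>space \<A>. \<bar>V t \<omega>\<bar> \<le> C"
    proof
      fix \<omega> assume w: "\<omega> \<in> space \<A>"
      have "\<forall>k\<ge>0. \<bar>W k t \<omega>\<bar> \<le> C" using C[OF t w] by simp
      then show "\<bar>V t \<omega>\<bar> \<le> C" using LIMSEQ_le_const2[OF tendsto_rabs[OF lim[OF t w]]] by blast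
    qed
    ultimately show ?thesis unfolding bmeas_def by blast
  qed
  have int: "(\<lambda>k. \<integral>\<omega>. Z \<omega> * W k t \<omega> \<partial>Pr x) \<longlonglongrightarrow> (\<integral>\<omega>. Z \<omega> * V t \<omega> \<partial>Pr x)" if t: "0 \<le> t" and Z: "bmeas Z" for t Z x
  proof (rule integral_dominated_convergence[where w = "\<lambda>\<omega>. \<bar>Z \<omega>\<bar> * C"])
    show "integrable (Pr x) (\<lambda>\<omega>. \<bar>Z \<omega>\<bar> * C)" using bmeas_integrable[OF Z] by simp
    show "(\<lambda>\<omega>. Z \<omega> * V t \<omega>) \<in> borel_measurable (Pr x)"
      using bmeas_integrable[OF bmeas_mult[OF Z Vm[OF t]]] by auto
    show "(\<lambda>\<omega>. Z \<omega> * W k t \<omega>) \<in> borel_measurable (Pr x)" for k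
      using bmeas_integrable[OF bmeas_mult[OF Z markov_functionalD(1)[OF W t]]] by auto
    show "AE \<omega> in Pr x. (\<lambda>k. Z \<omega> * W k t \<omega>) \<longlonglongrightarrow> Z \<omega> * V t \<omega>"
      by (rule AE_I2, rule tendsto_mult_left, rule lim[OF t]) simp
    show "AE \<omega> in Pr x. norm (Z \<omega> * W k t \<omega>) \<le> \<bar>Z \<omega>\<bar> * C" for k
    proof (rule AE_I2)
      fix \<omega> assume "\<omega> \<in> space (Pr x)"
      then have "\<bar>W k t \<omega>\<bar> \<le> C" by (intro C t) simp
      then show "norm (Z \<omega> * W k t \<omega>) \<le> \<bar>Z \<omega>\<bar> * C" by (simp add: abs_mult mult_left_mono)
    qed
  qed
  define \<Phi> where "\<Phi> k y = (\<integral>\<omega>. W k 0 \<omega> \<partial>Pr y)" for k y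
  define \<Psi> where "\<Psi> y = (\<integral>\<omega>. V 0 \<omega> \<partial>Pr y)" for y
  have one: "bmeas (\<lambda>_. 1)" by (auto simp: bmeas_def)
  have lim\<Phi>: "(\<lambda>k. \<Phi> k y) \<longlonglongrightarrow> \<Psi> y" for y using int[OF order_refl one, of y] by (simp add: \<Phi>_def \<Psi>_def)
  have \<Phi>b: "\<bar>\<Phi> k y\<bar> \<le> C" for k y
  proof -
    interpret prob_space "Pr y" by (rule prob_law)
    have i: "integrable (Pr y) (W k 0)" by (intro bmeas_integrable markov_functionalD(1)[OF W]) simp
    have "\<bar>\<Phi> k y\<bar> \<le> (\<integral>\<omega>. \<bar>W k 0 \<omega>\<bar> \<partial>Pr y)" unfolding \<Phi>_def by (rule integral_abs_bound)
    also have "\<dots> \<le> (\<integral>\<omega>. C \<partial>Pr y)" using i C[of 0] by (intro integral_mono) auto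
    finally show ?thesis using prob_space by simp
  qed
  have \<Phi>f: "bfun (\<Phi> k)" for k using markov_functionalD(2)[OF W[of k]] by (simp add: \<Phi>_def[abs_def])
  have \<Psi>f: "bfun \<Psi>"
  proof -
    have "\<Psi> \<in> borel_measurable borel"
    proof (rule borel_measurable_LIMSEQ_real)
      show "(\<lambda>k. \<Phi> k y) \<longlonglongrightarrow> \<Psi> y" for y by (rule lim\<Phi>)
      show "\<Phi> k \<in> borel_measurable borel" for k using \<Phi>f[of k] unfolding bfun_def by (rule conjunct1)
    qed
    moreover have "\<bar>\<Psi> y\<bar> \<le> C" for y
    proof -
      have "\<forall>k\<ge>0. \<bar>\<Phi> k y\<bar> \<le> C" using \<Phi>b by simp
      then show ?thesis using LIMSEQ_le_const2[OF tendsto_rabs[OF lim\<Phi>]] by blast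
    qed
    ultimately show ?thesis unfolding bfun_def by blast
  qed
  show ?thesis
  proof (rule markov_functionalI[OF Vm \<Psi>f])
    fix x t Z assume t: "0 \<le> t" and Z: "bmeasF t Z"
    have Zm: "bmeas Z" using bmeasF_bmeas t Z by blast
    have "(\<lambda>k. \<integral>\<omega>. Z \<omega> * \<Phi> k (X t \<omega>) \<partial>Pr x) \<longlonglongrightarrow> (\<integral>\<omega>. Z \<omega> * \<Psi> (X t \<omega>) \<partial>Pr x)"
    proof (rule integral_dominated_convergence[where w = "\<lambda>\<omega>. \<bar>Z \<omega>\<bar> * C"])
      show "integrable (Pr x) (\<lambda>\<omega>. \<bar>Z \<omega>\<bar> * C)" using bmeas_integrable[OF Zm] by simp
      show "(\<lambda>\<omega>. Z \<omega> * \<Psi> (X t \<omega>)) \<in> borel_measurable (Pr x)"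
        using bmeas_integrable[OF bmeas_mult[OF Zm bfun_X[OF t \<Psi>f]]] by auto
      show "(\<lambda>\<omega>. Z \<omega> * \<Phi> k (X t \<omega>)) \<in> borel_measurable (Pr x)" for k
        using bmeas_integrable[OF bmeas_mult[OF Zm bfun_X[OF t \<Phi>f]]] by auto
      show "AE \<omega> in Pr x. (\<lambda>k. Z \<omega> * \<Phi> k (X t \<omega>)) \<longlonglongrightarrow> Z \<omega> * \<Psi> (X t \<omega>)"
        by (intro AE_I2 tendsto_mult_left lim\<Phi>)
      show "AE \<omega> in Pr x. norm (Z \<omega> * \<Phi> k (X t \<omega>)) \<le> \<bar>Z \<omega>\<bar> * C" for k
        by (rule AE_I2) (simp add: abs_mult mult_left_mono \<Phi>b)
    qed
    moreover have "(\<integral>\<omega>. Z \<omega> * \<Phi> k (X t \<omega>) \<partial>Pr x) = (\<integral>\<omega>. Z \<omega> * W k t \<omega> \<partial>Pr x)" for k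
      using markov_functionalD(3)[OF W[of k] t Z] by (simp add: \<Phi>_def)
    ultimately have "(\<lambda>k. \<integral>\<omega>. Z \<omega> * W k t \<omega> \<partial>Pr x) \<longlonglongrightarrow> (\<integral>\<omega>. Z \<omega> * \<Psi> (X t \<omega>) \<partial>Pr x)" by simp
    then show "(\<integral>\<omega>. Z \<omega> * V t \<omega> \<partial>Pr x) = (\<integral>\<omega>. Z \<omega> * \<Psi> (X t \<omega>) \<partial>Pr x)"
      using int[OF t Zm, of x] LIMSEQ_unique by blast
  qed
qed

end

section \<open>The killed process as a semigroup of kernels\<close>

lemma prod_of_bool:
  fixes n :: nat
  shows "(\<Prod>j<n. of_bool (p j) :: real) = of_bool (\<forall>j<n. p j)"
  by (induction n) (auto simp: less_Suc_eq)

context feller_process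
begin

text \<open>
  A right-continuous path that leaves a closed set is seen outside that set on every sufficiently fine dyadic grid.
\<close>

lemma leaves_on_grid:
  assumes w: "\<omega> \<in> space \<A>" and S: "closed S" and e: "0 < e" and t: "0 \<le> t"
    and r: "0 \<le> r" "r < u" "X (t + r) \<omega> \<notin> S"
  shows "\<exists>k0. \<forall>k\<ge>k0. \<exists>j. real j * (e / 2 ^ k) < u \<and> X (t + real j * (e / 2 ^ k)) \<omega> \<notin> S"
proof -
  have "((\<lambda>s. X s \<omega>) \<longlongrightarrow> X (t + r) \<omega>) (at_right (t + r))" using w t r by (intro right_continuous_paths) auto
  moreover have "open (- S)" "X (t + r) \<omega> \<in> - S" using S r by auto
  ultimately have "eventually (\<lambda>s. X s \<omega> \<in> - S) (at_right (t + r))" by (rule topological_tendstoD)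
  then obtain b where b: "t + r < b" "\<And>s. t + r < s \<Longrightarrow> s < b \<Longrightarrow> X s \<omega> \<in> - S"
    unfolding eventually_at_right_field by blast
  have "r < min u (b - t)" using r b by simp
  then obtain k0 where k0: "\<forall>k\<ge>k0. \<exists>j. r \<le> real j * (e / 2 ^ k) \<and> real j * (e / 2 ^ k) < min u (b - t)"
    using grid_point_between[OF r(1) _ e] by blast
  have "\<exists>j. real j * (e / 2 ^ k) < u \<and> X (t + real j * (e / 2 ^ k)) \<omega> \<notin> S" if k: "k0 \<le> k" for k
  proof -
    obtain j where j: "r \<le> real j * (e / 2 ^ k)" "real j * (e / 2 ^ k) < min u (b - t)" using k0 k by blast
    have "X (t + real j * (e / 2 ^ k)) \<omega> \<notin> S"
    proof (cases "real j * (e / 2 ^ k) = r")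
      case True
      show ?thesis unfolding True by (rule r(3))
    next
      case False
      then have "t + r < t + real j * (e / 2 ^ k)" "t + real j * (e / 2 ^ k) < b" using j by linarith+
      then show ?thesis using b(2) by blast
    qed
    then show ?thesis using j by auto
  qed
  then show ?thesis by blast
qed

end

context killed_feller_process
begin

text \<open>
  Compact subsets of \<open>D\<close> that exhaust it: the points of the closure at distance at least \<open>1 / (m + 1)\<close> from the relative
  boundary. The distance is stated pointwise, so that the definition is right also for an empty boundary.
\<close>

definition core :: "nat \<Rightarrow> 'a set" where
  "core m = {x \<in> closure D. \<forall>c\<in>closure D - D. 1 / real (Suc m) \<le> dist x c}"

text \<open>
  The path shifted by \<open>t\<close> stays in one of the compact sets \<open>core m\<close> until slightly after time \<open>s\<close>. This is a measurable
  substitute for the event that the shifted path has not left \<open>D\<close> by time \<open>s\<close>.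
\<close>

definition alive :: "real \<Rightarrow> real \<Rightarrow> 'w \<Rightarrow> bool" where
  "alive t s \<omega> \<longleftrightarrow> (\<exists>m. \<forall>r. 0 \<le> r \<and> r < s + 1 / real (Suc m) \<longrightarrow> X (t + r) \<omega> \<in> core m)"

lemma relatively_open_D: obtains W where "open W" "D = closure D \<inter> W"
  using relatively_open by (auto simp: openin_open)

lemma D_borel [measurable]: "D \<in> sets borel"
  by (rule relatively_open_D) (metis borel_closed borel_open closed_closure sets.Int)

lemma closed_boundary: "closed (closure D - D)"
proof (rule relatively_open_D)
  fix W assume W: "open W" "D = closure D \<inter> W"
  then have "closure D - D = closure D \<inter> - W" by blast
  then show ?thesis using W by (simp add: closed_Int closed_Compl)
qed

lemma compact_boundary: "compact (closure D - D)"
  using compact_Int_closed[OF compact_closure closed_boundary] by (simp add: Int_absorb1)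

lemma closed_core: "closed (core m)"
proof -
  have "core m = closure D \<inter> (\<Inter>c\<in>closure D - D. {x. 1 / real (Suc m) \<le> dist x c})"
    by (auto simp: core_def)
  then show ?thesis by (auto intro!: closed_Int closed_INT closed_Collect_le continuous_intros)
qed

lemma core_mono: "m \<le> n \<Longrightarrow> core m \<subseteq> core n"
proof
  fix x assume "m \<le> n" "x \<in> core m"
  moreover have "1 / real (Suc n) \<le> 1 / real (Suc m)" using \<open>m \<le> n\<close> by (simp add: frac_le)
  ultimately show "x \<in> core n" unfolding core_def using order_trans by blast
qed

lemma core_subset: "core m \<subseteq> D"
proof
  fix x assume x: "x \<in> core m"
  show "x \<in> D"
  proof (rule ccontr)
    assume "x \<notin> D"
    then have "1 / real (Suc m) \<le> dist x x" using x unfolding core_def by blast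
    then show False by simp
  qed
qed

lemma alive_D: "alive t s \<omega> \<Longrightarrow> 0 \<le> r \<Longrightarrow> r \<le> s \<Longrightarrow> X (t + r) \<omega> \<in> D"
  unfolding alive_def
proof (elim exE)
  fix m assume r: "0 \<le> r" "r \<le> s" and m: "\<forall>r. 0 \<le> r \<and> r < s + 1 / real (Suc m) \<longrightarrow> X (t + r) \<omega> \<in> core m"
  have "0 < 1 / real (Suc m)" by simp
  then have "r < s + 1 / real (Suc m)" using r by linarith
  then have "X (t + r) \<omega> \<in> core m" using m r by blast
  then show "X (t + r) \<omega> \<in> D" using core_subset by blast
qed

lemma stays_mono:
  assumes "m \<le> n" "\<forall>r. 0 \<le> r \<and> r < s + 1 / real (Suc m) \<longrightarrow> X (t + r) \<omega> \<in> core m"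
  shows "\<forall>r. 0 \<le> r \<and> r < s + 1 / real (Suc n) \<longrightarrow> X (t + r) \<omega> \<in> core n"
proof (intro allI impI)
  fix r assume r: "0 \<le> r \<and> r < s + 1 / real (Suc n)"
  have "1 / real (Suc n) \<le> 1 / real (Suc m)" using assms(1) by (simp add: frac_le)
  then have "0 \<le> r \<and> r < s + 1 / real (Suc m)" using r by linarith
  then have "X (t + r) \<omega> \<in> core m" using assms(2) by blast
  then show "X (t + r) \<omega> \<in> core n" using core_mono[OF assms(1)] by blast
qed

lemma alive_split:
  assumes t: "0 \<le> t" "0 \<le> s"
  shows "alive 0 (t + s) \<omega> \<longleftrightarrow> alive 0 t \<omega> \<and> alive t s \<omega>"
proof
  assume "alive 0 (t + s) \<omega>"
  then obtain m where m: "\<And>r. 0 \<le> r \<Longrightarrow> r < t + s + 1 / real (Suc m) \<Longrightarrow> X (0 + r) \<omega> \<in> core m"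
    unfolding alive_def by blast
  have "alive 0 t \<omega>" unfolding alive_def
    by (intro exI[of _ m] allI impI, rule m) (use t in auto)
  moreover have "alive t s \<omega>" unfolding alive_def
  proof (intro exI[of _ m] allI impI)
    fix r assume "0 \<le> r \<and> r < s + 1 / real (Suc m)"
    then have "X (0 + (t + r)) \<omega> \<in> core m" using t by (intro m) auto
    then show "X (t + r) \<omega> \<in> core m" by simp
  qed
  ultimately show "alive 0 t \<omega> \<and> alive t s \<omega>" by simp
next
  assume a: "alive 0 t \<omega> \<and> alive t s \<omega>"
  obtain m1 where m1: "\<forall>r. 0 \<le> r \<and> r < t + 1 / real (Suc m1) \<longrightarrow> X (0 + r) \<omega> \<in> core m1"
    using a unfolding alive_def by blast
  obtain m2 where m2: "\<forall>r. 0 \<le> r \<and> r < s + 1 / real (Suc m2) \<longrightarrow> X (t + r) \<omega> \<in> core m2"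
    using a unfolding alive_def by blast
  define m where "m = max m1 m2"
  have m1': "\<forall>r. 0 \<le> r \<and> r < t + 1 / real (Suc m) \<longrightarrow> X (0 + r) \<omega> \<in> core m"
    by (rule stays_mono[OF _ m1]) (simp add: m_def)
  have m2': "\<forall>r. 0 \<le> r \<and> r < s + 1 / real (Suc m) \<longrightarrow> X (t + r) \<omega> \<in> core m"
    by (rule stays_mono[OF _ m2]) (simp add: m_def)
  show "alive 0 (t + s) \<omega>" unfolding alive_def
  proof (intro exI[of _ m] allI impI)
    fix r assume r: "0 \<le> r \<and> r < t + s + 1 / real (Suc m)"
    show "X (0 + r) \<omega> \<in> core m"
    proof (cases "r < t")
      case True
      moreover have "0 < 1 / real (Suc m)" by simp
      ultimately have "0 \<le> r \<and> r < t + 1 / real (Suc m)" using r by linarith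
      then show ?thesis using m1' by blast
    next
      case False
      then have "0 \<le> r - t \<and> r - t < s + 1 / real (Suc m)" using r by linarith
      then have "X (t + (r - t)) \<omega> \<in> core m" using m2' by blast
      then show ?thesis by simp
    qed
  qed
qed

text \<open>
  The indicator of staying in a closed set is the limit of its restrictions to dyadic grids.
\<close>

lemma markov_functional_stays:
  assumes f: "bfun f" and s: "0 \<le> s" and su: "s < u" and S: "closed S"
  shows "markov_functional (\<lambda>t \<omega>. of_bool (\<forall>r. 0 \<le> r \<and> r < u \<longrightarrow> X (t + r) \<omega> \<in> S) * f (X (t + s) \<omega>))"
proof -
  \<comment> \<open>the mesh is a dyadic fraction of \<open>s\<close>, so that \<open>s\<close> itself is a grid point, with index \<open>J k\<close>\<close>
  define e where "e = (if s = 0 then 1 else s)"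
  have e: "0 < e" using s by (simp add: e_def)
  define d where "d k = e / 2 ^ k" for k :: nat
  have d: "0 < d k" for k using e by (simp add: d_def)
  define J :: "nat \<Rightarrow> nat" where "J k = (if s = 0 then 0 else 2 ^ k)" for k
  have J: "real (J k) * d k = s" for k by (auto simp: J_def d_def e_def)
  define n where "n k = nat \<lceil>u / d k\<rceil>" for k
  have n: "j < n k \<longleftrightarrow> real j * d k < u" for j k
  proof -
    have "j < n k \<longleftrightarrow> real j < u / d k" unfolding n_def by linarith
    then show ?thesis using d[of k] by (simp add: field_simps)
  qed
  define g where "g k j x = indicator S x * (if j = J k then f x else 1)" for k j x
  have bi: "bfun (indicator S)" using S by (auto simp: bfun_def indicator_def intro!: exI[of _ 1])
  have gb: "bfun (g k j)" for k j
  proof (cases "j = J k")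
    case True
    then have "g k j = (\<lambda>x. indicator S x * f x)" by (auto simp: g_def)
    then show ?thesis using bfun_mult[OF bi f] by simp
  next
    case False
    then have "g k j = indicator S" by (auto simp: g_def)
    then show ?thesis using bi by simp
  qed
  have eq: "(\<Prod>j<n k. g k j (X (t + real j * d k) \<omega>)) =
      of_bool (\<forall>j. real j * d k < u \<longrightarrow> X (t + real j * d k) \<omega> \<in> S) * f (X (t + s) \<omega>)" for k t \<omega>
  proof -
    have "(\<Prod>j<n k. g k j (X (t + real j * d k) \<omega>)) =
      (\<Prod>j<n k. of_bool (X (t + real j * d k) \<omega> \<in> S)) * (\<Prod>j<n k. if j = J k then f (X (t + s) \<omega>) else 1)"
      unfolding g_def prod.distrib[symmetric]
      by (intro prod.cong refl) (auto simp: indicator_def J)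
    also have "(\<Prod>j<n k. if j = J k then f (X (t + s) \<omega>) else 1) = f (X (t + s) \<omega>)"
      using n[of "J k" k] J[of k] su by simp
    also have "(\<Prod>j<n k. of_bool (X (t + real j * d k) \<omega> \<in> S) :: real) = of_bool (\<forall>j. real j * d k < u \<longrightarrow> X (t + real j * d k) \<omega> \<in> S)"
      unfolding prod_of_bool n ..
    finally show ?thesis .
  qed
  obtain C where C: "\<And>x. \<bar>f x\<bar> \<le> C" using f by (auto simp: bfun_def)
  show ?thesis
  proof (rule markov_functional_lim[where W = "\<lambda>k t \<omega>. of_bool (\<forall>j. real j * d k < u \<longrightarrow> X (t + real j * d k) \<omega> \<in> S) * f (X (t + s) \<omega>)" and C = C])
    show "markov_functional (\<lambda>t \<omega>. of_bool (\<forall>j. real j * d k < u \<longrightarrow> X (t + real j * d k) \<omega> \<in> S) * f (X (t + s) \<omega>))" for k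
      by (rule markov_functional_product[OF less_imp_le[OF d[of k]], of "g k" "n k", OF gb, unfolded eq])
    show "\<bar>of_bool (\<forall>j. real j * d k < u \<longrightarrow> X (t + real j * d k) \<omega> \<in> S) * f (X (t + s) \<omega>)\<bar> \<le> C" for k t \<omega>
    proof -
      have "\<bar>of_bool p * y\<bar> \<le> C" if "\<bar>y\<bar> \<le> C" for p and y :: real using that by (cases p) auto
      then show ?thesis using C by blast
    qed
    fix t :: real and \<omega> assume t: "0 \<le> t" and w: "\<omega> \<in> space \<A>"
    show "(\<lambda>k. of_bool (\<forall>j. real j * d k < u \<longrightarrow> X (t + real j * d k) \<omega> \<in> S) * f (X (t + s) \<omega>))
       \<longlonglongrightarrow> of_bool (\<forall>r. 0 \<le> r \<and> r < u \<longrightarrow> X (t + r) \<omega> \<in> S) * f (X (t + s) \<omega>)"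
    proof (cases "\<forall>r. 0 \<le> r \<and> r < u \<longrightarrow> X (t + r) \<omega> \<in> S")
      case True
      have "\<forall>j. real j * d k < u \<longrightarrow> X (t + real j * d k) \<omega> \<in> S" for k
      proof (intro allI impI)
        fix j assume "real j * d k < u"
        moreover have "0 \<le> real j * d k" using d[of k] by simp
        ultimately show "X (t + real j * d k) \<omega> \<in> S" using True by blast
      qed
      then show ?thesis using True by simp
    next
      case False
      then obtain r where r: "0 \<le> r" "r < u" "X (t + r) \<omega> \<notin> S" by blast
      obtain k0 where k0: "\<forall>k\<ge>k0. \<exists>j. real j * d k < u \<and> X (t + real j * d k) \<omega> \<notin> S"
        using leaves_on_grid[OF w S e t r] unfolding d_def by blast
      have "\<forall>\<^sub>F k in sequentially. of_bool (\<forall>j. real j * d k < u \<longrightarrow> X (t + real j * d k) \<omega> \<in> S) * f (X (t + s) \<omega>) = 0"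
        unfolding eventually_sequentially
      proof (intro exI allI impI)
        fix k assume "k0 \<le> k"
        then have "\<not> (\<forall>j. real j * d k < u \<longrightarrow> X (t + real j * d k) \<omega> \<in> S)" using k0 by blast
        then show "of_bool (\<forall>j. real j * d k < u \<longrightarrow> X (t + real j * d k) \<omega> \<in> S) * f (X (t + s) \<omega>) = 0" by (simp only: of_bool_eq mult_zero_left)
      qed
      moreover have "of_bool (\<forall>r. 0 \<le> r \<and> r < u \<longrightarrow> X (t + r) \<omega> \<in> S) * f (X (t + s) \<omega>) = 0" using False by (simp only: of_bool_eq mult_zero_left)
      ultimately show ?thesis by (simp only:) (rule tendsto_eventually)
    qed
  qed
qed

lemma markov_functional_alive:
  assumes f: "bfun f" and s: "0 \<le> s"
  shows "markov_functional (\<lambda>t \<omega>. of_bool (alive t s \<omega>) * f (X (t + s) \<omega>))"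
proof -
  obtain C where C: "\<And>x. \<bar>f x\<bar> \<le> C" using f by (auto simp: bfun_def)
  define st where "st m t \<omega> \<longleftrightarrow> (\<forall>r. 0 \<le> r \<and> r < s + 1 / real (Suc m) \<longrightarrow> X (t + r) \<omega> \<in> core m)" for m t \<omega>
  show ?thesis
  proof (rule markov_functional_lim[where W = "\<lambda>m t \<omega>. of_bool (st m t \<omega>) * f (X (t + s) \<omega>)" and C = C])
    show "markov_functional (\<lambda>t \<omega>. of_bool (st m t \<omega>) * f (X (t + s) \<omega>))" for m
      unfolding st_def using f s closed_core by (intro markov_functional_stays) auto
    show "\<bar>of_bool (st m t \<omega>) * f (X (t + s) \<omega>)\<bar> \<le> C" for m t \<omega>
      using C[of "X (t + s) \<omega>"] by (cases "st m t \<omega>") auto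
    fix t \<omega>
    show "(\<lambda>m. of_bool (st m t \<omega>) * f (X (t + s) \<omega>)) \<longlonglongrightarrow> of_bool (alive t s \<omega>) * f (X (t + s) \<omega>)"
    proof (cases "alive t s \<omega>")
      case True
      then obtain m where m: "st m t \<omega>" unfolding alive_def st_def by blast
      have "st n t \<omega>" if "m \<le> n" for n using stays_mono[OF that] m unfolding st_def by blast
      then have "\<forall>\<^sub>F n in sequentially. of_bool (st n t \<omega>) * f (X (t + s) \<omega>) = of_bool (alive t s \<omega>) * f (X (t + s) \<omega>)"
        using True unfolding eventually_sequentially by (intro exI[of _ m]) simp
      then show ?thesis by (rule tendsto_eventually)
    next
      case False
      then have "\<not> st m t \<omega>" for m unfolding alive_def st_def by blast
      then show ?thesis using False by simp
    qed
  qed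
qed

text \<open>
  The event looks beyond time \<open>t\<close>, but only by an arbitrarily small amount; right-continuity of the filtration is essential here.
\<close>

lemma alive_sets_F: assumes t: "0 \<le> t" shows "{\<omega> \<in> space \<A>. alive 0 t \<omega>} \<in> sets (F t)"
proof -
  have "{\<omega> \<in> space \<A>. alive 0 t \<omega>} \<in> sets (F v)" if v: "t < v" for v
  proof -
    have v0: "0 \<le> v" using t v by simp
    obtain m0 where m0: "1 / real (Suc m0) < v - t" using nat_approx_posE[of "v - t"] v by auto
    define st where "st m \<omega> \<longleftrightarrow> (\<forall>r. 0 \<le> r \<and> r < t + 1 / real (Suc m) \<longrightarrow> X (0 + r) \<omega> \<in> core m)" for m \<omega>
    have st: "{\<omega> \<in> space \<A>. st m \<omega>} \<in> sets (F v)" if m: "m0 \<le> m" for m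
    proof -
      define u where "u = t + 1 / real (Suc m)"
      have "1 / real (Suc m) \<le> 1 / real (Suc m0)" using m by (simp add: frac_le)
      then have u: "u \<le> v" using m0 by (simp add: u_def)
      have "{\<omega> \<in> space \<A>. st m \<omega>} = {\<omega> \<in> space (F v). \<forall>k j. real j * (1 / 2 ^ k) < u \<longrightarrow> X (real j * (1 / 2 ^ k)) \<omega> \<in> core m}"
        (is "?L = ?R")
      proof (intro set_eqI iffI)
        fix \<omega> assume "\<omega> \<in> ?L"
        then have w: "\<omega> \<in> space \<A>" and s: "\<And>r. 0 \<le> r \<Longrightarrow> r < u \<Longrightarrow> X (0 + r) \<omega> \<in> core m" by (auto simp: st_def u_def)
        have "X (real j * (1 / 2 ^ k)) \<omega> \<in> core m" if "real j * (1 / 2 ^ k) < u" for j k using s[of "real j * (1 / 2 ^ k)"] that by simp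
        then show "\<omega> \<in> ?R" using w space_F[OF v0] by simp
      next
        fix \<omega> assume R: "\<omega> \<in> ?R"
        then have w: "\<omega> \<in> space \<A>" using space_F[OF v0] by simp
        have "st m \<omega>"
        proof (rule ccontr)
          assume "\<not> st m \<omega>"
          then obtain r where r: "0 \<le> r" "r < u" "X (0 + r) \<omega> \<notin> core m" by (auto simp: st_def u_def)
          obtain k0 where k0: "\<forall>k\<ge>k0. \<exists>j. real j * (1 / 2 ^ k) < u \<and> X (0 + real j * (1 / 2 ^ k)) \<omega> \<notin> core m"
            using leaves_on_grid[OF w closed_core zero_less_one order_refl r] by (elim exE) (rule that)
          from k0[rule_format, OF order_refl] obtain j where "real j * (1 / 2 ^ k0) < u" "X (real j * (1 / 2 ^ k0)) \<omega> \<notin> core m"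
            by (elim exE conjE) (simp only: add_0, rule that)
          moreover have "\<forall>k j. real j * (1 / 2 ^ k) < u \<longrightarrow> X (real j * (1 / 2 ^ k)) \<omega> \<in> core m"
            using R by (elim CollectE conjE)
          ultimately show False by blast
        qed
        then show "\<omega> \<in> ?L" using w by simp
      qed
      also have "\<dots> \<in> sets (F v)"
      proof (intro sets.sets_Collect_countable_All)
        fix k j :: nat
        define q where "q = real j * (1 / 2 ^ k)"
        have q0: "0 \<le> q" by (simp add: q_def)
        have "{\<omega> \<in> space (F v). q < u \<longrightarrow> X q \<omega> \<in> core m} \<in> sets (F v)"
        proof (cases "q < u")
          case True
          have "q \<le> v" using True u by linarith
          then have "X q \<in> F v \<rightarrow>\<^sub>M borel" by (rule measurable_F_mono[OF q0 _ adapted[OF q0]])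
          then have "X q -` core m \<inter> space (F v) \<in> sets (F v)"
            by (rule measurable_sets) (rule borel_closed[OF closed_core])
          moreover have "X q -` core m \<inter> space (F v) = {\<omega> \<in> space (F v). q < u \<longrightarrow> X q \<omega> \<in> core m}"
            using True by blast
          ultimately show ?thesis by (simp only:)
        next
          case False
          then have "{\<omega> \<in> space (F v). q < u \<longrightarrow> X q \<omega> \<in> core m} = space (F v)" by blast
          then show ?thesis by (simp only: sets.top)
        qed
        then show "{\<omega> \<in> space (F v). real j * (1 / 2 ^ k) < u \<longrightarrow> X (real j * (1 / 2 ^ k)) \<omega> \<in> core m} \<in> sets (F v)"
          unfolding q_def .
      qed
      finally show ?thesis .
    qed
    have "{\<omega> \<in> space \<A>. alive 0 t \<omega>} = (\<Union>m\<in>{m0..}. {\<omega> \<in> space \<A>. st m \<omega>})"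
    proof (intro set_eqI iffI)
      fix \<omega> assume "\<omega> \<in> {\<omega> \<in> space \<A>. alive 0 t \<omega>}"
      then obtain m where w: "\<omega> \<in> space \<A>" and m: "st m \<omega>" unfolding alive_def st_def by blast
      have "st (max m m0) \<omega>" unfolding st_def
        by (rule stays_mono[OF _ m[unfolded st_def]]) simp
      then show "\<omega> \<in> (\<Union>m\<in>{m0..}. {\<omega> \<in> space \<A>. st m \<omega>})" using w by (intro UN_I[of "max m m0"]) auto
    next
      fix \<omega> assume "\<omega> \<in> (\<Union>m\<in>{m0..}. {\<omega> \<in> space \<A>. st m \<omega>})"
      then obtain m where "\<omega> \<in> space \<A>" "st m \<omega>" by auto
      moreover from this have "alive 0 t \<omega>" unfolding alive_def st_def by (intro exI)
      ultimately show "\<omega> \<in> {\<omega> \<in> space \<A>. alive 0 t \<omega>}" by simp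
    qed
    then show ?thesis using st by (simp add: sets.countable_UN')
  qed
  then have "{\<omega> \<in> space \<A>. alive 0 t \<omega>} \<in> (\<Inter>v\<in>{t<..}. sets (F v))" by simp
  then show ?thesis by (rule subsetD[OF filtration_right_continuous[OF t]])
qed

lemma bmeasF_alive: assumes t: "0 \<le> t" shows "bmeasF t (\<lambda>\<omega>. of_bool (alive 0 t \<omega>))"
proof -
  have "(\<lambda>\<omega>. indicator {\<omega> \<in> space \<A>. alive 0 t \<omega>} \<omega> :: real) \<in> borel_measurable (F t)"
    using alive_sets_F[OF t] by (rule borel_measurable_indicator)
  then have "(\<lambda>\<omega>. of_bool (alive 0 t \<omega>) :: real) \<in> borel_measurable (F t)"
    by (rule measurable_cong[THEN iffD1, rotated]) (simp add: space_F[OF t] indicator_def)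
  then show ?thesis unfolding bmeasF_def by (auto intro!: exI[of _ 1])
qed

text \<open>
  The law of \<open>X t\<close> on the event \<open>alive 0 t\<close>. On this event \<open>X t\<close> lies in \<open>D\<close>, so the restriction makes
  \<open>X t\<close> a random variable with values in \<open>D\<close>.
\<close>

definition kern :: "real \<Rightarrow> 'a \<Rightarrow> 'a measure" where
  "kern t x = distr (restrict_space (Pr x) {\<omega>. alive 0 t \<omega>}) (restrict_space borel D) (X t)"

lemma sets_kern: "sets (kern t x) = sets (restrict_space borel D)"
  by (simp add: kern_def)

lemma space_kern: "space (kern t x) = D"
  by (simp add: kern_def space_restrict_space)

lemma alive_sets_law: "0 \<le> t \<Longrightarrow> {\<omega>. alive 0 t \<omega>} \<inter> space (Pr x) \<in> sets (Pr x)"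
proof -
  assume t: "0 \<le> t"
  have "{\<omega>. alive 0 t \<omega>} \<inter> space (Pr x) = {\<omega> \<in> space \<A>. alive 0 t \<omega>}" by auto
  then show ?thesis using sets_F[OF t alive_sets_F[OF t]] by (simp add: sets_law)
qed

lemma X_restrict: assumes t: "0 \<le> t"
  shows "X t \<in> restrict_space (Pr x) {\<omega>. alive 0 t \<omega>} \<rightarrow>\<^sub>M restrict_space borel D"
proof (rule measurable_restrict_space2)
  show "X t \<in> restrict_space (Pr x) {\<omega>. alive 0 t \<omega>} \<rightarrow>\<^sub>M borel"
    using measurable_law[OF X_measurable[OF t]] by (rule measurable_restrict_space1)
  show "X t \<in> space (restrict_space (Pr x) {\<omega>. alive 0 t \<omega>}) \<rightarrow> D"
    using alive_D[of 0 t _ t] t by (auto simp: space_restrict_space)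
qed

lemma bfun_extend: assumes "f \<in> bounded_measurable_on D" shows "bfun (\<lambda>x. indicator D x * f x)"
proof -
  have "f \<in> borel_measurable (restrict_space borel D)" using assms by (simp add: bounded_measurable_on_def)
  then have "(\<lambda>x. indicator D x *\<^sub>R f x) \<in> borel_measurable borel"
    by (subst (asm) borel_measurable_restrict_space_iff) auto
  moreover obtain C where C: "\<forall>x\<in>D. \<bar>f x\<bar> \<le> C" using assms by (auto simp: bounded_measurable_on_def bounded_iff)
  have "\<bar>indicator D x * f x\<bar> \<le> \<bar>C\<bar>" for x using C by (cases "x \<in> D") force+
  ultimately show ?thesis by (auto simp: bfun_def)
qed

lemma integral_kern:
  assumes t: "0 \<le> t" and f: "f \<in> bounded_measurable_on D"
  shows "(\<integral>y. f y \<partial>kern t x) = (\<integral>\<omega>. of_bool (alive 0 t \<omega>) * (indicator D (X t \<omega>) * f (X t \<omega>)) \<partial>Pr x)"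
proof -
  have "(\<integral>y. f y \<partial>kern t x) = (\<integral>\<omega>. f (X t \<omega>) \<partial>restrict_space (Pr x) {\<omega>. alive 0 t \<omega>})"
    unfolding kern_def using f by (intro integral_distr X_restrict t) (simp add: bounded_measurable_on_def)
  also have "\<dots> = (\<integral>\<omega>. indicator {\<omega>. alive 0 t \<omega>} \<omega> *\<^sub>R f (X t \<omega>) \<partial>Pr x)"
    by (rule integral_restrict_space[OF alive_sets_law[OF t]])
  also have "\<dots> = (\<integral>\<omega>. of_bool (alive 0 t \<omega>) * (indicator D (X t \<omega>) * f (X t \<omega>)) \<partial>Pr x)"
  proof (rule Bochner_Integration.integral_cong[OF refl])
    fix \<omega>
    show "indicator {\<omega>. alive 0 t \<omega>} \<omega> *\<^sub>R f (X t \<omega>) = of_bool (alive 0 t \<omega>) * (indicator D (X t \<omega>) * f (X t \<omega>))"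
      using alive_D[of 0 t \<omega> t] t by (auto simp: indicator_def)
  qed
  finally show ?thesis .
qed

lemma markov_kern:
  assumes t: "0 \<le> t" and f: "f \<in> bounded_measurable_on D"
  shows "markov_functional (\<lambda>s \<omega>. of_bool (alive s t \<omega>) * (indicator D (X (s + t) \<omega>) * f (X (s + t) \<omega>)))"
  using markov_functional_alive[OF bfun_extend[OF f] t] .

lemma bfun_kern:
  assumes t: "0 \<le> t" and f: "f \<in> bounded_measurable_on D"
  shows "bfun (\<lambda>x. \<integral>y. f y \<partial>kern t x)"
  using markov_functionalD(2)[OF markov_kern[OF t f]] unfolding integral_kern[OF t f] by simp

lemma subprob_kern: assumes t: "0 \<le> t" shows "subprob_space (kern t x)"
proof
  have "emeasure (kern t x) (space (kern t x)) = emeasure (restrict_space (Pr x) {\<omega>. alive 0 t \<omega>}) (X t -` D \<inter> space (restrict_space (Pr x) {\<omega>. alive 0 t \<omega>}))"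
    unfolding space_kern unfolding kern_def
    by (rule emeasure_distr[OF X_restrict[OF t]])
      (use sets.top[of "restrict_space borel D"] in \<open>simp add: space_restrict_space\<close>)
  also have "\<dots> \<le> emeasure (restrict_space (Pr x) {\<omega>. alive 0 t \<omega>}) (space (restrict_space (Pr x) {\<omega>. alive 0 t \<omega>}))"
    by (rule emeasure_space)
  also have "\<dots> = emeasure (Pr x) ({\<omega>. alive 0 t \<omega>} \<inter> space (Pr x))"
    using alive_sets_law[OF t, of x] by (subst emeasure_restrict_space) (auto simp: space_restrict_space)
  also have "\<dots> \<le> 1" using prob_space.emeasure_le_1[OF prob_law] .
  finally show "emeasure (kern t x) (space (kern t x)) \<le> 1" .
  show "space (kern t x) \<noteq> {}" using nonempty by (simp add: space_kern)
qed

lemma indicator_bounded_measurable: "A \<in> sets (restrict_space borel D) \<Longrightarrow> indicator A \<in> bounded_measurable_on D"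
  by (auto simp: bounded_measurable_on_def bounded_iff indicator_def intro!: exI[of _ 1])

lemma kern_measurable: assumes t: "0 \<le> t"
  shows "kern t \<in> restrict_space borel D \<rightarrow>\<^sub>M subprob_algebra (restrict_space borel D)"
proof (rule measurable_subprob_algebra)
  fix A assume A: "A \<in> sets (restrict_space borel D)"
  have "emeasure (kern t x) A = ennreal (\<integral>y. indicator A y \<partial>kern t x)" for x
  proof -
    interpret subprob_space "kern t x" by (rule subprob_kern[OF t])
    have "(\<integral>y. indicator A y \<partial>kern t x) = measure (kern t x) A"
      using A sets_kern[of t x] by (simp add: sets.sets_into_space Int_absorb2)
    then show ?thesis by (simp add: emeasure_eq_measure)
  qed
  moreover have "(\<lambda>x. \<integral>y. indicator A y \<partial>kern t x :: real) \<in> borel_measurable (restrict_space borel D)"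
    using bfun_kern[OF t indicator_bounded_measurable[OF A]] by (auto simp: bfun_def intro: measurable_restrict_space1)
  ultimately show "(\<lambda>x. emeasure (kern t x) A) \<in> borel_measurable (restrict_space borel D)" by simp
qed (auto simp: subprob_kern[OF t] sets_kern)

lemma kern_bounded_measurable: assumes t: "0 \<le> t" and f: "f \<in> bounded_measurable_on D"
  shows "(\<lambda>x. \<integral>y. f y \<partial>kern t x) \<in> bounded_measurable_on D"
  using bfun_kern[OF assms] unfolding bfun_def bounded_measurable_on_def bounded_iff
  by (auto intro: measurable_restrict_space1)

lemma kern_semigroup:
  assumes s: "0 \<le> s" and t: "0 \<le> t" and f: "f \<in> bounded_measurable_on D"
  shows "(\<integral>y. f y \<partial>kern (s + t) x) = (\<integral>y. (\<integral>z. f z \<partial>kern t y) \<partial>kern s x)"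
proof -
  have st: "0 \<le> s + t" using s t by simp
  have "(\<integral>y. f y \<partial>kern (s + t) x) =
     (\<integral>\<omega>. of_bool (alive 0 s \<omega>) * (of_bool (alive s t \<omega>) * (indicator D (X (s + t) \<omega>) * f (X (s + t) \<omega>))) \<partial>Pr x)"
    unfolding integral_kern[OF st f] alive_split[OF s t] by (simp add: mult.assoc of_bool_conj)
  also have "\<dots> = (\<integral>\<omega>. of_bool (alive 0 s \<omega>) * (\<integral>\<omega>'. of_bool (alive 0 t \<omega>') * (indicator D (X (0 + t) \<omega>') * f (X (0 + t) \<omega>')) \<partial>Pr (X s \<omega>)) \<partial>Pr x)"
    by (rule markov_functionalD(3)[OF markov_kern[OF t f] s bmeasF_alive[OF s]])
  also have "\<dots> = (\<integral>\<omega>. of_bool (alive 0 s \<omega>) * (\<integral>z. f z \<partial>kern t (X s \<omega>)) \<partial>Pr x)"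
    unfolding integral_kern[OF t f] by simp
  also have "\<dots> = (\<integral>\<omega>. of_bool (alive 0 s \<omega>) * (indicator D (X s \<omega>) * (\<integral>z. f z \<partial>kern t (X s \<omega>))) \<partial>Pr x)"
  proof (rule Bochner_Integration.integral_cong[OF refl])
    fix \<omega>
    show "of_bool (alive 0 s \<omega>) * (\<integral>z. f z \<partial>kern t (X s \<omega>)) = of_bool (alive 0 s \<omega>) * (indicator D (X s \<omega>) * (\<integral>z. f z \<partial>kern t (X s \<omega>)))"
      using alive_D[of 0 s \<omega> s] s by (cases "alive 0 s \<omega>") auto
  qed
  also have "\<dots> = (\<integral>y. (\<integral>z. f z \<partial>kern t y) \<partial>kern s x)"
    by (rule integral_kern[OF s kern_bounded_measurable[OF t f], symmetric])
  finally show ?thesis .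
qed

text \<open>
  Pathwise: the event \<open>alive 0 t\<close> is right-continuous in \<open>t\<close>, and so is \<open>f (X t)\<close> as long as the path is in \<open>D\<close>.
\<close>

lemma kern_right_continuous:
  assumes t: "0 \<le> t" and f: "f \<in> bounded_continuous_on D"
  shows "((\<lambda>s. \<integral>y. f y \<partial>kern s x) \<longlongrightarrow> (\<integral>y. f y \<partial>kern t x)) (at_right t)"
  unfolding tendsto_at_iff_sequentially comp_def
proof (intro allI impI)
  fix S :: "nat \<Rightarrow> real" assume "\<forall>i. S i \<in> {t<..} - {t}" and S: "S \<longlonglongrightarrow> t"
  then have St: "t < S i" for i by auto
  have S0: "0 \<le> S i" for i using St[of i] t by simp
  have r: "filterlim S (at_right t) sequentially"
    unfolding filterlim_at using S St by (auto intro!: always_eventually less_imp_neq[THEN not_sym])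
  have fB: "f \<in> bounded_measurable_on D"
    using f by (auto simp: bounded_continuous_on_def bounded_measurable_on_def intro: borel_measurable_continuous_on_restrict)
  obtain C where C: "0 \<le> C" "\<And>y. y \<in> D \<Longrightarrow> \<bar>f y\<bar> \<le> C"
  proof -
    obtain C where "\<And>y. y \<in> D \<Longrightarrow> \<bar>f y\<bar> \<le> C" using f by (auto simp: bounded_continuous_on_def bounded_iff)
    then show ?thesis using that[of "\<bar>C\<bar>"] by force
  qed
  interpret prob_space "Pr x" by (rule prob_law)
  have bm: "bmeas (\<lambda>\<omega>. of_bool (alive 0 s \<omega>) * (indicator D (X s \<omega>) * f (X s \<omega>)))" if "0 \<le> s" for s
    using markov_functionalD(1)[OF markov_kern[OF that fB] order_refl] by simp
  show "(\<lambda>i. \<integral>y. f y \<partial>kern (S i) x) \<longlonglongrightarrow> (\<integral>y. f y \<partial>kern t x)"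
    unfolding integral_kern[OF t fB] integral_kern[OF S0 fB]
  proof (rule integral_dominated_convergence[where w = "\<lambda>_. C"])
    show "(\<lambda>\<omega>. of_bool (alive 0 t \<omega>) * (indicator D (X t \<omega>) * f (X t \<omega>))) \<in> borel_measurable (Pr x)"
      using bmeas_integrable[OF bm[OF t]] by auto
    show "(\<lambda>\<omega>. of_bool (alive 0 (S i) \<omega>) * (indicator D (X (S i) \<omega>) * f (X (S i) \<omega>))) \<in> borel_measurable (Pr x)" for i
      using bmeas_integrable[OF bm[OF S0]] by auto
    show "AE \<omega> in Pr x. norm (of_bool (alive 0 (S i) \<omega>) * (indicator D (X (S i) \<omega>) * f (X (S i) \<omega>))) \<le> C" for i
    proof (rule AE_I2)
      fix \<omega>
      show "norm (of_bool (alive 0 (S i) \<omega>) * (indicator D (X (S i) \<omega>) * f (X (S i) \<omega>))) \<le> C"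
        using C(1) C(2)[of "X (S i) \<omega>"] by (auto simp: indicator_def)
    qed
    show "AE \<omega> in Pr x. (\<lambda>i. of_bool (alive 0 (S i) \<omega>) * (indicator D (X (S i) \<omega>) * f (X (S i) \<omega>)))
        \<longlonglongrightarrow> of_bool (alive 0 t \<omega>) * (indicator D (X t \<omega>) * f (X t \<omega>))"
    proof (rule AE_I2)
      fix \<omega> assume "\<omega> \<in> space (Pr x)"
      then have w: "\<omega> \<in> space \<A>" by simp
      show "(\<lambda>i. of_bool (alive 0 (S i) \<omega>) * (indicator D (X (S i) \<omega>) * f (X (S i) \<omega>)))
        \<longlonglongrightarrow> of_bool (alive 0 t \<omega>) * (indicator D (X t \<omega>) * f (X t \<omega>))"
      proof (cases "alive 0 t \<omega>")
        case False
        have "\<not> alive 0 (S i) \<omega>" for i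
          using False alive_split[of t "S i - t" \<omega>] t St[of i] by simp
        then show ?thesis using False by simp
      next
        case True
        then obtain m where m: "\<And>r. 0 \<le> r \<Longrightarrow> r < t + 1 / real (Suc m) \<Longrightarrow> X (0 + r) \<omega> \<in> core m"
          unfolding alive_def by blast
        have XD: "X t \<omega> \<in> D" using alive_D[OF True t order_refl] by simp
        have al: "alive 0 s \<omega>" if "s < t + 1 / (2 * real (Suc m))" for s
          unfolding alive_def
        proof (intro exI[of _ "2 * Suc m"] allI impI)
          fix r assume r: "0 \<le> r \<and> r < s + 1 / real (Suc (2 * Suc m))"
          have "1 / real (Suc (2 * Suc m)) \<le> 1 / (2 * real (Suc m))" by (simp add: frac_le)
          moreover have "1 / (2 * real (Suc m)) + 1 / (2 * real (Suc m)) = 1 / real (Suc m)" by (simp add: field_simps)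
          moreover have "r < t + c" if "a \<le> b" "b + b = c" "r < s + a" "s < t + b" for a b c :: real
            using that by linarith
          ultimately have "r < t + 1 / real (Suc m)" using r that by blast
          then have "X (0 + r) \<omega> \<in> core m" using r m by blast
          then show "X (0 + r) \<omega> \<in> core (2 * Suc m)" using core_mono[of m "2 * Suc m"] by auto
        qed
        have ev: "\<forall>\<^sub>F i in sequentially. alive 0 (S i) \<omega>"
        proof (rule eventually_mono)
          show "\<forall>\<^sub>F i in sequentially. S i < t + 1 / (2 * real (Suc m))"
            using S by (rule order_tendstoD) simp
        qed (rule al)
        have Xlim: "(\<lambda>i. X (S i) \<omega>) \<longlonglongrightarrow> X t \<omega>"
          by (rule filterlim_compose[OF right_continuous_paths[OF w t] r])
        have evD: "\<forall>\<^sub>F i in sequentially. X (S i) \<omega> \<in> D"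
          using ev by eventually_elim (use alive_D[of 0 _ \<omega>] S0 in force)
        have fl: "(\<lambda>i. f (X (S i) \<omega>)) \<longlonglongrightarrow> f (X t \<omega>)"
          using f Xlim evD XD by (intro continuous_on_tendsto_compose[of D f]) (auto simp: bounded_continuous_on_def)
        have "\<forall>\<^sub>F i in sequentially. f (X (S i) \<omega>) = of_bool (alive 0 (S i) \<omega>) * (indicator D (X (S i) \<omega>) * f (X (S i) \<omega>))"
          using ev evD by eventually_elim simp
        then have "(\<lambda>i. of_bool (alive 0 (S i) \<omega>) * (indicator D (X (S i) \<omega>) * f (X (S i) \<omega>))) \<longlonglongrightarrow> f (X t \<omega>)"
          using fl by (rule Lim_transform_eventually[rotated])
        then show ?thesis using True XD by simp
      qed
    qed
  qed simp
qed

end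

section \<open>No jump upon approaching a compact set\<close>

lemma infdist_less_attained:
  assumes "A \<noteq> {}" "infdist x A < e" shows "\<exists>a\<in>A. dist x a < e"
proof (rule ccontr)
  assume "\<not> ?thesis"
  then have "\<And>a. a \<in> A \<Longrightarrow> e \<le> dist x a" by force
  then have "e \<le> infdist x A" using assms(1) by (simp add: infdist_notempty cINF_greatest)
  then show False using assms(2) by simp
qed

text \<open>
A cut-off function: 1 within distance \<open>e\<close> of \<open>C\<close>, and 0 from distance \<open>2 * e\<close> on.
\<close>

definition bump :: "'a::metric_space set \<Rightarrow> real \<Rightarrow> 'a \<Rightarrow> real" where
  "bump C e x = max 0 (min 1 (2 - infdist x C / e))"

lemma bump_range: "0 \<le> bump C e x" "bump C e x \<le> 1"
  by (auto simp: bump_def)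

lemma bump_abs: "\<bar>bump C e x\<bar> \<le> 1"
  by (auto simp: bump_def)

lemma bump_one: "0 < e \<Longrightarrow> infdist x C \<le> e \<Longrightarrow> bump C e x = 1"
proof -
  assume "0 < e" "infdist x C \<le> e"
  then have "infdist x C / e \<le> 1" by simp
  then show ?thesis by (simp add: bump_def)
qed

lemma bump_zero: "0 < e \<Longrightarrow> 2 * e \<le> infdist x C \<Longrightarrow> bump C e x = 0"
proof -
  assume "0 < e" "2 * e \<le> infdist x C"
  then have "2 \<le> infdist x C / e" by (simp add: field_simps)
  then show ?thesis by (simp add: bump_def)
qed

lemma bump_continuous: "0 < e \<Longrightarrow> continuous_on S (bump C e)"
  unfolding bump_def by (intro continuous_intros) auto

lemma bump_vanishing:
  assumes e: "0 < e" and c: "compact {x. infdist x C \<le> 2 * e}"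
  shows "bump C e \<in> vanishing_on UNIV"
proof -
  have "bump C e \<in> compactly_supported_on UNIV"
    unfolding compactly_supported_on_def
  proof (intro CollectI conjI exI)
    show "continuous_on UNIV (bump C e)" using e by (rule bump_continuous)
    show "compact {x. infdist x C \<le> 2 * e}" by (rule c)
    show "\<forall>x\<in>UNIV - {x. infdist x C \<le> 2 * e}. bump C e x = 0"
      by (auto intro!: bump_zero[OF e])
  qed simp
  then show ?thesis unfolding vanishing_on_def by (intro CollectI allI impI bexI[of _ "bump C e"]) auto
qed

lemma (in prob_space) prob_eventually_le:
  assumes A: "\<And>n. A n \<in> events" and le: "\<And>n. n0 \<le> n \<Longrightarrow> prob (A n) \<le> c"
  shows "{\<omega> \<in> space M. \<forall>\<^sub>F n in sequentially. \<omega> \<in> A n} \<in> events"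
    and "prob {\<omega> \<in> space M. \<forall>\<^sub>F n in sequentially. \<omega> \<in> A n} \<le> c"
proof -
  define B where "B N = (\<Inter>n\<in>{N..}. A n)" for N
  have B: "B N \<in> events" for N unfolding B_def using A by (intro sets.countable_INT') auto
  have eq: "{\<omega> \<in> space M. \<forall>\<^sub>F n in sequentially. \<omega> \<in> A n} = (\<Union>N. B N)"
    using sets.sets_into_space[OF A] by (auto simp: B_def eventually_sequentially)
  show "{\<omega> \<in> space M. \<forall>\<^sub>F n in sequentially. \<omega> \<in> A n} \<in> events" unfolding eq using B by auto
  have "incseq B" unfolding B_def incseq_def by (intro allI impI INF_superset_mono) auto
  then have "(\<lambda>N. prob (B N)) \<longlonglongrightarrow> prob (\<Union>N. B N)" using B by (intro finite_Lim_measure_incseq) auto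
  moreover have "prob (B N) \<le> c" for N
  proof -
    have "B N \<subseteq> A (max N n0)" by (auto simp: B_def)
    then have "prob (B N) \<le> prob (A (max N n0))" by (intro finite_measure_mono A)
    also have "\<dots> \<le> c" by (rule le) simp
    finally show ?thesis .
  qed
  ultimately show "prob {\<omega> \<in> space M. \<forall>\<^sub>F n in sequentially. \<omega> \<in> A n} \<le> c"
    unfolding eq by (intro LIMSEQ_le_const2) auto
qed

context feller_semigroup
begin

lemma compact_neighbourhood:
  fixes C V :: "'a set"
  assumes C: "compact C" "C \<noteq> {}" and V: "open V" "C \<subseteq> V"
  shows "\<exists>r>0. compact {x. infdist x C \<le> r} \<and> {x. infdist x C \<le> r} \<subseteq> V"
proof -
  have "\<forall>x::'a. \<exists>U L. open U \<and> compact L \<and> x \<in> U \<and> U \<subseteq> L"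
    using locally_compact by (simp add: locally_compact_space_def)
  then obtain U where "\<forall>x::'a. \<exists>L. open (U x) \<and> compact L \<and> x \<in> U x \<and> U x \<subseteq> L"
    using choice[where Q = "\<lambda>x U. \<exists>L. open U \<and> compact L \<and> x \<in> U \<and> U \<subseteq> L"] by blast
  then obtain L where "\<forall>x::'a. open (U x) \<and> compact (L x) \<and> x \<in> U x \<and> U x \<subseteq> L x"
    using choice[where Q = "\<lambda>x L. open (U x) \<and> compact L \<and> x \<in> U x \<and> U x \<subseteq> L"] by blast
  then have UL: "\<And>x. open (U x)" "\<And>x. compact (L x)" "\<And>x. x \<in> U x" "\<And>x. U x \<subseteq> L x" by blast+
  obtain I where I: "I \<subseteq> C" "finite I" "C \<subseteq> (\<Union>x\<in>I. U x)"
    using compactE_image[OF C(1), of C U] UL(1,3) by blast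
  define W where "W = V \<inter> (\<Union>x\<in>I. U x)"
  have "open W" unfolding W_def using V(1) UL(1) by (intro open_Int open_UN ballI)
  moreover have "C \<subseteq> W" using I V by (auto simp: W_def)
  ultimately obtain e where e: "0 < e" "(\<Union>x\<in>C. cball x e) \<subseteq> W"
    using compact_subset_open_imp_cball_epsilon_subset[OF C(1)] by blast
  have sub: "{x. infdist x C \<le> e / 2} \<subseteq> W"
  proof
    fix x assume "x \<in> {x. infdist x C \<le> e / 2}"
    then have "infdist x C < e" using e(1) by simp
    then obtain c where "c \<in> C" "dist x c < e" using infdist_less_attained[OF C(2)] by blast
    then have "x \<in> (\<Union>x\<in>C. cball x e)" by (auto simp: dist_commute intro!: bexI[of _ c])
    then show "x \<in> W" using e(2) by blast
  qed
  have "compact (\<Union>x\<in>I. L x)" using I(2) UL(2) by (intro compact_UN) auto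
  moreover have "{x. infdist x C \<le> e / 2} \<subseteq> (\<Union>x\<in>I. L x)" using sub UL(4) by (fastforce simp: W_def)
  moreover have "closed {x. infdist x C \<le> e / 2}" by (intro closed_Collect_le continuous_intros)
  ultimately have "compact {x. infdist x C \<le> e / 2}"
    by (metis compact_Int_closed inf.absorb_iff2)
  then show ?thesis using sub e(1) by (intro exI[of _ "e / 2"]) (auto simp: W_def)
qed

text \<open>
  An open set of positive mass carries a function in \<open>C\<^sub>0\<close> of positive mean: by second countability, it is a countable union of open
  sets with compact closure in it.
\<close>

lemma charging_bump:
  assumes t: "0 \<le> t" and V: "open V" and pos: "0 < measure (P t x) V"
  shows "\<exists>g\<in>vanishing_on UNIV. (\<forall>y. 0 \<le> g y \<and> g y \<le> 1) \<and> (\<forall>y. y \<notin> V \<longrightarrow> g y = 0) \<and> 0 < (\<integral>y. g y \<partial>P t x)"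
proof -
  have PT: "prob_space (P t x)" "sets (P t x) = sets borel"
    using measurable_space[OF kernel[OF t], of x] by (auto simp: space_prob_algebra)
  interpret prob_space "P t x" by (rule PT)
  obtain \<B> :: "'a set set" where \<B>: "countable \<B>" "topological_basis \<B>" using ex_countable_basis by blast
  define \<C> where "\<C> = {B \<in> \<B>. compact (closure B) \<and> closure B \<subseteq> V}"
  have cov: "V = \<Union>\<C>"
  proof
    show "\<Union>\<C> \<subseteq> V" using closure_subset by (fastforce simp: \<C>_def)
    show "V \<subseteq> \<Union>\<C>"
    proof
      fix y assume y: "y \<in> V"
      obtain r where r: "0 < r" "compact {x. infdist x {y} \<le> r}" "{x. infdist x {y} \<le> r} \<subseteq> V"
        using compact_neighbourhood[of "{y}" V] V y by auto
      have cb: "{x. infdist x {y} \<le> r} = cball y r" by (auto simp: infdist_singleton dist_commute)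
      obtain B where B: "B \<in> \<B>" "y \<in> B" "B \<subseteq> ball y r"
        using topological_basisE[OF \<B>(2) open_ball, of y y r] r(1) by auto
      have cl: "closure B \<subseteq> cball y r" using B(3) by (intro closure_minimal) auto
      moreover have "compact (closure B)"
        using compact_Int_closed[OF r(2)[unfolded cb] closed_closure, of B] cl by (simp add: Int_absorb1)
      ultimately have "B \<in> \<C>" using B(1) r(3) cb by (auto simp: \<C>_def)
      then show "y \<in> \<Union>\<C>" using B(2) by blast
    qed
  qed
  have cC: "countable \<C>" using \<B>(1) by (auto simp: \<C>_def)
  have oC: "B \<in> sets (P t x)" if "B \<in> \<C>" for B
    using that topological_basis_open[OF \<B>(2), of B] PT(2) by (auto simp: \<C>_def)
  have "\<exists>B\<in>\<C>. emeasure (P t x) B \<noteq> 0"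
  proof (rule ccontr)
    assume "\<not> ?thesis"
    then have "\<forall>B\<in>\<C>. B \<in> null_sets (P t x)" using oC by auto
    then have "(\<Union>B\<in>\<C>. B) \<in> null_sets (P t x)" using cC by (intro null_sets_UN') auto
    then have "measure (P t x) V = 0" using cov by (auto simp: measure_def)
    then show False using pos by simp
  qed
  then obtain B where B: "B \<in> \<C>" "emeasure (P t x) B \<noteq> 0" by blast
  have Bne: "closure B \<noteq> {}" using B(2) by auto
  have Bc: "compact (closure B)" "closure B \<subseteq> V" using B(1) by (auto simp: \<C>_def)
  obtain r where r: "0 < r" "compact {x. infdist x (closure B) \<le> r}" "{x. infdist x (closure B) \<le> r} \<subseteq> V"
    using compact_neighbourhood[OF Bc(1) Bne V Bc(2)] by blast
  define g where "g = bump (closure B) (r / 2)"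
  have r2: "0 < r / 2" using r by simp
  have gv: "g \<in> vanishing_on UNIV" unfolding g_def by (rule bump_vanishing[OF r2]) (use r in simp)
  have gz: "g y = 0" if "y \<notin> V" for y
  proof -
    have "r < infdist y (closure B)" using that r(3) by (auto simp: not_le[symmetric])
    then show ?thesis unfolding g_def by (intro bump_zero r2) simp
  qed
  have gm: "g \<in> borel_measurable (P t x)"
    using borel_measurable_continuous_onI[OF bump_continuous[OF r2]] measurable_cong_sets[OF PT(2) refl] unfolding g_def by blast
  have gi: "integrable (P t x) g" using gm bump_abs by (intro integrable_const_bound[where B = 1]) (auto simp: g_def)
  have "measure (P t x) B = (\<integral>y. indicator B y \<partial>P t x)"
    using oC[OF B(1)] sets.sets_into_space[OF oC[OF B(1)]] by (simp add: Int_absorb2)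
  also have "\<dots> \<le> (\<integral>y. g y \<partial>P t x)"
  proof (rule integral_mono[OF _ gi])
    show "integrable (P t x) (indicator B :: _ \<Rightarrow> real)" using oC[OF B(1)] by (simp add: emeasure_eq_measure)
    fix y
    show "indicator B y \<le> g y"
    proof (cases "y \<in> B")
      case True
      then have "infdist y (closure B) = 0" using closure_subset[of B] by (intro infdist_zero) auto
      then show ?thesis using True bump_one[OF r2, of y "closure B"] r2 by (simp add: g_def)
    qed (simp add: g_def bump_range)
  qed
  finally have "prob B \<le> (\<integral>y. g y \<partial>P t x)" .
  moreover have "0 < prob B" using B(2) measure_nonneg[of "P t x" B] by (simp add: emeasure_eq_measure order_less_le)
  ultimately have "0 < (\<integral>y. g y \<partial>P t x)" by linarith
  then show ?thesis using gv gz bump_range by (intro bexI[of _ g]) (auto simp: g_def)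
qed

end

context feller_process
begin

lemma bmeasF_indicator: assumes "0 \<le> t" "A \<in> sets (F t)" shows "bmeasF t (indicator A)"
  using borel_measurable_indicator[OF assms(2)] by (auto simp: bmeasF_def indicator_def intro!: exI[of _ 1])

text \<open>
  A maximal inequality on a finite time grid. On \<open>A\<close> the path is where \<open>f = 1\<close> at time \<open>t\<close>, and \<open>H i\<close> is the event that
  the path is first seen where \<open>f = 0\<close> after \<open>i\<close> steps. By the Markov property at time \<open>t\<close>, the mean of \<open>f\<close> at the
  final time is at least \<open>1 - \<eta>\<close> on \<open>A\<close>; by the Markov property at the time of escape, it is at most \<open>\<eta>\<close> on each \<open>H i\<close>.
\<close>

lemma escape_after_visit:
  assumes \<eta>: "0 \<le> \<eta>" and f: "bfun f" "\<And>y. 0 \<le> f y" "\<And>y. f y \<le> 1"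
    and near: "\<And>s y. 0 \<le> s \<Longrightarrow> s \<le> \<delta> \<Longrightarrow> \<bar>(\<integral>z. f z \<partial>P s y) - f y\<bar> \<le> \<eta>"
    and t: "0 \<le> t" and A: "A \<in> sets (F t)" "\<And>\<omega>. \<omega> \<in> A \<Longrightarrow> f (X t \<omega>) = 1"
    and d: "0 \<le> d" "real N * d \<le> \<delta>"
    and H: "\<And>i. i \<le> N \<Longrightarrow> H i \<in> sets (F (t + real i * d))" "\<And>i. i \<le> N \<Longrightarrow> H i \<subseteq> A"
      "disjoint_family_on H {..N}" "\<And>i \<omega>. i \<le> N \<Longrightarrow> \<omega> \<in> H i \<Longrightarrow> f (X (t + real i * d) \<omega>) = 0"
  shows "(1 - \<eta>) * measure (Pr x) (\<Union>i\<le>N. H i) \<le> \<eta> * measure (Pr x) A"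
proof -
  interpret prob_space "Pr x" by (rule prob_law)
  have ti: "0 \<le> t + real i * d" for i using t d by simp
  define Y where "Y \<omega> = f (X (t + real N * d) \<omega>)" for \<omega>
  have Yb: "bmeas Y" unfolding Y_def by (rule bfun_X[OF ti f(1)])
  have Y01: "0 \<le> Y \<omega>" "Y \<omega> \<le> 1" for \<omega> using f by (auto simp: Y_def)
  have Aev: "A \<in> events" using sets_F[OF t A(1)] by (simp add: sets_law)
  have Hev: "H i \<in> events" if "i \<le> N" for i using sets_F[OF ti H(1)[OF that]] by (simp add: sets_law)
  have Uev: "(\<Union>i\<le>N. H i) \<in> events" using Hev by auto
  have intA: "integrable (Pr x) (\<lambda>\<omega>. indicator A \<omega> * Y \<omega>)"
    by (rule bmeas_integrable[OF bmeas_mult[OF bmeasF_bmeas[OF t bmeasF_indicator[OF t A(1)]] Yb]])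
  have intH: "integrable (Pr x) (\<lambda>\<omega>. indicator (H i) \<omega> * Y \<omega>)" if "i \<le> N" for i
    by (rule bmeas_integrable[OF bmeas_mult[OF bmeasF_bmeas[OF ti bmeasF_indicator[OF ti H(1)[OF that]]] Yb]])
  have indint: "integrable (Pr x) (indicator B :: _ \<Rightarrow> real)" if "B \<in> events" for B
    using that by (simp add: emeasure_eq_measure)
  have indval: "(\<integral>\<omega>. indicator B \<omega> \<partial>Pr x) = prob B" if "B \<in> events" for B
    using that sets.sets_into_space[OF that] by (simp add: Int_absorb2)
  have lower: "(1 - \<eta>) * prob A \<le> (\<integral>\<omega>. indicator A \<omega> * Y \<omega> \<partial>Pr x)"
  proof -
    have Nd: "0 \<le> real N * d" using d by simp
    have "(1 - \<eta>) * prob A = (\<integral>\<omega>. (1 - \<eta>) * indicator A \<omega> \<partial>Pr x)" using indval[OF Aev] by simp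
    also have "\<dots> \<le> (\<integral>\<omega>. indicator A \<omega> * (\<integral>z. f z \<partial>P (real N * d) (X t \<omega>)) \<partial>Pr x)"
    proof (rule integral_mono)
      show "integrable (Pr x) (\<lambda>\<omega>. (1 - \<eta>) * indicator A \<omega>)" using indint[OF Aev] by simp
      show "integrable (Pr x) (\<lambda>\<omega>. indicator A \<omega> * (\<integral>z. f z \<partial>P (real N * d) (X t \<omega>)))"
        by (rule bmeas_integrable[OF bmeas_mult[OF bmeasF_bmeas[OF t bmeasF_indicator[OF t A(1)]] bfun_X[OF t kernel_bfun[OF Nd f(1)]]]])
      fix \<omega>
      show "(1 - \<eta>) * indicator A \<omega> \<le> indicator A \<omega> * (\<integral>z. f z \<partial>P (real N * d) (X t \<omega>))"
        using A(2)[of \<omega>] near[OF Nd d(2), of "X t \<omega>"] by (cases "\<omega> \<in> A") auto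
    qed
    also have "\<dots> = (\<integral>\<omega>. indicator A \<omega> * Y \<omega> \<partial>Pr x)"
      unfolding Y_def by (rule simple_markov[OF t Nd f(1) bmeasF_indicator[OF t A(1)], symmetric])
    finally show ?thesis .
  qed
  have upper: "(\<integral>\<omega>. indicator (H i) \<omega> * Y \<omega> \<partial>Pr x) \<le> \<eta> * prob (H i)" if i: "i \<le> N" for i
  proof -
    define s where "s = real (N - i) * d"
    have s0: "0 \<le> s" using d by (simp add: s_def)
    have "real (N - i) * d \<le> real N * d" using d by (intro mult_right_mono) auto
    then have s1: "s \<le> \<delta>" using d(2) by (simp add: s_def)
    have ts: "t + real N * d = (t + real i * d) + s"
      using i by (simp add: s_def of_nat_diff algebra_simps)
    have "(\<integral>\<omega>. indicator (H i) \<omega> * Y \<omega> \<partial>Pr x) = (\<integral>\<omega>. indicator (H i) \<omega> * (\<integral>z. f z \<partial>P s (X (t + real i * d) \<omega>)) \<partial>Pr x)"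
      unfolding Y_def ts by (rule simple_markov[OF ti s0 f(1) bmeasF_indicator[OF ti H(1)[OF i]]])
    also have "\<dots> \<le> (\<integral>\<omega>. \<eta> * indicator (H i) \<omega> \<partial>Pr x)"
    proof (rule integral_mono)
      show "integrable (Pr x) (\<lambda>\<omega>. \<eta> * indicator (H i) \<omega>)" using indint[OF Hev[OF i]] by simp
      show "integrable (Pr x) (\<lambda>\<omega>. indicator (H i) \<omega> * (\<integral>z. f z \<partial>P s (X (t + real i * d) \<omega>)))"
        by (rule bmeas_integrable[OF bmeas_mult[OF bmeasF_bmeas[OF ti bmeasF_indicator[OF ti H(1)[OF i]]] bfun_X[OF ti kernel_bfun[OF s0 f(1)]]]])
      fix \<omega>
      show "indicator (H i) \<omega> * (\<integral>z. f z \<partial>P s (X (t + real i * d) \<omega>)) \<le> \<eta> * indicator (H i) \<omega>"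
        using H(4)[OF i, of \<omega>] near[OF s0 s1, of "X (t + real i * d) \<omega>"] by (cases "\<omega> \<in> H i") auto
    qed
    also have "\<dots> = \<eta> * prob (H i)" using indval[OF Hev[OF i]] by simp
    finally show ?thesis .
  qed
  have "(\<integral>\<omega>. indicator A \<omega> * Y \<omega> \<partial>Pr x) \<le>
      (\<integral>\<omega>. (indicator A \<omega> - indicator (\<Union>i\<le>N. H i) \<omega>) + (\<Sum>i\<le>N. indicator (H i) \<omega> * Y \<omega>) \<partial>Pr x)"
  proof (rule integral_mono[OF intA])
    show "integrable (Pr x) (\<lambda>\<omega>. (indicator A \<omega> - indicator (\<Union>i\<le>N. H i) \<omega>) + (\<Sum>i\<le>N. indicator (H i) \<omega> * Y \<omega>))"
      by (intro Bochner_Integration.integrable_add Bochner_Integration.integrable_diff Bochner_Integration.integrable_sum indint Aev Uev intH) auto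
    fix \<omega>
    show "indicator A \<omega> * Y \<omega> \<le> (indicator A \<omega> - indicator (\<Union>i\<le>N. H i) \<omega>) + (\<Sum>i\<le>N. indicator (H i) \<omega> * Y \<omega>)"
    proof (cases "\<exists>i\<le>N. \<omega> \<in> H i")
      case True
      then obtain i where i: "i \<le> N" "\<omega> \<in> H i" by blast
      have w: "\<omega> \<in> A" "\<omega> \<in> (\<Union>i\<le>N. H i)" using i H(2)[OF i(1)] by auto
      have "indicator (H i) \<omega> * Y \<omega> \<le> (\<Sum>i\<le>N. indicator (H i) \<omega> * Y \<omega>)"
        using i Y01 by (intro member_le_sum) auto
      then show ?thesis using i w by simp
    next
      case False
      then have "\<omega> \<notin> (\<Union>i\<le>N. H i)" "(\<Sum>i\<le>N. indicator (H i) \<omega> * Y \<omega>) = 0" by (auto intro!: sum.neutral)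
      then show ?thesis using Y01[of \<omega>] by (cases "\<omega> \<in> A") auto
    qed
  qed
  also have "\<dots> = prob A - prob (\<Union>i\<le>N. H i) + (\<Sum>i\<le>N. \<integral>\<omega>. indicator (H i) \<omega> * Y \<omega> \<partial>Pr x)"
  proof -
    have "(\<integral>\<omega>. (indicator A \<omega> - indicator (\<Union>i\<le>N. H i) \<omega>) + (\<Sum>i\<le>N. indicator (H i) \<omega> * Y \<omega>) \<partial>Pr x)
      = (\<integral>\<omega>. indicator A \<omega> - indicator (\<Union>i\<le>N. H i) \<omega> \<partial>Pr x) + (\<integral>\<omega>. (\<Sum>i\<le>N. indicator (H i) \<omega> * Y \<omega>) \<partial>Pr x)"
      by (intro Bochner_Integration.integral_add Bochner_Integration.integrable_diff Bochner_Integration.integrable_sum indint Aev Uev intH) auto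
    moreover have "(\<integral>\<omega>. indicator A \<omega> - indicator (\<Union>i\<le>N. H i) \<omega> \<partial>Pr x) = prob A - prob (\<Union>i\<le>N. H i)"
      unfolding Bochner_Integration.integral_diff[OF indint[OF Aev] indint[OF Uev]] indval[OF Aev] indval[OF Uev] ..
    moreover have "(\<integral>\<omega>. (\<Sum>i\<le>N. indicator (H i) \<omega> * Y \<omega>) \<partial>Pr x) = (\<Sum>i\<le>N. \<integral>\<omega>. indicator (H i) \<omega> * Y \<omega> \<partial>Pr x)"
      by (intro Bochner_Integration.integral_sum intH) auto
    ultimately show ?thesis by (simp only:)
  qed
  also have "\<dots> \<le> prob A - prob (\<Union>i\<le>N. H i) + (\<Sum>i\<le>N. \<eta> * prob (H i))"
    using upper by (intro add_left_mono sum_mono) auto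
  also have "(\<Sum>i\<le>N. \<eta> * prob (H i)) = \<eta> * prob (\<Union>i\<le>N. H i)"
    using Hev H(3) by (subst finite_measure_finite_Union) (auto simp: sum_distrib_left)
  finally show ?thesis using lower by (simp add: algebra_simps)
qed

text \<open>
  On the grid of mesh \<open>d\<close>, the first time with \<open>\<phi> < b\<close> has index \<open>j\<close>.
\<close>

definition visit :: "('a \<Rightarrow> real) \<Rightarrow> real \<Rightarrow> real \<Rightarrow> nat \<Rightarrow> 'w set" where
  "visit \<phi> d b j = {\<omega> \<in> space \<A>. \<phi> (X (real j * d) \<omega>) < b \<and> (\<forall>l<j. b \<le> \<phi> (X (real l * d) \<omega>))}"

text \<open>
  In addition, \<open>i\<close> is the number of further steps until \<open>\<phi>\<close> first reaches the level \<open>c\<close>.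
\<close>

definition visit_escape :: "('a \<Rightarrow> real) \<Rightarrow> real \<Rightarrow> real \<Rightarrow> real \<Rightarrow> nat \<Rightarrow> nat \<Rightarrow> 'w set" where
  "visit_escape \<phi> d b c j i = {\<omega> \<in> visit \<phi> d b j.
     c \<le> \<phi> (X (real j * d + real i * d) \<omega>) \<and> (\<forall>l<i. \<phi> (X (real j * d + real l * d) \<omega>) < c)}"

lemma level_sets:
  fixes \<phi> :: "'a \<Rightarrow> real"
  assumes \<phi>: "\<phi> \<in> borel_measurable borel" and s: "0 \<le> s" "s \<le> t"
  shows "{\<omega> \<in> space (F t). \<phi> (X s \<omega>) < b} \<in> sets (F t)" "{\<omega> \<in> space (F t). b \<le> \<phi> (X s \<omega>)} \<in> sets (F t)"
proof -
  have m: "(\<lambda>\<omega>. \<phi> (X s \<omega>)) \<in> borel_measurable (F t)"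
    using measurable_F_mono[OF s adapted[OF s(1)]] \<phi> by (rule measurable_compose)
  show "{\<omega> \<in> space (F t). \<phi> (X s \<omega>) < b} \<in> sets (F t)" using m by measurable
  show "{\<omega> \<in> space (F t). b \<le> \<phi> (X s \<omega>)} \<in> sets (F t)" using m by measurable
qed

lemma visit_sets:
  assumes \<phi>: "\<phi> \<in> borel_measurable borel" and d: "0 \<le> d" and t: "real j * d \<le> t"
  shows "visit \<phi> d b j \<in> sets (F t)"
proof -
  have jd: "0 \<le> real j * d" using d by simp
  have t0: "0 \<le> t" using jd t by linarith
  have "{\<omega> \<in> space (F t). l < j \<longrightarrow> b \<le> \<phi> (X (real l * d) \<omega>)} \<in> sets (F t)" for l
  proof (cases "l < j")
    case True
    then have "real l * d \<le> real j * d" using d by (intro mult_right_mono) auto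
    then show ?thesis using True level_sets(2)[OF \<phi>, of "real l * d" t b] d t by simp
  qed simp
  then have "{\<omega> \<in> space (F t). \<phi> (X (real j * d) \<omega>) < b \<and> (\<forall>l. l < j \<longrightarrow> b \<le> \<phi> (X (real l * d) \<omega>))} \<in> sets (F t)"
    by (intro sets.sets_Collect_conj sets.sets_Collect_countable_All level_sets(1)[OF \<phi> jd t])
  then show ?thesis by (simp add: visit_def space_F[OF t0])
qed

lemma visit_escape_sets:
  assumes \<phi>: "\<phi> \<in> borel_measurable borel" and d: "0 \<le> d"
  shows "visit_escape \<phi> d b c j i \<in> sets (F (real j * d + real i * d))"
proof -
  define t where "t = real j * d + real i * d"
  have t0: "0 \<le> t" using d by (simp add: t_def)
  have v: "visit \<phi> d b j \<in> sets (F t)" using d by (intro visit_sets \<phi>) (auto simp: t_def)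
  have "{\<omega> \<in> space (F t). l < i \<longrightarrow> \<phi> (X (real j * d + real l * d) \<omega>) < c} \<in> sets (F t)" for l
  proof (cases "l < i")
    case True
    then have "real l * d \<le> real i * d" using d by (intro mult_right_mono) auto
    then show ?thesis using True level_sets(1)[OF \<phi>, of "real j * d + real l * d" t c] d by (simp add: t_def)
  qed simp
  then have "{\<omega> \<in> space (F t). c \<le> \<phi> (X t \<omega>) \<and> (\<forall>l. l < i \<longrightarrow> \<phi> (X (real j * d + real l * d) \<omega>) < c)} \<in> sets (F t)"
    by (intro sets.sets_Collect_conj sets.sets_Collect_countable_All level_sets(2)[OF \<phi> t0 order_refl])
  then have "visit \<phi> d b j \<inter> {\<omega> \<in> space (F t). c \<le> \<phi> (X t \<omega>) \<and> (\<forall>l. l < i \<longrightarrow> \<phi> (X (real j * d + real l * d) \<omega>) < c)} \<in> sets (F t)"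
    by (rule sets.Int[OF v])
  moreover have "visit \<phi> d b j \<inter> {\<omega> \<in> space (F t). c \<le> \<phi> (X t \<omega>) \<and> (\<forall>l. l < i \<longrightarrow> \<phi> (X (real j * d + real l * d) \<omega>) < c)}
     = visit_escape \<phi> d b c j i"
    by (auto simp: visit_escape_def visit_def space_F[OF t0] t_def[symmetric])
  ultimately show ?thesis by (simp add: t_def)
qed

text \<open>
  The bound depends neither on the mesh nor on the time horizon \<open>J\<close>, since the events \<open>visit\<close> are disjoint for different \<open>j\<close>.
\<close>

lemma prob_visit_escape:
  assumes \<eta>: "0 \<le> \<eta>" "\<eta> \<le> 1 / 2" and f: "bfun f" "\<And>y. 0 \<le> f y" "\<And>y. f y \<le> 1"
    and near: "\<And>s y. 0 \<le> s \<Longrightarrow> s \<le> \<delta> \<Longrightarrow> \<bar>(\<integral>z. f z \<partial>P s y) - f y\<bar> \<le> \<eta>"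
    and \<phi>: "\<phi> \<in> borel_measurable borel" "\<And>y. \<phi> y < b \<Longrightarrow> f y = 1" "\<And>y. c \<le> \<phi> y \<Longrightarrow> f y = 0"
    and d: "0 \<le> d" "real N * d \<le> \<delta>"
  shows "(\<Union>j\<le>J. \<Union>i\<le>N. visit_escape \<phi> d b c j i) \<in> sets (Pr x)"
    and "measure (Pr x) (\<Union>j\<le>J. \<Union>i\<le>N. visit_escape \<phi> d b c j i) \<le> 2 * \<eta>"
proof -
  interpret prob_space "Pr x" by (rule prob_law)
  have ev: "visit_escape \<phi> d b c j i \<in> events" for j i
    using sets_F[OF _ visit_escape_sets[OF \<phi>(1) d(1)], of j i b c] d by (simp add: sets_law)
  have vev: "visit \<phi> d b j \<in> events" for j
    using sets_F[OF _ visit_sets[OF \<phi>(1) d(1) order_refl], of j b] d by (simp add: sets_law)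
  show "(\<Union>j\<le>J. \<Union>i\<le>N. visit_escape \<phi> d b c j i) \<in> sets (Pr x)" using ev by auto
  have bound: "prob (\<Union>i\<le>N. visit_escape \<phi> d b c j i) \<le> 2 * \<eta> * prob (visit \<phi> d b j)" for j
  proof -
    have "(1 - \<eta>) * prob (\<Union>i\<le>N. visit_escape \<phi> d b c j i) \<le> \<eta> * prob (visit \<phi> d b j)"
    proof (rule escape_after_visit[where f = f and \<delta> = \<delta> and t = "real j * d" and d = d])
      show "visit \<phi> d b j \<in> sets (F (real j * d))" by (rule visit_sets[OF \<phi>(1) d(1) order_refl])
      show "f (X (real j * d) \<omega>) = 1" if "\<omega> \<in> visit \<phi> d b j" for \<omega> using that by (intro \<phi>(2)) (simp add: visit_def)
      show "visit_escape \<phi> d b c j i \<in> sets (F (real j * d + real i * d))" for i by (rule visit_escape_sets[OF \<phi>(1) d(1)])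
      show "visit_escape \<phi> d b c j i \<subseteq> visit \<phi> d b j" for i by (auto simp: visit_escape_def)
      show "f (X (real j * d + real i * d) \<omega>) = 0" if "\<omega> \<in> visit_escape \<phi> d b c j i" for i \<omega>
        using that by (intro \<phi>(3)) (simp add: visit_escape_def)
      show "disjoint_family_on (visit_escape \<phi> d b c j) {..N}"
        unfolding disjoint_family_on_def
      proof (intro ballI impI)
        have "visit_escape \<phi> d b c j m \<inter> visit_escape \<phi> d b c j n = {}" if "m < n" for m n
          using that by (fastforce simp: visit_escape_def)
        then show "visit_escape \<phi> d b c j m \<inter> visit_escape \<phi> d b c j n = {}" if "m \<noteq> n" for m n
          using that by (metis inf_commute nat_neq_iff)
      qed
    qed (use \<eta> f near d in auto)
    moreover have "1 / 2 * prob (\<Union>i\<le>N. visit_escape \<phi> d b c j i) \<le> (1 - \<eta>) * prob (\<Union>i\<le>N. visit_escape \<phi> d b c j i)"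
      using \<eta> by (intro mult_right_mono) auto
    ultimately show ?thesis by linarith
  qed
  have "prob (\<Union>j\<le>J. \<Union>i\<le>N. visit_escape \<phi> d b c j i) \<le> (\<Sum>j\<le>J. prob (\<Union>i\<le>N. visit_escape \<phi> d b c j i))"
    using ev by (intro finite_measure_subadditive_finite) auto
  also have "\<dots> \<le> (\<Sum>j\<le>J. 2 * \<eta> * prob (visit \<phi> d b j))" by (intro sum_mono bound)
  also have "\<dots> = 2 * \<eta> * prob (\<Union>j\<le>J. visit \<phi> d b j)"
  proof -
    have "disjoint_family_on (visit \<phi> d b) {..J}"
      unfolding disjoint_family_on_def
    proof (intro ballI impI)
      have "visit \<phi> d b m \<inter> visit \<phi> d b n = {}" if "m < n" for m n
        using that by (fastforce simp: visit_def)
      then show "visit \<phi> d b m \<inter> visit \<phi> d b n = {}" if "m \<noteq> n" for m n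
        using that by (metis inf_commute nat_neq_iff)
    qed
    then show ?thesis using vev by (subst finite_measure_finite_Union) (auto simp: sum_distrib_left)
  qed
  also have "\<dots> \<le> 2 * \<eta> * 1" using \<eta> by (intro mult_left_mono) auto
  finally show "prob (\<Union>j\<le>J. \<Union>i\<le>N. visit_escape \<phi> d b c j i) \<le> 2 * \<eta>" by simp
qed

lemma short_time_stable:
  assumes f: "f \<in> vanishing_on UNIV" "f \<in> borel_measurable borel" and \<eta>: "0 < \<eta>"
  shows "\<exists>i::nat. \<forall>s y. 0 \<le> s \<and> s \<le> 1 / real (Suc i) \<longrightarrow> \<bar>(\<integral>z. f z \<partial>P s y) - f y\<bar> \<le> \<eta>"
proof -
  have "\<forall>\<^sub>F s in at_right 0. \<forall>y\<in>UNIV. dist (\<integral>z. f z \<partial>P s y) (f y) < \<eta>"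
    by (rule uniform_limitD[OF strongly_continuous[OF f(1)] \<eta>])
  then obtain b where b: "0 < b" "\<And>s. 0 < s \<Longrightarrow> s < b \<Longrightarrow> \<forall>y\<in>UNIV. dist (\<integral>z. f z \<partial>P s y) (f y) < \<eta>"
    unfolding eventually_at_right_field by blast
  obtain i where i: "1 / real (Suc i) < b" using nat_approx_posE[OF b(1)] by blast
  have "\<bar>(\<integral>z. f z \<partial>P s y) - f y\<bar> \<le> \<eta>" if s: "0 \<le> s" "s \<le> 1 / real (Suc i)" for s y
  proof (cases "s = 0")
    case True
    have "(\<integral>z. f z \<partial>P 0 y) = f y" unfolding kernel_0 using f(2) by (intro integral_return) auto
    then show ?thesis using True \<eta> by simp
  next
    case False
    then have "0 < s" "s < b" using s i by linarith+
    from b(2)[OF this] have "dist (\<integral>z. f z \<partial>P s y) (f y) < \<eta>" by blast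
    then show ?thesis by (simp add: dist_real_def)
  qed
  then show ?thesis by blast
qed

lemma path_nearby:
  assumes w: "\<omega> \<in> space \<A>" and \<phi>: "continuous_on UNIV \<phi>" and r: "0 \<le> r" and W: "open W" "\<phi> (X r \<omega>) \<in> (W :: real set)"
  shows "\<exists>b>r. \<forall>s. r \<le> s \<and> s < b \<longrightarrow> \<phi> (X s \<omega>) \<in> W"
proof -
  have "((\<lambda>s. \<phi> (X s \<omega>)) \<longlongrightarrow> \<phi> (X r \<omega>)) (at_right r)"
    by (rule continuous_on_tendsto_compose[OF \<phi> right_continuous_paths[OF w r]]) auto
  then have "\<forall>\<^sub>F s in at_right r. \<phi> (X s \<omega>) \<in> W" using W by (rule topological_tendstoD)
  then obtain b where b: "r < b" "\<And>s. r < s \<Longrightarrow> s < b \<Longrightarrow> \<phi> (X s \<omega>) \<in> W"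
    unfolding eventually_at_right_field by blast
  have "\<phi> (X s \<omega>) \<in> W" if "r \<le> s" "s < b" for s
    using b(2)[of s] that W(2) by (cases "s = r") auto
  then show ?thesis using b(1) by blast
qed

end

context killed_feller_process
begin

text \<open>
  The deterministic part of quasi-left-continuity. If a path stays in \<open>D\<close> beyond time \<open>t\<close> but \<open>alive 0 t\<close> fails, let \<open>S n\<close> be
  the infimum of its times within distance \<open>1 / (n + 1)\<close> of the relative boundary. These times are nondecreasing and strictly less than
  their limit \<open>L \<le> t\<close>, while
  \<open>X L\<close> is at positive distance from the boundary. So, on fine grids, an escape from the boundary follows the first visit near it within
  an arbitrarily short time \<open>\<delta>\<close>.
\<close>

lemma boundary_approach:
  assumes w: "\<omega> \<in> space \<A>" and t: "0 \<le> t" "t < u" and inD: "\<And>s. 0 \<le> s \<Longrightarrow> s < u \<Longrightarrow> X s \<omega> \<in> D"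
    and dead: "\<not> alive 0 t \<omega>"
  shows "closure D - D \<noteq> {}"
    and "\<exists>\<rho>>0. \<forall>c \<delta>. 0 < c \<and> c < \<rho> \<and> 0 < \<delta> \<longrightarrow> (\<forall>\<^sub>F n in sequentially. \<forall>\<^sub>F k in sequentially.
       \<exists>j l. \<omega> \<in> visit_escape (\<lambda>y. infdist y (closure D - D)) (1 / 2 ^ k) (1 / real (Suc n)) c j l \<and>
          real j * (1 / 2 ^ k) \<le> t \<and> real l * (1 / 2 ^ k) \<le> \<delta>)"
proof -
  define C where "C = closure D - D"
  define \<phi> where "\<phi> y = infdist y C" for y
  have \<phi>c: "continuous_on UNIV \<phi>" unfolding \<phi>_def by (intro continuous_intros)
  define V where "V n = {r. 0 \<le> r \<and> \<phi> (X r \<omega>) < 1 / real (Suc n)}" for n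
  have near: "\<exists>r. 0 \<le> r \<and> r < t + 1 / real (Suc m) \<and> (\<exists>c\<in>C. dist (X r \<omega>) c < 1 / real (Suc m))"
    if m: "1 / real (Suc m) < u - t" for m
  proof -
    have "\<not> (\<forall>r. 0 \<le> r \<and> r < t + 1 / real (Suc m) \<longrightarrow> X (0 + r) \<omega> \<in> core m)"
      using dead unfolding alive_def by blast
    then obtain r where r: "0 \<le> r" "r < t + 1 / real (Suc m)" "X r \<omega> \<notin> core m" by auto
    have "r < u" using r(2) m by linarith
    then have "X r \<omega> \<in> D" using inD r(1) by blast
    then have "X r \<omega> \<in> closure D" using closure_subset by blast
    then have "\<exists>c\<in>C. \<not> 1 / real (Suc m) \<le> dist (X r \<omega>) c" using r(3) unfolding core_def C_def by blast
    then show ?thesis using r by (auto simp: not_le)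
  qed
  obtain m0 where m0: "1 / real (Suc m0) < u - t" using nat_approx_posE[of "u - t"] t(2) by auto
  have small: "1 / real (Suc m) \<le> 1 / real (Suc m')" if "m' \<le> m" for m m' using that by (simp add: frac_le)
  show ne: "closure D - D \<noteq> {}" using near[OF m0] unfolding C_def by blast
  then have Cne: "C \<noteq> {}" by (simp add: C_def)
  have Vnear: "\<exists>r\<in>V n. r < t + e" if e: "0 < e" for n e
  proof -
    obtain k where k: "1 / real (Suc k) < e" using nat_approx_posE[OF e] by blast
    define m where "m = max (max n m0) k"
    have le: "1 / real (Suc m) \<le> 1 / real (Suc n)" "1 / real (Suc m) \<le> 1 / real (Suc m0)" "1 / real (Suc m) \<le> 1 / real (Suc k)"
      by (rule small, simp add: m_def)+
    have "1 / real (Suc m) < u - t" using le(2) m0 by linarith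
    from near[OF this] obtain r c where r: "0 \<le> r" "r < t + 1 / real (Suc m)" "c \<in> C" "dist (X r \<omega>) c < 1 / real (Suc m)"
      by blast
    have "\<phi> (X r \<omega>) \<le> dist (X r \<omega>) c" unfolding \<phi>_def by (rule infdist_le[OF r(3)])
    then have "\<phi> (X r \<omega>) < 1 / real (Suc n)" using r(4) le(1) by linarith
    then have "r \<in> V n" using r(1) by (simp add: V_def)
    moreover have "r < t + e" using r(2) le(3) k by linarith
    ultimately show ?thesis by blast
  qed
  have Vne: "V n \<noteq> {}" for n using Vnear[OF zero_less_one, of n] by blast
  have Vbdd: "bdd_below (V n)" for n by (rule bdd_belowI[of _ 0]) (simp add: V_def)
  define S where "S n = Inf (V n)" for n
  have S0: "0 \<le> S n" for n unfolding S_def by (rule cInf_greatest[OF Vne]) (simp add: V_def)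
  have Slow: "S n \<le> r" if "r \<in> V n" for n r unfolding S_def by (rule cInf_lower[OF that Vbdd])
  have St: "S n \<le> t" for n
  proof (rule field_le_epsilon)
    fix e :: real assume "0 < e"
    then obtain r where "r \<in> V n" "r < t + e" using Vnear by blast
    then show "S n \<le> t + e" using Slow[of r n] by linarith
  qed
  have Smono: "S m \<le> S n" if "m \<le> n" for m n
    unfolding S_def
  proof (rule cInf_superset_mono[OF Vne Vbdd])
    show "V n \<subseteq> V m"
    proof
      fix r assume "r \<in> V n"
      then have "0 \<le> r" "\<phi> (X r \<omega>) < 1 / real (Suc n)" by (auto simp: V_def)
      then show "r \<in> V m" using small[OF that] by (simp add: V_def)
    qed
  qed
  have Sval: "\<phi> (X (S n) \<omega>) \<le> 1 / real (Suc n)" for n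
  proof (rule ccontr)
    assume "\<not> ?thesis"
    then have "\<phi> (X (S n) \<omega>) \<in> {1 / real (Suc n)<..}" by simp
    from path_nearby[OF w \<phi>c S0 open_greaterThan this]
    obtain b where b: "S n < b" "\<forall>s. S n \<le> s \<and> s < b \<longrightarrow> \<phi> (X s \<omega>) \<in> {1 / real (Suc n)<..}" by blast
    have "b \<le> r" if r: "r \<in> V n" for r
    proof (rule ccontr)
      assume "\<not> b \<le> r"
      then have "\<phi> (X r \<omega>) \<in> {1 / real (Suc n)<..}" using b(2) Slow[OF r] by simp
      then show False using r by (simp add: V_def)
    qed
    then have "b \<le> S n" unfolding S_def by (intro cInf_greatest Vne)
    then show False using b(1) by simp
  qed
  define L where "L = (SUP n. S n)"
  have bddS: "bdd_above (range S)" using St by (intro bdd_aboveI[of _ t]) auto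
  have Slim: "S \<longlonglongrightarrow> L" unfolding L_def using bddS Smono by (intro LIMSEQ_incseq_SUP) (auto simp: incseq_def)
  have SL: "S n \<le> L" for n unfolding L_def using bddS by (intro cSUP_upper) auto
  have Lt: "L \<le> t" unfolding L_def using St by (intro cSUP_least) auto
  have L0: "0 \<le> L" using S0[of 0] SL[of 0] by linarith
  have "X L \<omega> \<in> D" using inD[OF L0] Lt t(2) by simp
  then have "X L \<omega> \<notin> C" by (simp add: C_def)
  then have \<rho>: "0 < \<phi> (X L \<omega>)" unfolding \<phi>_def
    using infdist_pos_not_in_closed[OF _ Cne] closed_boundary by (simp add: C_def)
  \<comment> \<open>otherwise \<open>X L\<close> would be within \<open>1 / (k + 1)\<close> of the boundary for every large \<open>k\<close>\<close>
  have Sless: "S n < L" for n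
  proof (rule ccontr)
    assume "\<not> S n < L"
    then have eq: "S k = L" if "n \<le> k" for k using Smono[OF that] SL[of k] SL[of n] by linarith
    obtain k where k: "1 / real (Suc k) < \<phi> (X L \<omega>)" using nat_approx_posE[OF \<rho>] by blast
    have "\<phi> (X L \<omega>) \<le> 1 / real (Suc (max n k))" using Sval[of "max n k"] eq[of "max n k"] by simp
    also have "\<dots> \<le> 1 / real (Suc k)" by (rule small) simp
    finally show False using k by simp
  qed
  have main: "\<forall>\<^sub>F n in sequentially. \<forall>\<^sub>F k in sequentially.
       \<exists>j l. \<omega> \<in> visit_escape \<phi> (1 / 2 ^ k) (1 / real (Suc n)) c j l \<and>
          real j * (1 / 2 ^ k) \<le> t \<and> real l * (1 / 2 ^ k) \<le> \<delta>"
    if c: "0 < c" "c < \<phi> (X L \<omega>)" and \<delta>: "0 < \<delta>" for c \<delta>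
  proof -
    have "\<forall>\<^sub>F n in sequentially. L - \<delta> / 2 < S n" using Slim \<delta> by (intro order_tendstoD(1)[OF Slim]) simp
    then show ?thesis
    proof eventually_elim
      fix n assume n: "L - \<delta> / 2 < S n"
      obtain r where r: "r \<in> V n" "r < L" using cInf_lessD[OF Vne, of n L] Sless[of n] unfolding S_def by blast
      have r0: "0 \<le> r" and rv: "\<phi> (X r \<omega>) \<in> {..<1 / real (Suc n)}" using r(1) by (auto simp: V_def)
      obtain b1 where b1: "r < b1" "\<forall>s. r \<le> s \<and> s < b1 \<longrightarrow> \<phi> (X s \<omega>) \<in> {..<1 / real (Suc n)}"
        using path_nearby[OF w \<phi>c r0 open_lessThan rv] by blast
      have Lv: "\<phi> (X L \<omega>) \<in> {c<..}" using c by simp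
      obtain b2 where b2: "L < b2" "\<forall>s. L \<le> s \<and> s < b2 \<longrightarrow> \<phi> (X s \<omega>) \<in> {c<..}"
        using path_nearby[OF w \<phi>c L0 open_greaterThan Lv] by blast
      have "r < min b1 L" using b1(1) r(2) by simp
      from grid_point_between[OF r0 this zero_less_one]
      obtain k1 where k1: "\<forall>k\<ge>k1. \<exists>j. r \<le> real j * (1 / 2 ^ k) \<and> real j * (1 / 2 ^ k) < min b1 L" by blast
      have "L < min b2 (L + \<delta> / 2)" using b2(1) \<delta> by simp
      from grid_point_between[OF L0 this zero_less_one]
      obtain k2 where k2: "\<forall>k\<ge>k2. \<exists>j. L \<le> real j * (1 / 2 ^ k) \<and> real j * (1 / 2 ^ k) < min b2 (L + \<delta> / 2)" by blast
      show "\<forall>\<^sub>F k in sequentially. \<exists>j l. \<omega> \<in> visit_escape \<phi> (1 / 2 ^ k) (1 / real (Suc n)) c j l \<and>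
          real j * (1 / 2 ^ k) \<le> t \<and> real l * (1 / 2 ^ k) \<le> \<delta>"
        unfolding eventually_sequentially
      proof (rule exI[of _ "max k1 k2"], intro allI impI)
        fix k assume "max k1 k2 \<le> k"
        then have kk: "k1 \<le> k" "k2 \<le> k" by auto
        define d where "d = (1 / 2 ^ k :: real)"
        have d: "0 < d" by (simp add: d_def)
        obtain j1 where j1: "r \<le> real j1 * d" "real j1 * d < min b1 L" using k1 kk(1) unfolding d_def by blast
        obtain i where i: "L \<le> real i * d" "real i * d < min b2 (L + \<delta> / 2)" using k2 kk(2) unfolding d_def by blast
        have "\<phi> (X (real j1 * d) \<omega>) \<in> {..<1 / real (Suc n)}" using b1(2) j1 by simp
        then have j1v: "\<phi> (X (real j1 * d) \<omega>) < 1 / real (Suc n)" by simp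
        have "\<phi> (X (real i * d) \<omega>) \<in> {c<..}" using b2(2) i by simp
        then have iv: "c \<le> \<phi> (X (real i * d) \<omega>)" by simp
        define j where "j = (LEAST j. \<phi> (X (real j * d) \<omega>) < 1 / real (Suc n))"
        have jv: "\<phi> (X (real j * d) \<omega>) < 1 / real (Suc n)" unfolding j_def by (rule LeastI[of _ j1]) (rule j1v)
        have "j \<le> j1" unfolding j_def by (rule Least_le) (rule j1v)
        then have "real j * d \<le> real j1 * d" using d by (intro mult_right_mono) auto
        then have jL: "real j * d < L" using j1(2) by linarith
        have jbefore: "\<forall>l<j. 1 / real (Suc n) \<le> \<phi> (X (real l * d) \<omega>)"
          using not_less_Least[of _ "\<lambda>j. \<phi> (X (real j * d) \<omega>) < 1 / real (Suc n)"] unfolding j_def by (auto simp: not_less)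
        have "real j * d \<in> V n" using jv d by (simp add: V_def)
        then have jS: "L - \<delta> / 2 < real j * d" using Slow n by (meson order_less_le_trans)
        have "real j * d < real i * d" using jL i(1) by linarith
        then have ji: "j \<le> i" using d by simp
        have shift: "real j * d + real (i - j) * d = real i * d" using ji by (simp add: of_nat_diff algebra_simps)
        have ex: "c \<le> \<phi> (X (real j * d + real (i - j) * d) \<omega>)" unfolding shift by (rule iv)
        define l where "l = (LEAST l. c \<le> \<phi> (X (real j * d + real l * d) \<omega>))"
        have lv: "c \<le> \<phi> (X (real j * d + real l * d) \<omega>)" unfolding l_def by (rule LeastI[of _ "i - j"]) (rule ex)
        have "l \<le> i - j" unfolding l_def by (rule Least_le) (rule ex)
        then have "real l * d \<le> real (i - j) * d" using d by (intro mult_right_mono) auto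
        then have ld: "real l * d \<le> \<delta>" using shift i(2) jS by linarith
        have lbefore: "\<forall>l'<l. \<phi> (X (real j * d + real l' * d) \<omega>) < c"
          using not_less_Least[of _ "\<lambda>l. c \<le> \<phi> (X (real j * d + real l * d) \<omega>)"] unfolding l_def by (auto simp: not_le)
        have "\<omega> \<in> visit_escape \<phi> d (1 / real (Suc n)) c j l"
          unfolding visit_escape_def visit_def using w jv jbefore lv lbefore by blast
        moreover have "real j * d \<le> t" using jL Lt by linarith
        ultimately show "\<exists>j l. \<omega> \<in> visit_escape \<phi> (1 / 2 ^ k) (1 / real (Suc n)) c j l \<and>
          real j * (1 / 2 ^ k) \<le> t \<and> real l * (1 / 2 ^ k) \<le> \<delta>" using ld unfolding d_def by blast
      qed
    qed
  qed
  show "\<exists>\<rho>>0. \<forall>c \<delta>. 0 < c \<and> c < \<rho> \<and> 0 < \<delta> \<longrightarrow> (\<forall>\<^sub>F n in sequentially. \<forall>\<^sub>F k in sequentially.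
       \<exists>j l. \<omega> \<in> visit_escape (\<lambda>y. infdist y (closure D - D)) (1 / 2 ^ k) (1 / real (Suc n)) c j l \<and>
          real j * (1 / 2 ^ k) \<le> t \<and> real l * (1 / 2 ^ k) \<le> \<delta>)"
    unfolding C_def[symmetric] \<phi>_def[symmetric, abs_def] using \<rho> main by blast
qed

lemma exit_time_D:
  assumes "ereal t < exit_time X D \<omega>"
  shows "\<exists>u>t. \<forall>s. 0 \<le> s \<and> s < u \<longrightarrow> X s \<omega> \<in> D"
proof -
  obtain u where u: "ereal t < ereal u" "ereal u < exit_time X D \<omega>" using ereal_dense2[OF assms] by blast
  have "X s \<omega> \<in> D" if s: "0 \<le> s" "s < u" for s
  proof (rule ccontr)
    assume "X s \<omega> \<notin> D"
    then have "exit_time X D \<omega> \<le> ereal s" unfolding exit_time_def using s(1) by (intro INF_lower) simp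
    also have "\<dots> < ereal u" using s(2) by simp
    finally show False using u(2) by simp
  qed
  then show ?thesis using u(1) by (intro exI[of _ u]) auto
qed

lemma alive_exit_time:
  assumes "0 \<le> t" "alive 0 t \<omega>" shows "ereal t < exit_time X D \<omega>"
proof -
  obtain m where m: "\<And>r. 0 \<le> r \<Longrightarrow> r < t + 1 / real (Suc m) \<Longrightarrow> X (0 + r) \<omega> \<in> core m"
    using assms(2) unfolding alive_def by blast
  have "ereal (t + 1 / real (Suc m)) \<le> exit_time X D \<omega>"
    unfolding exit_time_def
  proof (rule INF_greatest)
    fix s assume s: "s \<in> {s. 0 \<le> s \<and> X s \<omega> \<notin> D}"
    have "\<not> s < t + 1 / real (Suc m)"
    proof
      assume "s < t + 1 / real (Suc m)"
      then have "X (0 + s) \<omega> \<in> core m" using s by (intro m) auto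
      then show False using s core_subset by auto
    qed
    then show "ereal (t + 1 / real (Suc m)) \<le> ereal s" by simp
  qed
  moreover have "t < t + 1 / real (Suc m)" by simp
  ultimately show ?thesis by (meson less_ereal.simps(1) order_less_le_trans)
qed

text \<open>
  The bad event is covered by iterated lower limits of the events of the preceding lemmas, for a sequence of distances \<open>e p\<close>; for each of them
  the probability is at most \<open>2 * \<eta>\<close> for every positive \<open>\<eta> \<le> 1 / 2\<close>, once the time span \<open>e i\<close> of the escape is small.
\<close>

lemma dead_before_exit_null:
  assumes t: "0 \<le> t"
  shows "\<exists>B\<in>null_sets (Pr x). {\<omega> \<in> space \<A>. ereal t < exit_time X D \<omega> \<and> \<not> alive 0 t \<omega>} \<subseteq> B"
proof -
  define C where "C = closure D - D"
  define Bad where "Bad = {\<omega> \<in> space \<A>. ereal t < exit_time X D \<omega> \<and> \<not> alive 0 t \<omega>}"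
  interpret prob_space "Pr x" by (rule prob_law)
  show ?thesis
  proof (cases "C = {}")
    case True
    have "Bad = {}"
    proof (rule ccontr)
      assume "Bad \<noteq> {}"
      then obtain \<omega> where w: "\<omega> \<in> space \<A>" "ereal t < exit_time X D \<omega>" "\<not> alive 0 t \<omega>" by (auto simp: Bad_def)
      obtain u where u: "t < u" "\<And>s. 0 \<le> s \<Longrightarrow> s < u \<Longrightarrow> X s \<omega> \<in> D" using exit_time_D[OF w(2)] by blast
      show False using boundary_approach(1)[OF w(1) t u w(3)] True by (simp add: C_def)
    qed
    then show ?thesis by (intro bexI[of _ "{}"]) (auto simp: Bad_def)
  next
    case False
    define \<phi> where "\<phi> y = infdist y C" for y
    have \<phi>m: "\<phi> \<in> borel_measurable borel"
      unfolding \<phi>_def by (intro borel_measurable_continuous_onI continuous_intros)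
    obtain r0 where r0: "0 < r0" "compact {y. infdist y C \<le> r0}"
      using compact_neighbourhood[of C UNIV] compact_boundary False by (auto simp: C_def)
    define e where "e p = 1 / real (Suc p)" for p
    have e0: "0 < e p" for p by (simp add: e_def)
    define J where "J k = nat \<lfloor>t * 2 ^ k\<rfloor>" for k :: nat
    define N where "N i k = nat \<lfloor>e i * 2 ^ k\<rfloor>" for i k :: nat
    define A where "A p i n k = (\<Union>j\<le>J k. \<Union>l\<le>N i k. visit_escape \<phi> (1 / 2 ^ k) (e n) (2 * e p) j l)" for p i n k
    define A1 where "A1 p i n = {\<omega> \<in> space (Pr x). \<forall>\<^sub>F k in sequentially. \<omega> \<in> A p i n k}" for p i n
    define A2 where "A2 p i = {\<omega> \<in> space (Pr x). \<forall>\<^sub>F n in sequentially. \<omega> \<in> A1 p i n}" for p i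
    have d2: "real (N i k) * (1 / 2 ^ k) \<le> e i" for i k
    proof -
      have "real (N i k) \<le> e i * 2 ^ k" unfolding N_def using e0[of i] by (intro of_nat_floor) simp
      then show ?thesis by (simp add: field_simps)
    qed
    have Aev: "A p i n k \<in> events" for p i n k
    proof -
      have "visit_escape \<phi> (1 / 2 ^ k) (e n) (2 * e p) j l \<in> events" for j l
      proof -
        have "0 \<le> real j * (1 / 2 ^ k) + real l * (1 / 2 ^ k)" by simp
        moreover have "visit_escape \<phi> (1 / 2 ^ k) (e n) (2 * e p) j l \<in> sets (F (real j * (1 / 2 ^ k) + real l * (1 / 2 ^ k)))"
          by (rule visit_escape_sets[OF \<phi>m]) simp
        ultimately show ?thesis unfolding sets_law by (rule sets_F)
      qed
      then show ?thesis unfolding A_def by auto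
    qed
    have A1ev: "A1 p i n \<in> events" for p i n unfolding A1_def
      by (rule prob_eventually_le(1)[where c = 1 and ?n0.0 = 0, OF Aev]) simp
    have A2ev: "A2 p i \<in> events" for p i unfolding A2_def
      by (rule prob_eventually_le(1)[where c = 1 and ?n0.0 = 0, OF A1ev]) simp
    have A2le: "\<exists>i. prob (A2 p i) \<le> 2 * \<eta>" if p: "2 * e p \<le> r0" and \<eta>: "0 < \<eta>" "\<eta> \<le> 1 / 2" for p \<eta>
    proof -
      define f where "f = bump C (e p)"
      have "compact {y. infdist y C \<le> 2 * e p}"
      proof -
        have "compact ({y. infdist y C \<le> r0} \<inter> {y. infdist y C \<le> 2 * e p})"
          by (intro compact_Int_closed r0 closed_Collect_le continuous_intros)
        moreover have "{y. infdist y C \<le> r0} \<inter> {y. infdist y C \<le> 2 * e p} = {y. infdist y C \<le> 2 * e p}" using p by auto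
        ultimately show ?thesis by simp
      qed
      then have fv: "f \<in> vanishing_on UNIV" unfolding f_def by (rule bump_vanishing[OF e0])
      have fm: "f \<in> borel_measurable borel" unfolding f_def
        by (intro borel_measurable_continuous_onI bump_continuous e0)
      have fb: "bfun f" using fm bump_abs by (auto simp: bfun_def f_def)
      obtain i where i: "\<forall>s y. 0 \<le> s \<and> s \<le> e i \<longrightarrow> \<bar>(\<integral>z. f z \<partial>P s y) - f y\<bar> \<le> \<eta>"
        using short_time_stable[OF fv fm \<eta>(1)] unfolding e_def by blast
      have "prob (A p i n k) \<le> 2 * \<eta>" if n: "p \<le> n" for n k
        unfolding A_def
      proof (rule prob_visit_escape(2)[where f = f and \<delta> = "e i"])
        show "f y = 1" if "\<phi> y < e n" for y
        proof -
          have "e n \<le> e p" using n by (simp add: e_def frac_le)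
          then show ?thesis using that unfolding f_def \<phi>_def by (intro bump_one e0) simp
        qed
        show "f y = 0" if "2 * e p \<le> \<phi> y" for y using that unfolding f_def \<phi>_def by (intro bump_zero e0)
        show "real (N i k) * (1 / 2 ^ k) \<le> e i" by (rule d2)
        show "\<bar>(\<integral>z. f z \<partial>P s y) - f y\<bar> \<le> \<eta>" if "0 \<le> s" "s \<le> e i" for s y using i that by blast
      qed (use \<eta> fb \<phi>m bump_range in \<open>auto simp: f_def\<close>)
      then have "prob (A1 p i n) \<le> 2 * \<eta>" if "p \<le> n" for n
        unfolding A1_def using that by (intro prob_eventually_le(2)[where ?n0.0 = 0] Aev) auto
      then have "prob (A2 p i) \<le> 2 * \<eta>"
        unfolding A2_def by (intro prob_eventually_le(2)[where ?n0.0 = p] A1ev) auto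
      then show ?thesis by blast
    qed
    have null: "(\<Inter>i. A2 p i) \<in> null_sets (Pr x)" if p: "2 * e p \<le> r0" for p
    proof -
      have ev: "(\<Inter>i. A2 p i) \<in> events" using A2ev by auto
      have "prob (\<Inter>i. A2 p i) \<le> 0"
      proof (rule field_le_epsilon)
        fix \<epsilon> :: real assume \<epsilon>: "0 < \<epsilon>"
        define \<eta> where "\<eta> = min (1 / 2) (\<epsilon> / 2)"
        have \<eta>: "0 < \<eta>" "\<eta> \<le> 1 / 2" "2 * \<eta> \<le> \<epsilon>" using \<epsilon> by (auto simp: \<eta>_def)
        obtain i where "prob (A2 p i) \<le> 2 * \<eta>" using A2le[OF p \<eta>(1,2)] by blast
        moreover have "prob (\<Inter>i. A2 p i) \<le> prob (A2 p i)" by (intro finite_measure_mono A2ev) auto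
        ultimately show "prob (\<Inter>i. A2 p i) \<le> 0 + \<epsilon>" using \<eta>(3) by linarith
      qed
      then have "prob (\<Inter>i. A2 p i) = 0" using measure_nonneg[of "Pr x"] by (intro antisym)
      then show ?thesis using ev by (auto simp: null_sets_def emeasure_eq_measure)
    qed
    have "(\<Union>p\<in>{p. 2 * e p \<le> r0}. \<Inter>i. A2 p i) \<in> null_sets (Pr x)"
      using null by (intro null_sets_UN') auto
    moreover have "Bad \<subseteq> (\<Union>p\<in>{p. 2 * e p \<le> r0}. \<Inter>i. A2 p i)"
    proof
      fix \<omega> assume "\<omega> \<in> Bad"
      then have w: "\<omega> \<in> space \<A>" "ereal t < exit_time X D \<omega>" "\<not> alive 0 t \<omega>" by (auto simp: Bad_def)
      obtain u where u: "t < u" "\<And>s. 0 \<le> s \<Longrightarrow> s < u \<Longrightarrow> X s \<omega> \<in> D" using exit_time_D[OF w(2)] by blast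
      obtain \<rho> where \<rho>: "0 < \<rho>" and esc: "\<forall>c \<delta>. 0 < c \<and> c < \<rho> \<and> 0 < \<delta> \<longrightarrow> (\<forall>\<^sub>F n in sequentially. \<forall>\<^sub>F k in sequentially.
         \<exists>j l. \<omega> \<in> visit_escape \<phi> (1 / 2 ^ k) (1 / real (Suc n)) c j l \<and>
          real j * (1 / 2 ^ k) \<le> t \<and> real l * (1 / 2 ^ k) \<le> \<delta>)"
        using boundary_approach(2)[OF w(1) t u w(3)] unfolding C_def[symmetric] \<phi>_def[symmetric, abs_def] by blast
      have "0 < min \<rho> r0 / 2" using \<rho> r0 by simp
      then obtain p where "1 / real (Suc p) < min \<rho> r0 / 2" using nat_approx_posE by blast
      then have p: "2 * e p \<le> r0" "2 * e p < \<rho>" by (auto simp: e_def)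
      have "\<omega> \<in> A2 p i" for i
      proof -
        have "\<forall>\<^sub>F n in sequentially. \<forall>\<^sub>F k in sequentially.
         \<exists>j l. \<omega> \<in> visit_escape \<phi> (1 / 2 ^ k) (1 / real (Suc n)) (2 * e p) j l \<and>
          real j * (1 / 2 ^ k) \<le> t \<and> real l * (1 / 2 ^ k) \<le> e i"
          using esc p(2) e0[of p] e0[of i] by simp
        then have "\<forall>\<^sub>F n in sequentially. \<omega> \<in> A1 p i n"
        proof (rule eventually_mono)
          fix n assume n: "\<forall>\<^sub>F k in sequentially.
            \<exists>j l. \<omega> \<in> visit_escape \<phi> (1 / 2 ^ k) (1 / real (Suc n)) (2 * e p) j l \<and>
            real j * (1 / 2 ^ k) \<le> t \<and> real l * (1 / 2 ^ k) \<le> e i"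
          have "\<forall>\<^sub>F k in sequentially. \<omega> \<in> A p i n k"
            using n
          proof (rule eventually_mono)
            fix k assume "\<exists>j l. \<omega> \<in> visit_escape \<phi> (1 / 2 ^ k) (1 / real (Suc n)) (2 * e p) j l \<and>
              real j * (1 / 2 ^ k) \<le> t \<and> real l * (1 / 2 ^ k) \<le> e i"
            then obtain j l where jl: "\<omega> \<in> visit_escape \<phi> (1 / 2 ^ k) (e n) (2 * e p) j l"
              "real j \<le> t * 2 ^ k" "real l \<le> e i * 2 ^ k" by (auto simp: e_def field_simps)
            have "j \<le> J k" "l \<le> N i k" unfolding J_def N_def using jl(2,3) by (simp_all add: le_nat_floor)
            then show "\<omega> \<in> A p i n k" unfolding A_def using jl(1) by blast
          qed
          then show "\<omega> \<in> A1 p i n" using w(1) by (simp add: A1_def)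
        qed
        then show ?thesis using w(1) by (simp add: A2_def)
      qed
      then show "\<omega> \<in> (\<Union>p\<in>{p. 2 * e p \<le> r0}. \<Inter>i. A2 p i)" using p(1) by blast
    qed
    ultimately show ?thesis unfolding Bad_def by blast
  qed
qed

section \<open>Identification with the killed process and decay of its mass\<close>

text \<open>
  The event that the exit time exceeds \<open>t\<close> differs from \<open>alive 0 t\<close> by a set that is negligible under every law, and hence measurable
  by completeness of the filtration.
\<close>

lemma killed_semigroup_eq:
  assumes t: "0 \<le> t" and f: "f \<in> bounded_measurable_on D"
  shows "killed_semigroup Pr X D t f x = (\<integral>y. f y \<partial>kern t x)"
proof -
  define Bad where "Bad = {\<omega> \<in> space \<A>. ereal t < exit_time X D \<omega> \<and> \<not> alive 0 t \<omega>}"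
  have "Bad \<in> sets (F t)" unfolding Bad_def
    by (rule filtration_complete[OF t], rule dead_before_exit_null[OF t])
  then have BadF: "Bad \<in> sets \<A>" by (rule sets_F[OF t])
  obtain B where B: "B \<in> null_sets (Pr x)" "Bad \<subseteq> B" using dead_before_exit_null[OF t, of x] unfolding Bad_def by blast
  have ae: "AE \<omega> in Pr x. \<omega> \<notin> Bad"
    using AE_not_in[OF B(1)] by eventually_elim (use B(2) in blast)
  define W where "W \<omega> = of_bool (alive 0 t \<omega>) * (indicator D (X t \<omega>) * f (X t \<omega>))" for \<omega>
  have Wm: "W \<in> borel_measurable (Pr x)"
    using bmeas_integrable[OF markov_functionalD(1)[OF markov_kern[OF t f] order_refl], of x] unfolding W_def[abs_def]
    by (simp only: add_0 borel_measurable_integrable)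
  define Z where "Z \<omega> = f (X t \<omega>) * indicator {\<omega>. ereal t < exit_time X D \<omega>} \<omega>" for \<omega>
  have ZW: "Z \<omega> = (if \<omega> \<in> Bad then indicator D (X t \<omega>) * f (X t \<omega>) else W \<omega>)" if w: "\<omega> \<in> space \<A>" for \<omega>
  proof (cases "ereal t < exit_time X D \<omega>")
    case True
    obtain u where u: "t < u" "\<And>s. 0 \<le> s \<Longrightarrow> s < u \<Longrightarrow> X s \<omega> \<in> D" using exit_time_D[OF True] by blast
    have XD: "X t \<omega> \<in> D" using u t by blast
    show ?thesis using True XD w by (cases "alive 0 t \<omega>") (simp_all add: Z_def W_def Bad_def)
  next
    case False
    then have "\<not> alive 0 t \<omega>" using alive_exit_time[OF t] by blast
    then show ?thesis using False by (simp add: Z_def W_def Bad_def)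
  qed
  have gm: "(\<lambda>\<omega>. indicator D (X t \<omega>) * f (X t \<omega>)) \<in> borel_measurable (Pr x)"
    by (rule borel_measurable_integrable, rule bmeas_integrable[OF bfun_X[OF t bfun_extend[OF f]]])
  have "(\<lambda>\<omega>. if \<omega> \<in> Bad then indicator D (X t \<omega>) * f (X t \<omega>) else W \<omega>) \<in> borel_measurable (Pr x)"
    by (rule measurable_If_set[OF gm Wm]) (simp add: sets_law sets.Int_space_eq2[OF BadF] BadF)
  then have Zm: "Z \<in> borel_measurable (Pr x)"
    by (rule measurable_cong[THEN iffD1, rotated]) (simp add: ZW)
  have "(\<integral>\<omega>. Z \<omega> \<partial>Pr x) = (\<integral>\<omega>. W \<omega> \<partial>Pr x)"
  proof (rule integral_cong_AE[OF Zm Wm])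
    show "AE \<omega> in Pr x. Z \<omega> = W \<omega>" using ae AE_space by eventually_elim (simp add: ZW)
  qed
  then show ?thesis unfolding killed_semigroup_def integral_kern[OF t f] Z_def W_def .
qed

lemma kern_one: "0 \<le> t \<Longrightarrow> (\<integral>y. 1 \<partial>kern t x) = measure (kern t x) D"
  by (simp add: space_kern)

lemma const_bounded_measurable: "(\<lambda>_. c) \<in> bounded_measurable_on D"
  by (auto simp: bounded_measurable_on_def image_constant_conv)

lemma escape_probability:
  assumes t: "0 \<le> t" and g: "g \<in> vanishing_on UNIV" "\<forall>y. 0 \<le> g y \<and> g y \<le> 1" "\<forall>y. y \<notin> - closure D \<longrightarrow> g y = 0"
    and cont: "continuous_on UNIV g"
  shows "measure (kern t x) D \<le> 1 - (\<integral>y. g y \<partial>P t x)"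
proof -
  interpret prob_space "Pr x" by (rule prob_law)
  have "\<bar>g y\<bar> \<le> 1" for y using g(2)[rule_format, of y] by linarith
  then have gb: "bfun g" unfolding bfun_def using borel_measurable_continuous_onI[OF cont] by blast
  have one: "bmeasF 0 (\<lambda>_. 1)" by (auto simp: bmeasF_def)
  have "(\<integral>\<omega>. 1 * g (X (0 + t) \<omega>) \<partial>Pr x) = (\<integral>\<omega>. 1 * (\<integral>y. g y \<partial>P t (X 0 \<omega>)) \<partial>Pr x)"
    by (rule simple_markov[OF order_refl t gb one])
  then have eq: "(\<integral>\<omega>. g (X t \<omega>) \<partial>Pr x) = (\<integral>y. g y \<partial>P t x)"
    using integral_starts_at[OF kernel_bfun[OF t gb]] by simp
  have ig: "integrable (Pr x) (\<lambda>\<omega>. g (X t \<omega>))" by (rule bmeas_integrable[OF bfun_X[OF t gb]])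
  have "measure (kern t x) D = (\<integral>\<omega>. of_bool (alive 0 t \<omega>) * (indicator D (X t \<omega>) * 1) \<partial>Pr x)"
    using integral_kern[OF t const_bounded_measurable[of 1], of x] kern_one[OF t] by simp
  also have "\<dots> \<le> (\<integral>\<omega>. 1 - g (X t \<omega>) \<partial>Pr x)"
  proof (rule integral_mono)
    show "integrable (Pr x) (\<lambda>\<omega>. of_bool (alive 0 t \<omega>) * (indicator D (X t \<omega>) * (1::real)))"
      using bmeas_integrable[OF markov_functionalD(1)[OF markov_kern[OF t const_bounded_measurable[of 1]] order_refl]] by simp
    show "integrable (Pr x) (\<lambda>\<omega>. 1 - g (X t \<omega>))" using ig by simp
    fix \<omega>
    show "of_bool (alive 0 t \<omega>) * (indicator D (X t \<omega>) * 1) \<le> 1 - g (X t \<omega>)"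
    proof (cases "X t \<omega> \<in> D")
      case True
      then have "g (X t \<omega>) = 0" using g(3) closure_subset by blast
      then show ?thesis by (simp add: indicator_def)
    next
      case False
      then show ?thesis using g(2) by simp
    qed
  qed
  also have "\<dots> = 1 - (\<integral>y. g y \<partial>P t x)" using ig eq prob_space by simp
  finally show ?thesis .
qed

lemma kern_one_antitone:
  assumes "0 \<le> s" "0 \<le> t" shows "measure (kern (s + t) x) D \<le> measure (kern s x) D"
proof -
  interpret s: subprob_space "kern s x" by (rule subprob_kern[OF assms(1)])
  have m: "measure (kern t y) D \<le> 1" for y using subprob_space.subprob_measure_le_1[OF subprob_kern[OF assms(2)]] .
  have "measure (kern (s + t) x) D = (\<integral>y. measure (kern t y) D \<partial>kern s x)"
    using kern_semigroup[OF assms const_bounded_measurable[of 1], of x] kern_one assms by simp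
  also have "\<dots> \<le> (\<integral>y. 1 \<partial>kern s x)"
  proof (rule integral_mono)
    have "(\<lambda>y. measure (kern t y) D) \<in> bounded_measurable_on D"
      using kern_bounded_measurable[OF assms(2) const_bounded_measurable[of 1]] kern_one[OF assms(2)] by simp
    then have "(\<lambda>y. measure (kern t y) D) \<in> borel_measurable (kern s x)"
      using measurable_cong_sets[OF sets_kern[of s x] refl] unfolding bounded_measurable_on_def by blast
    then show "integrable (kern s x) (\<lambda>y. measure (kern t y) D)"
      using m by (intro s.integrable_const_bound[where B = 1]) auto
  qed (use m in auto)
  finally show ?thesis using kern_one[OF assms(1)] by simp
qed

text \<open>
  The Feller property makes \<open>y \<mapsto> P t y g\<close> continuous, so the escape probability is bounded below near each point of the compact closure of
  \<open>D\<close>. Finitely many neighbourhoods suffice, and the sum of their times serves all of them because the surviving mass decreases.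
\<close>

lemma uniform_escape: "\<exists>T>0. \<exists>\<theta>. 1 / 2 \<le> \<theta> \<and> \<theta> < 1 \<and> (\<forall>x\<in>D. measure (kern T x) D \<le> \<theta>)"
proof -
  define esc where "esc V \<longleftrightarrow> (\<exists>t\<ge>0. \<exists>c>0. \<forall>y\<in>V. measure (kern t y) D \<le> 1 - c)" for V
  have escI: "esc V" if "0 \<le> t" "0 < c" "\<And>y. y \<in> V \<Longrightarrow> measure (kern t y) D \<le> 1 - c" for V t c
    unfolding esc_def using that by (intro exI[of _ t] exI[of _ c] conjI ballI)
  have loc: "\<exists>V. open V \<and> x \<in> V \<and> esc V" if x: "x \<in> closure D" for x
  proof -
    obtain t where t: "0 \<le> t" "0 < measure (P t x) (- closure D)" using accessible_outside[OF x] by blast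
    have "open (- closure D)" by (rule open_Compl[OF closed_closure])
    from charging_bump[OF t(1) this t(2)]
    obtain g where g: "g \<in> vanishing_on UNIV" "\<forall>y. 0 \<le> g y \<and> g y \<le> 1" "\<forall>y. y \<notin> - closure D \<longrightarrow> g y = 0"
      and pos: "0 < (\<integral>y. g y \<partial>P t x)" by (elim bexE conjE) (rule that)
    define p where "p y = (\<integral>z. g z \<partial>P t y)" for y
    define V where "V = {y. p x / 2 < p y}"
    have "continuous_on UNIV p" unfolding p_def by (rule vanishing_on_bounds(1)[OF feller[OF t(1) g(1)]])
    then have oV: "open V" unfolding V_def by (intro open_Collect_less continuous_on_const)
    have px: "0 < p x / 2" using pos by (simp add: p_def)
    have "esc V"
    proof (rule escI[OF t(1) px])
      fix y assume "y \<in> V"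
      then show "measure (kern t y) D \<le> 1 - p x / 2"
        using escape_probability[OF t(1) g vanishing_on_bounds(1)[OF g(1)], of y] by (simp add: p_def V_def)
    qed
    moreover have "x \<in> V" using px by (simp add: V_def)
    ultimately show ?thesis using oV by (intro exI[of _ V] conjI)
  qed
  define \<U> where "\<U> = {V. open V \<and> esc V}"
  have "closure D \<subseteq> \<Union>\<U>"
  proof
    fix x assume "x \<in> closure D"
    from loc[OF this] obtain V where "open V \<and> x \<in> V \<and> esc V" by (elim exE)
    then show "x \<in> \<Union>\<U>" unfolding \<U>_def by (intro UnionI[of V]) simp_all
  qed
  moreover have "\<And>V. V \<in> \<U> \<Longrightarrow> open V" by (simp add: \<U>_def)
  ultimately obtain \<V> where V: "\<V> \<subseteq> \<U>" "finite \<V>" "closure D \<subseteq> \<Union>\<V>"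
    using compactE[OF compact_closure, of \<U>] by metis
  have "esc (\<Union>\<V>)" using V(2,1)
  proof (induction rule: finite_induct)
    case empty
    show ?case by (rule escI[of 0 1]) simp_all
  next
    case (insert V \<W>)
    have "esc V" using insert.prems by (simp add: \<U>_def)
    then obtain t c where t: "0 \<le> t" "0 < c" "\<forall>y\<in>V. measure (kern t y) D \<le> 1 - c"
      unfolding esc_def by (elim exE conjE) (rule that)
    have "esc (\<Union>\<W>)" using insert by simp
    then obtain t' c' where t': "0 \<le> t'" "0 < c'" "\<forall>y\<in>\<Union>\<W>. measure (kern t' y) D \<le> 1 - c'"
      unfolding esc_def by (elim exE conjE) (rule that)
    show ?case
    proof (rule escI[of "t + t'" "min c c'"])
      fix y assume "y \<in> \<Union>(insert V \<W>)"
      then consider "y \<in> V" | "y \<in> \<Union>\<W>" by auto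
      then show "measure (kern (t + t') y) D \<le> 1 - min c c'"
      proof cases
        case 1
        have "measure (kern (t + t') y) D \<le> measure (kern t y) D" by (rule kern_one_antitone[OF t(1) t'(1)])
        also have "\<dots> \<le> 1 - c" using t(3) 1 by (rule bspec)
        finally show ?thesis by linarith
      next
        case 2
        have "measure (kern (t' + t) y) D \<le> measure (kern t' y) D" by (rule kern_one_antitone[OF t'(1) t(1)])
        also have "\<dots> \<le> 1 - c'" using t'(3) 2 by (rule bspec)
        finally show ?thesis by (simp add: add.commute)
      qed
    qed (use t t' in auto)
  qed
  then obtain T c where T: "0 \<le> T" "0 < c" "\<forall>y\<in>\<Union>\<V>. measure (kern T y) D \<le> 1 - c"
    unfolding esc_def by (elim exE conjE) (rule that)
  have "measure (kern (T + 1) x) D \<le> max (1 / 2) (1 - c)" if x: "x \<in> D" for x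
  proof -
    have "x \<in> \<Union>\<V>" using V(3) closure_subset x by blast
    have "measure (kern (T + 1) x) D \<le> measure (kern T x) D" by (rule kern_one_antitone[OF T(1)]) simp
    also have "\<dots> \<le> 1 - c" using T(3) \<open>x \<in> \<Union>\<V>\<close> by (rule bspec)
    finally show ?thesis by simp
  qed
  moreover have "0 < T + 1" "1 / 2 \<le> max (1 / 2) (1 - c)" "max (1 / 2) (1 - c) < 1" using T by auto
  ultimately show ?thesis by blast
qed

lemma survival_decay: "\<exists>E c. 0 \<le> E \<and> 0 < c \<and> (\<forall>t\<ge>0. \<forall>x\<in>D. measure (kern t x) D \<le> E * exp (- c * t))"
proof -
  obtain T \<theta> where T: "0 < T" and \<theta>: "1 / 2 \<le> \<theta>" "\<theta> < 1" and step: "\<And>x. x \<in> D \<Longrightarrow> measure (kern T x) D \<le> \<theta>"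
    using uniform_escape by blast
  have iter: "measure (kern (real n * T) x) D \<le> \<theta> ^ n" if "x \<in> D" for n x
    using that
  proof (induction n arbitrary: x)
    case 0
    then show ?case using subprob_space.subprob_measure_le_1[OF subprob_kern[OF order_refl]] by simp
  next
    case (Suc n)
    have nT: "0 \<le> real n * T" using T by simp
    interpret s: subprob_space "kern T x" by (rule subprob_kern) (use T in simp)
    have "measure (kern (real (Suc n) * T) x) D = (\<integral>y. measure (kern (real n * T) y) D \<partial>kern T x)"
      using kern_semigroup[OF less_imp_le[OF T] nT const_bounded_measurable[of 1], of x] kern_one[OF nT] kern_one[of "T + real n * T" x] T
      by (simp add: algebra_simps)
    also have "\<dots> \<le> (\<integral>y. \<theta> ^ n \<partial>kern T x)"
    proof (rule integral_mono)
      have "(\<lambda>y. measure (kern (real n * T) y) D) \<in> bounded_measurable_on D"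
        using kern_bounded_measurable[OF nT const_bounded_measurable[of 1]] kern_one[OF nT] by simp
      then have "(\<lambda>y. measure (kern (real n * T) y) D) \<in> borel_measurable (kern T x)"
        using measurable_cong_sets[OF sets_kern[of T x] refl] unfolding bounded_measurable_on_def by blast
      then show "integrable (kern T x) (\<lambda>y. measure (kern (real n * T) y) D)"
        using Suc.IH \<theta> by (intro s.integrable_const_bound[where B = "\<theta> ^ n"]) (auto simp: space_kern)
    qed (use Suc.IH in \<open>auto simp: space_kern\<close>)
    also have "\<dots> = \<theta> ^ n * measure (kern T x) D" by (simp add: space_kern)
    also have "\<dots> \<le> \<theta> ^ n * \<theta>" using step[OF Suc.prems] \<theta> by (intro mult_left_mono) auto
    finally show ?case by (simp add: mult.commute)
  qed
  define c where "c = - ln \<theta> / T"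
  have c: "0 < c" using \<theta> T by (simp add: c_def divide_neg_pos)
  have "measure (kern t x) D \<le> 2 * exp (- c * t)" if t: "0 \<le> t" and x: "x \<in> D" for t x
  proof -
    define n where "n = nat \<lfloor>t / T\<rfloor>"
    have "real n \<le> t / T" "t / T < real n + 1" using t T by (auto simp: n_def)
    then have n: "real n * T \<le> t" "t - T \<le> real n * T" using T by (auto simp: field_simps)
    have "measure (kern (real n * T + (t - real n * T)) x) D \<le> measure (kern (real n * T) x) D"
      using n T by (intro kern_one_antitone) auto
    also have "\<dots> \<le> \<theta> ^ n" by (rule iter[OF x])
    also have "\<theta> ^ n = exp (real n * ln \<theta>)" using \<theta> by (simp add: exp_of_nat_mult)
    also have "\<dots> = exp (- c * (real n * T))" using T by (simp add: c_def)
    also have "\<dots> \<le> exp (- c * t + c * T)"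
      using mult_left_mono[OF n(2) less_imp_le[OF c]] by (simp add: algebra_simps)
    also have "\<dots> = exp (- c * t) * exp (c * T)" by (rule exp_add)
    also have "exp (c * T) = 1 / \<theta>" using T \<theta> by (simp add: c_def exp_minus field_simps)
    also have "exp (- c * t) * (1 / \<theta>) \<le> exp (- c * t) * 2"
      using \<theta> by (intro mult_left_mono) (auto simp: field_simps)
    finally show ?thesis by (simp add: mult.commute)
  qed
  then show ?thesis using c by (intro exI[of _ 2] exI[of _ c]) auto
qed

text \<open>
  At time 0 the killed kernel multiplies by the probability of not leaving \<open>D\<close> immediately. As \<open>D\<close> is open only relative to its closure,
  this probability need not be 1.
\<close>

lemma integral_kern_0:
  assumes f: "f \<in> bounded_measurable_on D" and x: "x \<in> D"
  shows "(\<integral>y. f y \<partial>kern 0 x) = f x * measure (kern 0 x) D"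
proof -
  have m: "(\<lambda>\<omega>. of_bool (alive 0 0 \<omega>) * (indicator D (X 0 \<omega>) * g (X 0 \<omega>))) \<in> borel_measurable (Pr x)"
    if "g \<in> bounded_measurable_on D" for g
    using bmeas_integrable[OF markov_functionalD(1)[OF markov_kern[OF order_refl that] order_refl], of x]
    by (simp only: add_0_right borel_measurable_integrable)
  have "(\<integral>y. f y \<partial>kern 0 x) = (\<integral>\<omega>. of_bool (alive 0 0 \<omega>) * (indicator D (X 0 \<omega>) * f (X 0 \<omega>)) \<partial>Pr x)"
    by (rule integral_kern[OF order_refl f])
  also have "\<dots> = (\<integral>\<omega>. f x * (of_bool (alive 0 0 \<omega>) * (indicator D (X 0 \<omega>) * 1)) \<partial>Pr x)"
  proof (rule integral_cong_AE[OF m[OF f]])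
    show "(\<lambda>\<omega>. f x * (of_bool (alive 0 0 \<omega>) * (indicator D (X 0 \<omega>) * 1))) \<in> borel_measurable (Pr x)"
      by (rule borel_measurable_times[OF borel_measurable_const m[OF const_bounded_measurable]])
    show "AE \<omega> in Pr x. of_bool (alive 0 0 \<omega>) * (indicator D (X 0 \<omega>) * f (X 0 \<omega>)) =
        f x * (of_bool (alive 0 0 \<omega>) * (indicator D (X 0 \<omega>) * 1))"
      using starts_at by eventually_elim simp
  qed
  also have "\<dots> = f x * (\<integral>\<omega>. of_bool (alive 0 0 \<omega>) * (indicator D (X 0 \<omega>) * 1) \<partial>Pr x)"
    by (rule integral_mult_right_zero)
  also have "(\<integral>\<omega>. of_bool (alive 0 0 \<omega>) * (indicator D (X 0 \<omega>) * 1) \<partial>Pr x) = (\<integral>y. (1::real) \<partial>kern 0 x)"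
    by (rule integral_kern[OF order_refl const_bounded_measurable, symmetric])
  also have "(\<integral>y. (1::real) \<partial>kern 0 x) = measure (kern 0 x) D" by (rule kern_one[OF order_refl])
  finally show ?thesis .
qed

lemma green_eq:
  assumes f: "f \<in> bounded_measurable_on D"
  shows "green Pr X D f x = (\<integral>t. indicator {0..} t *\<^sub>R (\<integral>y. f y \<partial>kern t x) \<partial>lborel)"
  unfolding green_def set_lebesgue_integral_def
  by (rule Bochner_Integration.integral_cong[OF refl]) (simp add: indicator_def killed_semigroup_eq[OF _ f])

lemma killed_kernel_eq:
  assumes t: "0 \<le> t" and A: "A \<inter> D \<in> sets (restrict_space borel D)"
  shows "killed_kernel Pr X D t x A = measure (kern t x) (A \<inter> D)"
proof -
  have "A \<inter> D \<inter> space (kern t x) = A \<inter> D" by (auto simp: space_kern)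
  then show ?thesis
    unfolding killed_kernel_def killed_semigroup_eq[OF t indicator_bounded_measurable[OF A]]
    by simp
qed

text \<open>
  The semigroup property at time 0 forces the probability of not leaving \<open>D\<close> immediately to be 0 or 1, and a positive eigenfunction
  of the Green operator excludes 0.
\<close>

lemma kern_0_total:
  assumes h: "positive_right_eigenfunction Pr X D h" and x: "x \<in> D"
  shows "measure (kern 0 x) D = 1"
proof -
  define p where "p y = measure (kern 0 y) D" for y
  obtain \<kappa> where hB: "h \<in> bounded_measurable_on D" and hx: "0 < h x" and \<kappa>: "0 < \<kappa>"
    and eig: "green Pr X D h x = 1 / \<kappa> * h x"
    using h x unfolding positive_right_eigenfunction_def by blast
  have "p \<in> bounded_measurable_on D" using kern_bounded_measurable[OF order_refl const_bounded_measurable[of 1]] unfolding kern_one[OF order_refl] p_def .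
  then have "(\<integral>y. p y \<partial>kern 0 x) = p x * p x" using integral_kern_0[OF _ x, of p] by (simp add: p_def)
  moreover have "(\<integral>y. (\<integral>z. 1 \<partial>kern 0 y) \<partial>kern 0 x) = p x"
    using kern_semigroup[OF order_refl order_refl const_bounded_measurable[of 1], of x] kern_one[OF order_refl, of x] by (simp add: p_def)
  ultimately have "p x * p x = p x" unfolding kern_one[OF order_refl] p_def by simp
  moreover have "p x \<noteq> 0"
  proof
    assume p0: "p x = 0"
    have "(\<integral>y. h y \<partial>kern t x) = 0" if t: "0 \<le> t" for t
    proof -
      interpret subprob_space "kern t x" by (rule subprob_kern[OF t])
      have "measure (kern t x) D = 0"
        using kern_one_antitone[OF order_refl t, of x] p0 by (simp add: p_def measure_le_0_iff)
      then have "emeasure (kern t x) (space (kern t x)) = 0"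
        using emeasure_eq_measure[of D] by (simp add: space_kern)
      then have "space (kern t x) \<in> null_sets (kern t x)" by (simp add: null_sets_def)
      then have "AE y in kern t x. h y = 0" by (rule AE_I') auto
      then show ?thesis by (rule integral_eq_zero_AE)
    qed
    then have "(\<lambda>t. indicator {0..} t *\<^sub>R (\<integral>y. h y \<partial>kern t x)) = (\<lambda>_. 0)" by (auto simp: fun_eq_iff indicator_def)
    then have "green Pr X D h x = 0" unfolding green_eq[OF hB] by simp
    then show False using eig hx \<kappa> by simp
  qed
  ultimately show ?thesis by (simp add: p_def)
qed

end

section \<open>The convergence theorem\<close>

theorem theorem2p16:
  fixes P :: "real \<Rightarrow> 'a::{metric_space, second_countable_topology} \<Rightarrow> 'a measure"
    and \<A> :: "'w measure" and F :: "real \<Rightarrow> 'w measure"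
    and Pr :: "'a \<Rightarrow> 'w measure" and X :: "real \<Rightarrow> 'w \<Rightarrow> 'a"
    and D U :: "'a set" and h :: "'a \<Rightarrow> real" and \<xi> :: "'a measure" and T :: real
  assumes setting: "killed_feller_process P \<A> F Pr X D"
    and green_C0: "\<And>f. f \<in> bounded_continuous_on D \<Longrightarrow> green Pr X D f \<in> vanishing_on D"
    and h_C0: "h \<in> vanishing_on D"
    and h_eigen: "positive_right_eigenfunction Pr X D h"
    and U_open: "open U"
    and U_accessible: "\<And>x. x \<in> D \<Longrightarrow> D_accessible_from Pr X D U x"
    and xi_on_D: "sets \<xi> = sets (restrict_space borel D)"
    and xi_nontrivial: "emeasure \<xi> D \<noteq> 0"
    and T_pos: "T > 0"
    and minorization: "\<And>x A. x \<in> U \<inter> D \<Longrightarrow> A \<in> sets (restrict_space borel D) \<Longrightarrow>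
          emeasure \<xi> A \<le> ennreal (killed_kernel Pr X D T x A)"
  shows "\<exists>\<mu>. quasi_stationary_distribution Pr X D \<mu> \<and>
          (\<exists>C>0. \<exists>\<alpha>>0. \<forall>\<rho>\<in>prob_measures_on D. \<forall>t\<ge>0.
             tv_dist_on D (\<lambda>A. killed_law Pr X D \<rho> t A / killed_law Pr X D \<rho> t D) (measure \<mu>)
               \<le> ereal (C / (\<integral>x. h x \<partial>\<rho>) * exp (- \<alpha> * t)))"
proof -
  interpret process: killed_feller_process P \<A> F Pr X D by (rule setting)
  let ?K = process.kern
  obtain \<kappa> where h_pos: "\<And>x. x \<in> D \<Longrightarrow> 0 < h x" and \<kappa>: "0 < \<kappa>"
    and hG: "\<And>x. x \<in> D \<Longrightarrow> green Pr X D h x = 1 / \<kappa> * h x" and hB: "h \<in> bounded_measurable_on D"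
    using h_eigen unfolding positive_right_eigenfunction_def by blast
  obtain E c where E: "0 \<le> E" "0 < c" "\<forall>t\<ge>0. \<forall>x\<in>D. measure (?K t x) D \<le> E * exp (- c * t)"
    using process.survival_decay by (elim exE conjE) (rule that)
  interpret transient_kernels D ?K E c
  proof
    show "D \<noteq> {}" by (rule process.nonempty)
    show "?K t \<in> restrict_space borel D \<rightarrow>\<^sub>M subprob_algebra (restrict_space borel D)" if "0 \<le> t" for t
      by (rule process.kern_measurable[OF that])
    show "(\<integral>y. f y \<partial>?K 0 x) = f x" if "x \<in> D" "f \<in> bounded_measurable_on D" for f x
      using process.integral_kern_0[OF that(2,1)] process.kern_0_total[OF h_eigen that(1)] by simp
    show "(\<integral>y. f y \<partial>?K (s + t) x) = (\<integral>y. (\<integral>z. f z \<partial>?K t y) \<partial>?K s x)"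
      if "0 \<le> s" "0 \<le> t" "x \<in> D" "f \<in> bounded_measurable_on D" for s t x f
      by (rule process.kern_semigroup[OF that(1,2,4)])
    show "((\<lambda>s. \<integral>y. f y \<partial>?K s x) \<longlongrightarrow> (\<integral>y. f y \<partial>?K t x)) (at_right t)"
      if "0 \<le> t" "x \<in> D" "f \<in> bounded_continuous_on D" for t x f
      by (rule process.kern_right_continuous[OF that(1,3)])
    show "measure (?K t x) D \<le> E * exp (- c * t)" if "0 \<le> t" "x \<in> D" for t x using E(3) that by blast
  qed (fact E)+
  have G_green: "G f = green Pr X D f" if "f \<in> bounded_measurable_on D" for f
    unfolding G_def[abs_def] flow_def Q_def process.green_eq[OF that] ..
  have killed_kernel: "killed_kernel Pr X D t x A = measure (?K t x) A"
    if "0 \<le> t" "A \<in> sets (restrict_space borel D)" for t x A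
  proof -
    have "A \<subseteq> D" using sets.sets_into_space[OF that(2)] by (simp add: space_restrict_space)
    then show ?thesis using process.killed_kernel_eq[OF that(1), of A x] that(2) by (simp add: Int_absorb2)
  qed
  have UD: "U \<inter> D \<in> sets (restrict_space borel D)" using U_open by (auto simp: sets_restrict_space)
  have "harris D ?K h \<kappa> \<xi>"
  proof (rule harris_from_green)
    show "G f \<in> vanishing_on D" if "f \<in> bounded_continuous_on D" for f
      using green_C0[OF that] unfolding G_green[OF BC_BM[OF that]] .
    show "G h x = 1 / \<kappa> * h x" if "x \<in> D" for x using hG[OF that] unfolding G_green[OF hB] .
    show "\<exists>t\<ge>0. 0 < measure (?K t x) (U \<inter> D)" if x: "x \<in> D" for x
    proof -
      obtain t where "0 \<le> t" "0 < killed_kernel Pr X D t x U"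
        using U_accessible[OF x] unfolding D_accessible_from_def by blast
      then show ?thesis using process.killed_kernel_eq[OF _ UD] by (intro exI[of _ t]) simp
    qed
    show "emeasure \<xi> A \<le> emeasure (?K T x) A" if "x \<in> U \<inter> D" "A \<in> sets (restrict_space borel D)" for x A
    proof -
      interpret subprob_space "?K T x" using T_pos by (intro process.subprob_kern) simp
      show ?thesis using minorization[OF that] killed_kernel[OF less_imp_le[OF T_pos] that(2)] by (simp add: emeasure_eq_measure)
    qed
  qed (fact h_C0 h_pos \<kappa> U_open xi_on_D xi_nontrivial T_pos)+
  then interpret harris D ?K h \<kappa> \<xi> .
  obtain x0 where x0: "x0 \<in> D" using process.nonempty by blast
  obtain \<Lambda> C \<alpha> where \<Lambda>: "0 \<le> C" "0 < \<alpha>" "\<forall>f\<in>BM. \<forall>F\<ge>0. (\<forall>x\<in>D. \<bar>f x\<bar> \<le> F) \<longrightarrow>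
     (\<forall>t\<ge>0. \<forall>x\<in>D. \<bar>B t f x * h x0 - \<Lambda> f * h x\<bar> \<le> C * F * exp (- \<alpha> * t))"
    using rank_one_limit[OF x0] by (elim exE conjE) (rule that)
  interpret harris_limit D ?K h \<kappa> \<xi> x0 \<Lambda> C \<alpha>
    by unfold_locales (use x0 \<Lambda> in blast)+
  have law: "killed_law Pr X D \<rho> t A = (\<integral>x. Q t (indicator A) x \<partial>\<rho>)"
    if "0 \<le> t" "A \<in> sets (restrict_space borel D)" for \<rho> t A
  proof -
    have "Q t (indicator A) x = killed_kernel Pr X D t x A" for x
    proof -
      have "A \<inter> space (?K t x) = A" using sets.sets_into_space[OF that(2)] by (auto simp: process.space_kern space_restrict_space)
      then show ?thesis by (simp add: Q_def killed_kernel[OF that])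
    qed
    then show ?thesis by (simp add: killed_law_def)
  qed
  have law_D: "killed_law Pr X D \<rho> t D = (\<integral>x. Q t (\<lambda>_. 1) x \<partial>\<rho>)" if "0 \<le> t" for \<rho> t
    unfolding killed_law_def killed_kernel[OF that D_sets] by (simp add: Q_def process.space_kern)
  obtain C' where C': "0 < C'" and attracts: "\<forall>\<rho>\<in>prob_measures_on D. \<forall>t\<ge>0. \<forall>A\<in>sets (restrict_space borel D).
     \<bar>(\<integral>x. Q t (indicator A) x \<partial>\<rho>) / (\<integral>x. Q t (\<lambda>_. 1) x \<partial>\<rho>) - measure \<mu> A\<bar>
       \<le> C' / (\<integral>x. h x \<partial>\<rho>) * exp (- \<alpha> * t)"
    using \<mu>_attracts by (elim exE conjE) (rule that)
  have "quasi_stationary_distribution Pr X D \<mu>"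
    unfolding quasi_stationary_distribution_def
  proof (intro conjI exI[of _ \<kappa>] allI impI ballI)
    fix t :: real and A assume t: "0 \<le> t" and A: "A \<in> sets (restrict_space borel D)"
    have "A \<inter> space \<mu> = A" using sets.sets_into_space[OF A] by (auto simp: space_\<mu> space_restrict_space)
    then show "killed_law Pr X D \<mu> t A = exp (- \<kappa> * t) * measure \<mu> A"
      unfolding law[OF t A] \<mu>_quasi_stationary[OF t BM_indicator[OF A]] by simp
  qed (fact \<mu>_prob \<kappa>)+
  moreover have "tv_dist_on D (\<lambda>A. killed_law Pr X D \<rho> t A / killed_law Pr X D \<rho> t D) (measure \<mu>)
      \<le> ereal (C' / (\<integral>x. h x \<partial>\<rho>) * exp (- \<alpha> * t))" if "\<rho> \<in> prob_measures_on D" "0 \<le> t" for \<rho> t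
    unfolding tv_dist_on_def
  proof (rule SUP_least)
    fix A assume A: "A \<in> sets (restrict_space borel D)"
    show "ereal \<bar>killed_law Pr X D \<rho> t A / killed_law Pr X D \<rho> t D - measure \<mu> A\<bar>
      \<le> ereal (C' / (\<integral>x. h x \<partial>\<rho>) * exp (- \<alpha> * t))"
      unfolding law[OF that(2) A] law_D[OF that(2)] ereal_less_eq using attracts that A by blast
  qed
  ultimately show ?thesis using C' \<Lambda>(2) by blast
qed

end
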